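(* Let $(R,\mathfrak{m})$ be a Cohen--Macaulay local ring of prime characteristic $p$ and of dimension $d>0$. Let $H := H^d_{\mathfrak{m}}(R)$ with its natural structure of left $R[x,f]$-module (which is Artinian as an $R$-module), let $m_0$ be the HSL-number of $H$ (the smallest $e\in\mathbb{N}_0$ with $x^e\Gamma_x(H)=0$; such $e$ exists), and let $q_0 := p^{m_0}$. Let $G := H/\Gamma_x(H)$, an $x$-torsion-free left $R[x,f]$-module. Then the set $\mathcal{I}(G)$ of $G$-special $R$-ideals contains a uniquely determined smallest ideal $\mathfrak{b}$ among its members of height at least $1$ (i.e. $\operatorname{height}\mathfrak{b}\ge 1$ and $\mathfrak{b}\subseteq \mathfrak{c}$ for every $\mathfrak{c}\in\mathcal{I}(G)$ of height $\geq 1$). Moreover, for every $c\in\mathfrak{b}\cap R^{\circ}$, the element $c^{q_0}$ is a $q_0$-weak parameter test element for $R$; in particular $R$ has a $q_0$-weak parameter test element. Furthermore the weak parameter test ideal $\sigma'(R)$ satisfies $\mathfrak{b}^{[q_0]}\subseteq \sigma'(R)\subseteq \mathfrak{b}$.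
   Context: $R$ is a commutative Noetherian ring of prime characteristic $p$ (no excellence assumption). $f:R\to R$ is the Frobenius map $r\mapsto r^p$. $R[x,f]$ is the Frobenius skew polynomial ring: as a left $R$-module it is free on $(x^i)_{i\in\mathbb{N}_0}$, with multiplication subject to $xr=r^px$ for $r\in R$; it is graded with $n$-th component $Rx^n$. The graded two-sided ideals of $R[x,f]$ are exactly the sets $\bigoplus_{n}\mathfrak{b}_nx^n$ for ascending chains $(\mathfrak{b}_n)$ of ideals of $R$. For a left $R[x,f]$-module $M$, $\Gamma_x(M)=\{m: x^jm=0 \text{ for some } j\in\mathbb{N}\}$; $M$ is $x$-torsion-free if $xm=0$ implies $m=0$. The graded annihilator $\operatorname{grann}_{R[x,f]}M$ is the set of $\sum_i r_ix^i$ with each $r_ix^i$ annihilating $M$. For an $x$-torsion-free $G$, an ideal $\mathfrak{b}$ of $R$ is $G$-special if there is an $R[x,f]$-submodule $N$ of $G$ with $\operatorname{grann}_{R[x,f]}N=\bigoplus_{n\in\mathbb{N}_0}\mathfrak{b}x^n$; $\mathcal{I}(G)$ denotes the set of these; the ideal $R$ has height $\infty$. The left $R[x,f]$-module structure of $H^d_{\mathfrak{m}}(R)$: representing it as the $d$-th cohomology of the Čech complex on a system of parameters $a_1,\dots,a_d$, one has $x[r/(a_1\cdots a_d)^j]=[r^p/(a_1\cdots a_d)^{jp}]$ (independent of choice of parameters). $R^{\circ}$ is the complement of the union of the minimal primes of $R$; $\mathfrak{a}^{[p^n]}$ is the ideal generated by $p^n$-th powers of elements of $\mathfrak{a}$;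 $r\in\mathfrak{a}^*$ (tight closure) iff there is $c\in R^\circ$ with $cr^{p^n}\in\mathfrak{a}^{[p^n]}$ for all $n\gg0$. A parameter ideal is a proper ideal generated by $\operatorname{height}\mathfrak{a}$ elements. A $p^{w_0}$-weak parameter test element is $c'\in R^\circ$ such that for every parameter ideal $\mathfrak{a}$ and $r\in R$: $r\in\mathfrak{a}^*$ iff $c'r^{p^n}\in\mathfrak{a}^{[p^n]}$ for all $n\ge w_0$. The weak parameter test ideal $\sigma'(R)$ is the ideal generated by $0$ and all $p^{w}$-weak parameter test elements for all $w\in\mathbb{N}_0$. *)

theory Defs
  imports Main "HOL-Library.Extended_Nat" "HOL-Computational_Algebra.Primes"
begin

definition is_ideal :: "'a::comm_ring_1 set \<Rightarrow> bool" where
  "is_ideal I \<longleftrightarrow> 0 \<in> I \<and> (\<forall>x\<in>I. \<forall>y\<in>I. x + y \<in> I) \<and> (\<forall>r. \<forall>x\<in>I. r * x \<in> I)"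

definition ideal_gen :: "'a::comm_ring_1 set \<Rightarrow> 'a set" where
  "ideal_gen S = \<Inter> {I. is_ideal I \<and> S \<subseteq> I}"

definition prime_ideal :: "'a::comm_ring_1 set \<Rightarrow> bool" where
  "prime_ideal P \<longleftrightarrow> is_ideal P \<and> P \<noteq> UNIV \<and> (\<forall>x y. x * y \<in> P \<longrightarrow> x \<in> P \<or> y \<in> P)"

definition maximal_ideal :: "'a::comm_ring_1 set \<Rightarrow> bool" where
  "maximal_ideal M \<longleftrightarrow> is_ideal M \<and> M \<noteq> UNIV \<and>
     (\<forall>I. is_ideal I \<and> M \<subseteq> I \<longrightarrow> I = M \<or> I = UNIV)"

definition noetherian_ring :: "'a::comm_ring_1 itself \<Rightarrow> bool" where
  "noetherian_ring _ \<longleftrightarrow> (\<forall>I::'a set. is_ideal I \<longrightarrow> (\<exists>S. finite S \<and> I = ideal_gen S))"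

definition local_ring :: "'a::comm_ring_1 set \<Rightarrow> bool" where
  "local_ring m \<longleftrightarrow> maximal_ideal m \<and> (\<forall>M. maximal_ideal M \<longrightarrow> M = m)"

definition prime_height :: "'a::comm_ring_1 set \<Rightarrow> enat" where
  "prime_height P = Sup {enat n | n. \<exists>c. (\<forall>i\<le>n. prime_ideal (c i)) \<and>
                          (\<forall>i<n. c i \<subset> c (Suc i)) \<and> c n = P}"

text \<open>Height of an ideal: infimum of heights of primes containing it (R itself has height \<infinity>).\<close>
definition ideal_height :: "'a::comm_ring_1 set \<Rightarrow> enat" where
  "ideal_height I = (INF P \<in> {P. prime_ideal P \<and> I \<subseteq> P}. prime_height P)"

definition radical :: "'a::comm_ring_1 set \<Rightarrow> 'a set" where
  "radical I = {r. \<exists>n. r ^ n \<in> I}"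

definition regular_seq :: "'a::comm_ring_1 list \<Rightarrow> bool" where
  "regular_seq xs \<longleftrightarrow> ideal_gen (set xs) \<noteq> UNIV \<and>
     (\<forall>i<length xs. \<forall>y. xs ! i * y \<in> ideal_gen (set (take i xs)) \<longrightarrow> y \<in> ideal_gen (set (take i xs)))"

definition CM_local :: "'a::comm_ring_1 set \<Rightarrow> nat \<Rightarrow> bool" where
  "CM_local m d \<longleftrightarrow> local_ring m \<and> ideal_height m = enat d \<and>
     (\<exists>xs. length xs = d \<and> set xs \<subseteq> m \<and> regular_seq xs)"

definition sop :: "'a::comm_ring_1 set \<Rightarrow> nat \<Rightarrow> 'a list \<Rightarrow> bool" where
  "sop m d as \<longleftrightarrow> length as = d \<and> set as \<subseteq> m \<and> m \<subseteq> radical (ideal_gen (set as))"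

section \<open>H^d_m(R) via the Cech complex on a system of parameters as = a_1..a_d\<close>

text \<open>A pair (r,j) represents the class [r/(a_1\<cdots>a_d)^j] in H^d_m(R) = lim_j R/(a_1^j,...,a_d^j).\<close>

definition prodpow :: "'a::comm_ring_1 list \<Rightarrow> nat \<Rightarrow> 'a" where
  "prodpow as j = prod_list (map (\<lambda>a. a ^ j) as)"

definition powideal :: "'a::comm_ring_1 list \<Rightarrow> nat \<Rightarrow> 'a set" where
  "powideal as l = ideal_gen ((\<lambda>a. a ^ l) ` set as)"

definition hzero :: "'a::comm_ring_1 list \<Rightarrow> 'a \<times> nat \<Rightarrow> bool" where
  "hzero as h \<longleftrightarrow> (\<exists>l\<ge>snd h. prodpow as (l - snd h) * fst h \<in> powideal as l)"

definition hadd :: "'a::comm_ring_1 list \<Rightarrow> 'a \<times> nat \<Rightarrow> 'a \<times> nat \<Rightarrow> 'a \<times> nat" where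
  "hadd as h h' = (prodpow as (snd h') * fst h + prodpow as (snd h) * fst h', snd h + snd h')"

definition hsmul :: "'a::comm_ring_1 \<Rightarrow> 'a \<times> nat \<Rightarrow> 'a \<times> nat" where
  "hsmul t h = (t * fst h, snd h)"

definition hx :: "nat \<Rightarrow> 'a::comm_ring_1 \<times> nat \<Rightarrow> 'a \<times> nat" where
  "hx p h = (fst h ^ p, p * snd h)"

definition hxpow :: "nat \<Rightarrow> nat \<Rightarrow> 'a::comm_ring_1 \<times> nat \<Rightarrow> 'a \<times> nat" where
  "hxpow p n = (hx p ^^ n)"

definition in_Gamma_x :: "'a::comm_ring_1 list \<Rightarrow> nat \<Rightarrow> 'a \<times> nat \<Rightarrow> bool" where
  "in_Gamma_x as p h \<longleftrightarrow> (\<exists>n. hzero as (hxpow p n h))"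

definition hsl_kills :: "'a::comm_ring_1 list \<Rightarrow> nat \<Rightarrow> nat \<Rightarrow> bool" where
  "hsl_kills as p e \<longleftrightarrow> (\<forall>h. in_Gamma_x as p h \<longrightarrow> hzero as (hxpow p e h))"

text \<open>G = H/Gamma_x(H). An R[x,f]-submodule of G is described by the set N of all
  representatives (pairs) of its elements; an element of G is zero iff its representative
  lies in Gamma_x(H).\<close>
definition G_submodule :: "'a::comm_ring_1 list \<Rightarrow> nat \<Rightarrow> ('a \<times> nat) set \<Rightarrow> bool" where
  "G_submodule as p N \<longleftrightarrow> (0, 0) \<in> N \<and> (\<forall>h\<in>N. \<forall>h'\<in>N. hadd as h h' \<in> N) \<and>
     (\<forall>t. \<forall>h\<in>N. hsmul t h \<in> N) \<and> (\<forall>h\<in>N. hx p h \<in> N)"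

definition grann_deg :: "'a::comm_ring_1 list \<Rightarrow> nat \<Rightarrow> ('a \<times> nat) set \<Rightarrow> nat \<Rightarrow> 'a set" where
  "grann_deg as p N n = {r. \<forall>h\<in>N. in_Gamma_x as p (hsmul r (hxpow p n h))}"

definition G_special_ideals :: "'a::comm_ring_1 list \<Rightarrow> nat \<Rightarrow> 'a set set" where
  "G_special_ideals as p = {b. \<exists>N. G_submodule as p N \<and> (\<forall>n. grann_deg as p N n = b)}"

definition minimal_prime :: "'a::comm_ring_1 set \<Rightarrow> bool" where
  "minimal_prime P \<longleftrightarrow> prime_ideal P \<and> (\<forall>Q. prime_ideal Q \<and> Q \<subseteq> P \<longrightarrow> Q = P)"

definition R_circ :: "'a::comm_ring_1 set" where
  "R_circ = {r. \<forall>P. minimal_prime P \<longrightarrow> r \<notin> P}"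

definition frob_pow :: "'a::comm_ring_1 set \<Rightarrow> nat \<Rightarrow> 'a set" where
  "frob_pow I q = ideal_gen {r ^ q | r. r \<in> I}"

definition tight_closure :: "nat \<Rightarrow> 'a::comm_ring_1 set \<Rightarrow> 'a set" where
  "tight_closure p I = {r. \<exists>c\<in>R_circ. \<exists>n0. \<forall>n\<ge>n0. c * r ^ (p ^ n) \<in> frob_pow I (p ^ n)}"

definition parameter_ideal :: "'a::comm_ring_1 set \<Rightarrow> bool" where
  "parameter_ideal I \<longleftrightarrow> is_ideal I \<and> I \<noteq> UNIV \<and>
     (\<exists>xs. I = ideal_gen (set xs) \<and> enat (length xs) = ideal_height I)"

definition weak_param_test_elem :: "nat \<Rightarrow> nat \<Rightarrow> 'a::comm_ring_1 \<Rightarrow> bool" where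
  "weak_param_test_elem p w c \<longleftrightarrow> c \<in> R_circ \<and>
     (\<forall>I r. parameter_ideal I \<longrightarrow>
        (r \<in> tight_closure p I \<longleftrightarrow> (\<forall>n\<ge>w. c * r ^ (p ^ n) \<in> frob_pow I (p ^ n))))"

definition weak_param_test_ideal :: "nat \<Rightarrow> 'a::comm_ring_1 set" where
  "weak_param_test_ideal p = ideal_gen ({0} \<union> {c. \<exists>w. weak_param_test_elem p w c})"

end

theory Submission
  imports Defs "HOL-Computational_Algebra.Polynomial"
begin

text \<open>
  Because graded annihilators over an \<open>x\<close>-torsion-free module are constant in the degree, the
  \<open>G\<close>-special ideals are the annihilators of the submodules of \<open>H\<close> that contain \<open>\<Gamma>\<^sub>x(H)\<close> and are
  stable under \<open>x\<close>.  Those containing a nonzerodivisor (equivalently, of height at least 1, since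
  \<open>R\<close> is unmixed) have a common regular annihilator: \<open>G\<close> is exhausted by finitely many layers, each
  killed by finitely many maximal special primes, because a prime occurring in a layer is properly
  contained in a prime of the preceding one and prime chains have length at most \<open>d\<close>.

  If \<open>b\<close> is the smallest such ideal and \<open>r \<in> \<aa>\<^sup>*\<close> for a parameter ideal, then the submodule spanned
  by the \<open>x\<^sup>n[r]\<close> for large \<open>n\<close> is killed by some \<open>c' \<in> R\<^sup>\<circ>\<close>, hence by every \<open>c \<in> b\<close>, so that
  \<open>c x\<^sup>n[r] \<in> \<Gamma>\<^sub>x(H)\<close> for all \<open>n\<close>; applying \<open>x\<^sup>m\<close> with \<open>m\<close> the HSL-number gives the test element property.
  Conversely, any test element kills the submodule with annihilator \<open>b\<close> modulo \<open>\<Gamma>\<^sub>x(H)\<close>.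

  The existence of the HSL-number is a version of Gabber's argument.  The scalars of the completion of
  \<open>R\<close> enter it only as maps that agree with a scalar on every finite set; Matlis duality is replaced by
  the fact that such maps separate points from submodules in quotients with simple socle.
\<close>

section \<open>Ideals in Noetherian local rings\<close>

text \<open>Two obstacles shape the proof. As R need not be excellent, nothing can be descended from
  its completion: tight closure, test elements and nonzerodivisors are treated in R itself, and
  completion scalars occur only in the proof that the HSL-number exists. Moreover, the vanishing of
  a class in H detects only ideals generated by equal powers of the fixed parameters
  \<open>as\<close>. A parameter ideal is therefore completed to a system of parameters by powers
  y^N of further elements; \<open>emb\<close> compares this system with powers of \<open>as\<close>
  by one multiplier compatible with all Frobenius powers, and Krull's intersection theorem removes
  the y^N. Gabber's argument concerns a minimal stable submodule G of the x-torsion on which no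
  single power of x vanishes. The completion scalars that make the image of G boundedly nilpotent
  behave like a prime ideal whose elements are nilpotent on G. The kernels of the powers of x on G
  would then have to use infinitely many different members of a finite irreducible
  decomposition.\<close>

interpretation R: module "(*) :: 'a::comm_ring_1 \<Rightarrow> 'a \<Rightarrow> 'a"
  by unfold_locales (simp_all add: algebra_simps)

declare R.scale_scale [simp del] \<comment> \<open>loops with the simp rules for \<open>mult\<close>\<close>

lemma is_ideal_subspace: "is_ideal = R.subspace"
  by (auto simp: fun_eq_iff is_ideal_def R.subspace_def)

lemma ideal_gen_span: "ideal_gen = R.span"
proof (rule ext)
  fix S :: "'a set"
  show "ideal_gen S = R.span S"
    unfolding ideal_gen_def is_ideal_subspace
    by (auto intro: R.span_base dest: subsetD[OF R.span_minimal, rotated 2])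
qed

lemmas ideal_simps = is_ideal_subspace ideal_gen_span

lemma subspace_one: "R.subspace I \<Longrightarrow> 1 \<in> I \<Longrightarrow> (x::'a::comm_ring_1) \<in> I"
  using R.subspace_scale[of I 1 x] by simp

lemma subspace_one_iff: "R.subspace I \<Longrightarrow> I = UNIV \<longleftrightarrow> (1::'a::comm_ring_1) \<in> I"
  using subspace_one[of I] by auto

lemma subspace_mult_right: "R.subspace I \<Longrightarrow> x \<in> I \<Longrightarrow> x * r \<in> (I :: 'a::comm_ring_1 set)"
  using R.subspace_scale[of I x r] by (simp add: mult.commute)

lemma mem_span_insert:
  "R.subspace J \<Longrightarrow> z \<in> R.span (insert x J) \<longleftrightarrow> (\<exists>r. z - r * x \<in> (J :: 'a::comm_ring_1 set))"
  by (simp add: R.span_insert R.span_eq_iff[THEN iffD2])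

lemma span_insert_span: "R.span (insert x (R.span S)) = R.span (insert x (S :: 'a::comm_ring_1 set))"
  by (simp add: R.span_insert R.span_span)

lemma span_Un_span: "R.span (R.span S \<union> T) = R.span (S \<union> (T :: 'a::comm_ring_1 set))"
  by (simp add: R.span_Un R.span_span)

lemma (in module) subspace_Union_chain:
  assumes "\<And>I. I \<in> C \<Longrightarrow> subspace I" "C \<noteq> {}"
    and "\<And>I J. I \<in> C \<Longrightarrow> J \<in> C \<Longrightarrow> I \<subseteq> J \<or> J \<subseteq> I"
  shows "subspace (\<Union>C)"
  unfolding subspace_def
proof (intro conjI ballI allI)
  show "0 \<in> \<Union>C" using assms(1,2) subspace_0 by blast
next
  fix x y assume "x \<in> \<Union>C" "y \<in> \<Union>C"
  then obtain I J where "I \<in> C" "x \<in> I" "J \<in> C" "y \<in> J" by blast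
  with assms(3)[of I J] have "\<exists>K\<in>C. x \<in> K \<and> y \<in> K" by blast
  then show "x + y \<in> \<Union>C" using assms(1) subspace_add by blast
next
  fix c x assume "x \<in> \<Union>C"
  then show "c *s x \<in> \<Union>C" using assms(1) subspace_scale by blast
qed

lemma noetherian_fg:
  "noetherian_ring TYPE('a::comm_ring_1) \<Longrightarrow> R.subspace (I::'a set) \<Longrightarrow> \<exists>S. finite S \<and> I = R.span S"
  by (simp add: noetherian_ring_def ideal_simps)

text \<open>The union of a chain is generated by finitely many elements, all of which lie in one
  member; so the union is that member and inherits \<open>Q\<close>.\<close>

lemma noetherian_maximal:
  fixes I0 :: "'a::comm_ring_1 set"
  assumes N: "noetherian_ring TYPE('a)" and I0: "R.subspace I0" "Q I0"
  obtains M where "R.subspace M" "Q M" "\<And>K. R.subspace K \<Longrightarrow> Q K \<Longrightarrow> M \<subseteq> K \<Longrightarrow> K = M"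
proof -
  let ?F = "{I. R.subspace I \<and> Q I}"
  have "\<exists>M\<in>?F. \<forall>X\<in>?F. M \<subseteq> X \<longrightarrow> X = M"
  proof (rule subset_Zorn_nonempty)
    show "?F \<noteq> {}" using I0 by auto
    fix C assume C: "C \<noteq> {}" "subset.chain ?F C"
    then have chain: "\<And>I J. I \<in> C \<Longrightarrow> J \<in> C \<Longrightarrow> I \<subseteq> J \<or> J \<subseteq> I" and CF: "C \<subseteq> ?F"
      by (auto simp: subset.chain_def)
    have "R.subspace (\<Union>C)"
      using C chain CF by (intro R.subspace_Union_chain) auto
    then obtain S where S: "finite S" "\<Union>C = R.span S"
      using noetherian_fg[OF N] by metis
    then have "S \<subseteq> \<Union>C" using R.span_superset by blast
    then obtain I where "I \<in> C" "S \<subseteq> I"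
      using finite_subset_Union_chain[OF S(1) _ C(1)] C(2) by blast
    have "I \<in> ?F" using \<open>I \<in> C\<close> CF by (rule subsetD[rotated])
    then have "R.span S \<subseteq> I" using \<open>S \<subseteq> I\<close> by (simp add: R.span_minimal)
    then have "\<Union>C \<subseteq> I" by (simp only: S(2))
    then have "\<Union>C = I" using Union_upper[OF \<open>I \<in> C\<close>] by (rule antisym)
    with \<open>I \<in> ?F\<close> show "\<Union>C \<in> ?F" by (simp only:)
  qed
  then obtain M where "M \<in> ?F" "\<forall>X\<in>?F. M \<subseteq> X \<longrightarrow> X = M" ..
  then show ?thesis by (intro that[of M]) simp_all
qed

lemma proper_in_max:
  fixes I :: "'a::comm_ring_1 set"
  assumes N: "noetherian_ring TYPE('a)" and L: "local_ring m" and I: "R.subspace I" "I \<noteq> UNIV"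
  shows "I \<subseteq> m"
proof -
  obtain M where M: "R.subspace M" "M \<noteq> UNIV \<and> I \<subseteq> M"
    and mx: "\<And>K. R.subspace K \<Longrightarrow> K \<noteq> UNIV \<and> I \<subseteq> K \<Longrightarrow> M \<subseteq> K \<Longrightarrow> K = M"
    by (rule noetherian_maximal[OF N, of I "\<lambda>K. K \<noteq> UNIV \<and> I \<subseteq> K"]) (use I in auto)
  have "maximal_ideal M" unfolding maximal_ideal_def ideal_simps
    using M mx by (metis order_trans)
  with L M show ?thesis unfolding local_ring_def by simp
qed

lemma local_unit:
  fixes x :: "'a::comm_ring_1"
  assumes N: "noetherian_ring TYPE('a)" and L: "local_ring m" and "x \<notin> m"
  shows "\<exists>y. y * x = 1"
proof -
  have "R.span {x} = UNIV"
    using proper_in_max[OF N L, of "R.span {x}"] assms(3) R.span_base[of x "{x}"] by auto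
  then have "1 \<in> R.span {x}" by simp
  then show ?thesis by (auto simp: R.span_singleton)
qed

lemma local_subspace: "local_ring m \<Longrightarrow> R.subspace m"
  and local_one: "local_ring m \<Longrightarrow> 1 \<notin> m"
  by (auto simp: local_ring_def maximal_ideal_def ideal_simps dest: subspace_one)

lemma prime_ideal_power: "prime_ideal P \<Longrightarrow> x ^ n \<in> P \<Longrightarrow> x \<in> P"
proof (induction n)
  case 0
  then show ?case
    by (auto simp: prime_ideal_def ideal_simps dest: subspace_one)
next
  case (Suc n)
  then show ?case by (auto simp: prime_ideal_def)
qed

lemma prime_subspace: "prime_ideal P \<Longrightarrow> R.subspace P"
  and prime_one: "prime_ideal P \<Longrightarrow> 1 \<notin> P"
  and prime_mult: "prime_ideal P \<Longrightarrow> x * y \<in> P \<Longrightarrow> x \<in> P \<or> y \<in> P"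
  by (auto simp: prime_ideal_def ideal_simps dest: subspace_one)

lemma prime_idealI:
  "R.subspace P \<Longrightarrow> 1 \<notin> P \<Longrightarrow> (\<And>x y. x * y \<in> P \<Longrightarrow> x \<notin> P \<Longrightarrow> y \<in> P) \<Longrightarrow> prime_ideal P"
  by (auto simp: prime_ideal_def ideal_simps dest: subspace_one)

lemma local_prime:
  fixes m :: "'a::comm_ring_1 set"
  assumes N: "noetherian_ring TYPE('a)" and L: "local_ring m"
  shows "prime_ideal m"
proof (rule prime_idealI)
  fix x y assume *: "x * y \<in> m" "x \<notin> m"
  then obtain z where "z * x = 1" using local_unit[OF N L] by blast
  then have "y = z * (x * y)" by (simp add: mult.assoc[symmetric])
  then show "y \<in> m" using * R.subspace_scale[OF local_subspace[OF L]] by metis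
qed (use L local_subspace local_one in auto)

text \<open>An ideal maximal among those that contain \<open>J\<close> and miss \<open>S\<close> is
  prime: if x and y lie outside it, both enlarged ideals meet \<open>S\<close>, and the product of
  the two elements found would lie in the ideal if x * y did.\<close>

lemma prime_avoiding:
  fixes S :: "'a::comm_ring_1 set"
  assumes N: "noetherian_ring TYPE('a)" and S: "1 \<in> S" "\<And>x y. x \<in> S \<Longrightarrow> y \<in> S \<Longrightarrow> x * y \<in> S"
    and J: "R.subspace J" "J \<inter> S = {}"
  obtains P where "prime_ideal P" "J \<subseteq> P" "P \<inter> S = {}"
proof -
  obtain P where P': "R.subspace P" "J \<subseteq> P \<and> P \<inter> S = {}"
    and mx: "\<And>K. R.subspace K \<Longrightarrow> J \<subseteq> K \<and> K \<inter> S = {} \<Longrightarrow> P \<subseteq> K \<Longrightarrow> K = P"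
    by (rule noetherian_maximal[OF N, of J "\<lambda>K. J \<subseteq> K \<and> K \<inter> S = {}"]) (use J in auto)
  then have P: "R.subspace P" "J \<subseteq> P" "P \<inter> S = {}" by auto
  have meet: "\<exists>r s. s \<in> S \<and> s - r * x \<in> P" if "x \<notin> P" for x
  proof -
    have "x \<in> R.span (insert x P)" "P \<subseteq> R.span (insert x P)"
      using R.span_superset by blast+
    then have "R.span (insert x P) \<inter> S \<noteq> {}"
      using mx[of "R.span (insert x P)"] that P by auto
    then show ?thesis using P by (auto simp: mem_span_insert)
  qed
  have "prime_ideal P"
  proof (rule prime_idealI)
    show "1 \<notin> P" using P S by auto
    fix x y assume xy: "x * y \<in> P" "x \<notin> P"
    show "y \<in> P"
    proof (rule ccontr)
      assume "y \<notin> P"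
      then obtain r s r' s' where *: "s \<in> S" "s - r * x \<in> P" "s' \<in> S" "s' - r' * y \<in> P"
        using meet xy by metis
      have "s * s' = s' * (s - r * x) + (r * x) * (s' - r' * y) + r * r' * (x * y)"
        by (simp add: algebra_simps)
      also have "\<dots> \<in> P"
        using *(2,4) xy(1) P(1) by (simp add: R.subspace_add R.subspace_scale)
      finally show False using * S P by blast
    qed
  qed (use P in auto)
  with P that show ?thesis by blast
qed

text \<open>The Nakayama argument: take an ideal maximal among those containing \<open>J\<close> but not \<open>K\<close>.\<close>

lemma nakayama:
  fixes J K :: "'a::comm_ring_1 set"
  assumes N: "noetherian_ring TYPE('a)" and L: "local_ring m"
    and J: "R.subspace J" and K: "R.subspace K" and x: "\<And>x. x \<in> X \<Longrightarrow> x \<in> m"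
    and sub: "K \<subseteq> R.span (J \<union> {x * k | x k. x \<in> X \<and> k \<in> K})"
  shows "K \<subseteq> J"
proof (rule ccontr)
  assume nK: "\<not> K \<subseteq> J"
  obtain T where T': "R.subspace T" "J \<subseteq> T \<and> \<not> K \<subseteq> T"
    and mx: "\<And>I. R.subspace I \<Longrightarrow> J \<subseteq> I \<and> \<not> K \<subseteq> I \<Longrightarrow> T \<subseteq> I \<Longrightarrow> I = T"
    by (rule noetherian_maximal[OF N, of J "\<lambda>I. J \<subseteq> I \<and> \<not> K \<subseteq> I"]) (use J nK in auto)
  then have T: "R.subspace T" "J \<subseteq> T" "\<not> K \<subseteq> T" by auto
  have "x * k \<in> T" if "x \<in> X" "k \<in> K" for x k
  proof (cases "k \<in> T")
    case True then show ?thesis using T R.subspace_scale by blast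
  next
    case False
    show ?thesis
    proof (rule ccontr)
      assume "x * k \<notin> T"
      moreover have "T \<subseteq> R.span (insert (x * k) T)" "x * k \<in> R.span (insert (x * k) T)"
        using R.span_superset by blast+
      ultimately have "K \<subseteq> R.span (insert (x * k) T)"
        using mx[of "R.span (insert (x * k) T)"] T by auto
      then obtain r where r: "k - r * (x * k) \<in> T"
        using \<open>k \<in> K\<close> mem_span_insert[OF T(1), of k "x * k"] by blast
      \<comment> \<open>Modulo T, (1 - r * x) * k is zero; as 1 - r * x is a unit, k would lie in
        T.\<close>
      have "1 - r * x \<notin> m"
      proof
        assume *: "1 - r * x \<in> m"
        have "r * x \<in> m" using x that L local_subspace R.subspace_scale by metis
        from R.subspace_add[OF local_subspace[OF L] * this] have "1 \<in> m" by simp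
        with L local_one show False by blast
      qed
      then obtain y where "y * (1 - r * x) = 1" using local_unit[OF N L] by blast
      then have "k = y * (1 - r * x) * k" by simp
      also have "\<dots> = y * (k - r * (x * k))" by (simp add: algebra_simps)
      finally show False using r False R.subspace_scale[OF T(1)] by metis
    qed
  qed
  then have "R.span (J \<union> {x * k | x k. x \<in> X \<and> k \<in> K}) \<subseteq> T"
    using T by (intro R.span_minimal) auto
  with sub T show False by blast
qed

lemma nakayama1:
  fixes J K :: "'a::comm_ring_1 set"
  assumes N: "noetherian_ring TYPE('a)" and L: "local_ring m"
    and J: "R.subspace J" and K: "R.subspace K" and x: "x \<in> m"
    and sub: "\<And>k. k \<in> K \<Longrightarrow> \<exists>k'\<in>K. k - x * k' \<in> J"
  shows "K \<subseteq> J"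
proof (rule nakayama[OF N L J K, of "{x}"])
  show "K \<subseteq> R.span (J \<union> {xa * k |xa k. xa \<in> {x} \<and> k \<in> K})" (is "_ \<subseteq> R.span ?S")
  proof
    fix k assume "k \<in> K"
    with sub obtain k' where "k' \<in> K" "k - x * k' \<in> J" by blast
    then have "k - x * k' \<in> R.span ?S" "x * k' \<in> R.span ?S" by (auto intro!: R.span_base)
    from R.span_add[OF this] show "k \<in> R.span ?S" by simp
  qed
qed (use x in auto)

text \<open>Coset form of prime avoidance, by removing a minimal member P of \<open>F\<close>. If
  the element found for the other primes lies in P, add an element of \<open>B\<close> that lies in
  all the other primes but not in P; minimality of P provides it.\<close>

lemma avoidance:
  fixes a :: "'a::comm_ring_1"
  assumes "finite F" "\<And>P. P \<in> F \<Longrightarrow> prime_ideal P" and B: "R.subspace B"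
    and "\<And>P. P \<in> F \<Longrightarrow> a \<notin> P \<or> \<not> B \<subseteq> P"
  shows "\<exists>b\<in>B. \<forall>P\<in>F. a + b \<notin> P"
  using assms(1,2,4)
proof (induction F rule: finite_psubset_induct)
  case (psubset F)
  show ?case
  proof (cases "F = {}")
    case True
    then show ?thesis using B R.subspace_0 by blast
  next
    case False
    then obtain P where P: "P \<in> F" "\<And>Q. Q \<in> F \<Longrightarrow> Q \<subseteq> P \<Longrightarrow> Q = P"
      using finite_has_minimal[OF psubset.hyps] by metis
    obtain b where b: "b \<in> B" "\<And>Q. Q \<in> F - {P} \<Longrightarrow> a + b \<notin> Q"
      using psubset.IH[of "F - {P}"] P(1) psubset.prems by blast
    show ?thesis
    proof (cases "a + b \<in> P")
      case False
      then show ?thesis using b by blast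
    next
      case True
      have "\<not> B \<subseteq> P"
      proof
        assume BP: "B \<subseteq> P"
        then have "(a + b) - b \<in> P"
          using True b psubset.prems P prime_subspace R.subspace_diff by blast
        with BP psubset.prems P show False by auto
      qed
      then obtain c where c: "c \<in> B" "c \<notin> P" by blast
      have "\<forall>Q\<in>F - {P}. \<exists>e. e \<in> Q \<and> e \<notin> P" using P by blast
      then obtain e where e: "\<And>Q. Q \<in> F - {P} \<Longrightarrow> e Q \<in> Q \<and> e Q \<notin> P" by metis
      define z where "z = c * prod e (F - {P})"
      have pP: "prime_ideal P" using P psubset.prems by blast
      have "prod e G \<notin> P" if "finite G" "G \<subseteq> F - {P}" for G
        using that by (induction G) (use e pP prime_mult[OF pP] prime_one[OF pP] in auto)
      then have zP: "z \<notin> P"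
        unfolding z_def using c pP prime_mult psubset.hyps by blast
      have zQ: "z \<in> Q" if "Q \<in> F - {P}" for Q
      proof -
        have "prod e (F - {P}) = e Q * prod e (F - {P} - {Q})"
          using that psubset.hyps by (intro prod.remove) auto
        then have "z = (c * prod e (F - {P} - {Q})) * e Q" by (simp add: z_def mult_ac)
        then show ?thesis
          using e that psubset.prems prime_subspace R.subspace_scale by (metis DiffD1)
      qed
      have zB: "z \<in> B" unfolding z_def using c B subspace_mult_right by blast
      have "a + (b + z) \<notin> Q" if "Q \<in> F" for Q
      proof
        assume *: "a + (b + z) \<in> Q"
        have sQ: "R.subspace Q" using that psubset.prems prime_subspace by blast
        show False
        proof (cases "Q = P")
          case True
          then have "a + (b + z) - (a + b) \<in> P" using * \<open>a + b \<in> P\<close> sQ R.subspace_diff by blast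
          then show False using zP by simp
        next
          case False
          then have "a + (b + z) - z \<in> Q" using zQ[of Q] that * sQ R.subspace_diff by blast
          then show False using b(2)[of Q] False that by (simp add: add.assoc[symmetric])
        qed
      qed
      then show ?thesis using b zB B R.subspace_add by blast
    qed
  qed
qed

section \<open>Associated primes, nonzerodivisors and Krull's intersection theorem\<close>

definition colon :: "'a::comm_ring_1 set \<Rightarrow> 'a \<Rightarrow> 'a set" where
  "colon J u = {r. r * u \<in> J}"

lemma subspace_colon: "R.subspace J \<Longrightarrow> R.subspace (colon J u)"
  by (auto simp: R.subspace_def colon_def algebra_simps)

definition assoc_primes :: "'a::comm_ring_1 set \<Rightarrow> 'a set set" where
  "assoc_primes J = {P. prime_ideal P \<and> (\<exists>u. u \<notin> J \<and> P = colon J u)}"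

definition reg :: "'a::comm_ring_1 \<Rightarrow> 'a set \<Rightarrow> bool" where
  "reg y J \<longleftrightarrow> (\<forall>z. y * z \<in> J \<longrightarrow> z \<in> J)"

text \<open>The maximal ideals of the form \<open>J : u\<close> are prime; choosing finitely many of the \<open>u\<close>
  that generate the ideal of all of them shows that there are only finitely many.\<close>

lemma finite_assoc_primes:
  fixes J :: "'a::comm_ring_1 set"
  assumes N: "noetherian_ring TYPE('a)" and J: "R.subspace J"
  obtains F where "finite F" "F \<subseteq> assoc_primes J" "\<And>y. \<not> reg y J \<Longrightarrow> \<exists>P\<in>F. y \<in> P"
proof -
  define A where "A = {colon J u | u. u \<notin> J}"
  define M where "M = {P \<in> A. \<forall>Q\<in>A. P \<subseteq> Q \<longrightarrow> Q \<subseteq> P}"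
  have sA: "R.subspace P" if "P \<in> A" for P
    using that J subspace_colon by (auto simp: A_def)
  have above: "\<exists>P\<in>M. Q \<subseteq> P" if Q: "Q \<in> A" for Q
  proof -
    obtain P where P: "R.subspace P" "P \<in> A \<and> Q \<subseteq> P"
      and mx: "\<And>I. R.subspace I \<Longrightarrow> I \<in> A \<and> Q \<subseteq> I \<Longrightarrow> P \<subseteq> I \<Longrightarrow> I = P"
      by (rule noetherian_maximal[OF N, of Q "\<lambda>I. I \<in> A \<and> Q \<subseteq> I"]) (use Q sA in auto)
    have "I \<subseteq> P" if "I \<in> A" "P \<subseteq> I" for I
      using mx[of I] that P sA by auto
    with P show ?thesis unfolding M_def by blast
  qed
  have pM: "prime_ideal P" if "P \<in> M" for P
  proof -
    have "P \<in> A" using that by (simp add: M_def)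
    then obtain u where u: "u \<notin> J" "P = colon J u" unfolding A_def by blast
    show ?thesis
    proof (rule prime_idealI)
      show "R.subspace P" using u J subspace_colon by blast
      show "1 \<notin> P" using u by (simp add: colon_def)
      fix x y assume xy: "x * y \<in> P" "x \<notin> P"
      then have "colon J (x * u) \<in> A" using u by (auto simp: A_def colon_def)
      moreover have "P \<subseteq> colon J (x * u)"
        using u J R.subspace_scale by (fastforce simp: colon_def mult.left_commute)
      ultimately have "colon J (x * u) \<subseteq> P" using that by (auto simp: M_def)
      moreover have "y \<in> colon J (x * u)" using xy u by (simp add: colon_def mult_ac)
      ultimately show "y \<in> P" by blast
    qed
  qed
  have "\<forall>P\<in>M. \<exists>u. u \<notin> J \<and> P = colon J u" by (auto simp: M_def A_def)
  then obtain g where g: "\<And>P. P \<in> M \<Longrightarrow> g P \<notin> J \<and> P = colon J (g P)" by metis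
  obtain S where S: "finite S" "R.span (g ` M) = R.span S"
    using noetherian_fg[OF N R.subspace_span] by metis
  have "\<exists>F. finite F \<and> F \<subseteq> M \<and> T \<subseteq> R.span (g ` F)" if "finite T" "T \<subseteq> R.span (g ` M)" for T
    using that
  proof (induction T)
    case (insert x T)
    then obtain F where F: "finite F" "F \<subseteq> M" "T \<subseteq> R.span (g ` F)" by auto
    have "x \<in> R.span (g ` M)" using insert by auto
    then obtain t where t: "finite t" "t \<subseteq> g ` M" "x \<in> R.span t"
      unfolding R.span_explicit by (auto intro!: R.span_sum R.span_scale R.span_base)
    from finite_subset_image[OF t(1,2)] obtain G where G: "finite G" "G \<subseteq> M" "t = g ` G" by blast
    have "R.span (g ` F) \<subseteq> R.span (g ` (F \<union> G))" "R.span (g ` G) \<subseteq> R.span (g ` (F \<union> G))"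
      by (auto intro!: R.span_mono)
    then show ?case using F G t by (intro exI[of _ "F \<union> G"]) auto
  qed auto
  from this[OF S(1)] obtain F where F: "finite F" "F \<subseteq> M" "S \<subseteq> R.span (g ` F)"
    using S R.span_superset by blast
  have MF: "P \<in> F" if P: "P \<in> M" for P
  proof (rule ccontr)
    assume nF: "P \<notin> F"
    have "R.span S \<subseteq> R.span (g ` F)" using F(3) by (rule R.span_minimal) simp
    then have "g P \<in> R.span (g ` F)"
      using R.span_base[of "g P" "g ` M"] P S(2) by blast
    have "\<exists>e. e \<in> Q \<and> e \<notin> P" if "Q \<in> F" for Q
    proof (rule ccontr)
      assume "\<nexists>e. e \<in> Q \<and> e \<notin> P"
      then have "Q \<subseteq> P" by blast
      moreover have "Q \<in> M" "P \<in> A" using that F(2) P by (auto simp: M_def)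
      ultimately have "P = Q" unfolding M_def by (intro antisym) blast+
      with nF that show False by simp
    qed
    then obtain e where e: "\<And>Q. Q \<in> F \<Longrightarrow> e Q \<in> Q \<and> e Q \<notin> P" by metis
    have "prod e G \<notin> P" if "finite G" "G \<subseteq> F" for G
      using that by (induction G) (use e pM[OF P] prime_mult[OF pM[OF P]] prime_one[OF pM[OF P]] in auto)
    \<comment> \<open>The product of the e Q kills modulo J every g Q with Q in F, hence also g P,
      which lies in their span; so it would belong to P.\<close>
    then have nP: "prod e F \<notin> P" using F by blast
    have "R.span (g ` F) \<subseteq> {z. prod e F * z \<in> J}"
    proof (rule R.span_minimal)
      show "R.subspace {z. prod e F * z \<in> J}"
        using J by (auto simp: R.subspace_def algebra_simps)
      show "g ` F \<subseteq> {z. prod e F * z \<in> J}"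
      proof clarify
        fix Q assume Q: "Q \<in> F"
        have "e Q * g Q \<in> J" using e[OF Q] g[of Q] Q F by (auto simp: colon_def)
        moreover have "prod e F * g Q = prod e (F - {Q}) * (e Q * g Q)"
          using prod.remove[OF F(1) Q, of e] by (simp add: mult_ac)
        ultimately show "prod e F * g Q \<in> J" using J R.subspace_scale by metis
      qed
    qed
    then have "prod e F * g P \<in> J" using \<open>g P \<in> R.span (g ` F)\<close> by blast
    then show False using nP g[OF P] by (auto simp: colon_def)
  qed
  show ?thesis
  proof (rule that[of F])
    show "finite F" by fact
    show "F \<subseteq> assoc_primes J" using F g pM by (fastforce simp: assoc_primes_def)
    fix y assume "\<not> reg y J"
    then obtain z where z: "y * z \<in> J" "z \<notin> J" by (auto simp: reg_def)
    then have "colon J z \<in> A" by (auto simp: A_def)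
    then obtain P where "P \<in> M" "colon J z \<subseteq> P" using above by blast
    then show "\<exists>P\<in>F. y \<in> P" using MF z by (auto simp: colon_def)
  qed
qed

text \<open>Let K be the intersection of all the ideals \<open>I\<close> in question. An ideal T
  maximal with T \<inter> K = J + \<open>m\<close> K turns out to contain a power of every element
  of \<open>m\<close>, so K lies in T and K = J + \<open>m\<close> K; Nakayama finishes.\<close>

lemma krull_intersection:
  fixes J :: "'a::comm_ring_1 set"
  assumes N: "noetherian_ring TYPE('a)" and L: "local_ring m" and J: "R.subspace J"
    and z: "\<And>I. R.subspace I \<Longrightarrow> J \<subseteq> I \<Longrightarrow> (\<And>y. y \<in> m \<Longrightarrow> \<exists>n. y ^ n \<in> I) \<Longrightarrow> z \<in> I"
  shows "z \<in> J"
proof -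
  define K where "K = \<Inter> {I. R.subspace I \<and> J \<subseteq> I \<and> (\<forall>y\<in>m. \<exists>n. y ^ n \<in> I)}"
  have K: "R.subspace K" unfolding K_def by (intro R.subspace_Inter) auto
  have JK: "J \<subseteq> K" unfolding K_def by blast
  let ?S = "J \<union> {x * k | x k. x \<in> m \<and> k \<in> K}"
  define L' where "L' = R.span ?S"
  have L'K: "L' \<subseteq> K" unfolding L'_def
    by (intro R.span_minimal K) (use JK K R.subspace_scale in blast)
  have sL': "R.subspace L'" by (simp add: L'_def)
  obtain T where T: "R.subspace T" "T \<inter> K = L'"
    and mx: "\<And>I. R.subspace I \<Longrightarrow> I \<inter> K = L' \<Longrightarrow> T \<subseteq> I \<Longrightarrow> I = T"
    by (rule noetherian_maximal[OF N, of L' "\<lambda>I. I \<inter> K = L'"]) (use sL' L'K in auto)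
  have "\<exists>n. y ^ n \<in> T" if y: "y \<in> m" for y
  proof -
    \<comment> \<open>The ideals T : y^n become stationary, and the n at which this happens is the
      exponent with y^n in T.\<close>
    obtain I where "R.subspace I" "\<exists>n. I = colon T (y ^ n)"
      and mx': "\<And>K. R.subspace K \<Longrightarrow> \<exists>n. K = colon T (y ^ n) \<Longrightarrow> I \<subseteq> K \<Longrightarrow> K = I"
      by (rule noetherian_maximal[OF N, of "colon T (y ^ 0)" "\<lambda>I. \<exists>n. I = colon T (y ^ n)"])
        (use subspace_colon[OF T(1)] in blast)+
    then obtain n where n: "\<And>i. colon T (y ^ n) \<subseteq> colon T (y ^ i) \<Longrightarrow> colon T (y ^ i) = colon T (y ^ n)"
      using subspace_colon[OF T(1)] by metis
    have n': "r * y ^ n \<in> T" if "r * y ^ Suc n \<in> T" for r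
    proof -
      have "colon T (y ^ n) \<subseteq> colon T (y ^ Suc n)"
        using T R.subspace_scale by (fastforce simp: colon_def mult.left_commute)
      from n[OF this] that show ?thesis by (auto simp: colon_def)
    qed
    have "R.span (insert (y ^ n) T) \<inter> K = L'"
    proof (rule antisym)
      show "R.span (insert (y ^ n) T) \<inter> K \<subseteq> L'"
      proof clarify
        fix k assume k: "k \<in> R.span (insert (y ^ n) T)" "k \<in> K"
        then obtain r where r: "k - r * y ^ n \<in> T" using T mem_span_insert by blast
        have "y * k \<in> L'" unfolding L'_def using y k by (intro R.span_base) auto
        then have "y * k - y * (k - r * y ^ n) \<in> T"
          using T r R.subspace_scale R.subspace_diff by blast
        then have "r * y ^ n \<in> T" by (intro n') (simp add: algebra_simps)
        from R.subspace_add[OF T(1) r this] have "k \<in> T" by simp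
        with k T show "k \<in> L'" by blast
      qed
      show "L' \<subseteq> R.span (insert (y ^ n) T) \<inter> K"
        using T L'K R.span_superset[of "insert (y ^ n) T"] by blast
    qed
    then have "R.span (insert (y ^ n) T) \<subseteq> T"
      using mx[of "R.span (insert (y ^ n) T)"] R.span_superset[of "insert (y ^ n) T"] by simp
    then show ?thesis using R.span_superset[of "insert (y ^ n) T"] by blast
  qed
  moreover have "J \<subseteq> T" using T R.span_superset[of ?S] unfolding L'_def by blast
  ultimately have "K \<subseteq> T" using T(1) unfolding K_def by blast
  with T have "K \<subseteq> L'" by blast
  then have "K \<subseteq> J" using nakayama[OF N L J K, of m] unfolding L'_def by blast
  moreover have "z \<in> K" unfolding K_def using z by blast
  ultimately show ?thesis by blast
qed

section \<open>Regular sequences and grade\<close>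

locale noetherian_local =
  fixes m :: "'a::comm_ring_1 set"
  assumes noeth: "noetherian_ring TYPE('a)" and local: "local_ring m"
begin

lemmas m_subspace = local_subspace[OF local]
lemmas m_prime = local_prime[OF noeth local]
lemmas m_one = local_one[OF local]

end

text \<open>Regular sequences on R / J in recursive form: the growing base ideal lets inductions
  pass to R / (x, J) without forming a quotient ring.\<close>

fun regs :: "'a::comm_ring_1 set \<Rightarrow> 'a list \<Rightarrow> bool" where
  "regs J [] \<longleftrightarrow> True"
| "regs J (x # xs) \<longleftrightarrow> reg x J \<and> regs (R.span (insert x J)) xs"

lemma regs_append:
  "R.subspace J \<Longrightarrow> regs J (xs @ ys) \<longleftrightarrow> regs J xs \<and> regs (R.span (J \<union> set xs)) ys"
proof (induction xs arbitrary: J)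
  case Nil
  then show ?case by (simp add: R.span_eq_iff[THEN iffD2])
next
  case (Cons x xs)
  have "R.span (R.span (insert x J) \<union> set xs) = R.span (J \<union> set (x # xs))"
    by (simp add: span_Un_span)
  then show ?case using Cons.IH[of "R.span (insert x J)"] by simp
qed

lemma span_insert2: "R.span (insert x (R.span (insert y J))) = R.span (insert y (R.span (insert x J)))"
  by (simp add: span_insert_span insert_commute)

lemma reg_cong:
  assumes J: "R.subspace J" and j: "x' - x \<in> J" and r: "reg x' J"
  shows "reg x J"
  unfolding reg_def
proof (intro allI impI)
  fix z assume z: "x * z \<in> J"
  have "x * z + (x' - x) * z \<in> J"
    using z j J R.subspace_add subspace_mult_right by blast
  then have "x' * z \<in> J" by (simp add: algebra_simps)
  with r show "z \<in> J" by (simp add: reg_def)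
qed

context noetherian_local
begin

text \<open>If k * y lies in J, then k = s * x modulo J, and s again lies in J : y because x is
  regular on J. So J : y is contained in J + x (J : y), and Nakayama gives J : y = J; this is where
  x in \<open>m\<close> enters.\<close>

lemma reg_swap:
  assumes J: "R.subspace J" and m: "x \<in> m" and r: "reg x J" "reg y (R.span (insert x J))"
  shows "reg y J" "reg x (R.span (insert y J))"
proof -
  have "colon J y \<subseteq> J"
  proof (rule nakayama1[OF noeth local J subspace_colon[OF J] m])
    fix k assume "k \<in> colon J y"
    then have k: "k * y \<in> J" by (simp add: colon_def)
    then have "y * k \<in> R.span (insert x J)"
      using R.span_superset[of "insert x J"] by (auto simp: mult.commute)
    then have "k \<in> R.span (insert x J)" using r(2) by (simp add: reg_def)
    then obtain s where s: "k - s * x \<in> J" using mem_span_insert[OF J, of k x] by blast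
    have "k * y - (k - s * x) * y \<in> J"
      using k s J R.subspace_diff subspace_mult_right by blast
    then have "x * (s * y) \<in> J" by (simp add: algebra_simps)
    then have "s \<in> colon J y" using r(1) by (simp add: reg_def colon_def)
    then show "\<exists>k'\<in>colon J y. k - x * k' \<in> J" using s by (auto simp: mult.commute)
  qed
  then show "reg y J" by (auto simp: reg_def colon_def mult.commute)
  show "reg x (R.span (insert y J))"
    unfolding reg_def
  proof (intro allI impI)
    fix z assume "x * z \<in> R.span (insert y J)"
    then obtain t where t: "x * z - t * y \<in> J" using mem_span_insert[OF J, of "x * z" y] by blast
    have "- (x * z - t * y) \<in> J" using t J R.subspace_neg by blast
    then have "y * t - z * x \<in> J" by (simp add: algebra_simps)
    then have "y * t \<in> R.span (insert x J)" using mem_span_insert[OF J, of "y * t" x] by blast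
    then have "t \<in> R.span (insert x J)" using r(2) by (simp add: reg_def)
    then obtain s where s: "t - s * x \<in> J" using mem_span_insert[OF J, of t x] by blast
    have "(x * z - t * y) + (t - s * x) * y \<in> J"
      using t s J R.subspace_add subspace_mult_right by blast
    then have "x * (z - s * y) \<in> J" by (simp add: algebra_simps)
    then have "z - s * y \<in> J" using r(1) by (simp add: reg_def)
    then show "z \<in> R.span (insert y J)" using mem_span_insert[OF J, of z y] by blast
  qed
qed

lemma regs_rotate:
  assumes "R.subspace J" "x \<in> m" "set xs \<subseteq> m"
  shows "regs J (x # xs) \<longleftrightarrow> regs J (xs @ [x])"
  using assms
proof (induction xs arbitrary: J)
  case Nil
  then show ?case by simp
next
  case (Cons y ys)
  have IH: "regs (R.span (insert y J)) (x # ys) \<longleftrightarrow> regs (R.span (insert y J)) (ys @ [x])"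
    using Cons by simp
  have "regs J (x # y # ys) \<longleftrightarrow> reg y J \<and> regs (R.span (insert y J)) (x # ys)"
  proof -
    have y: "y \<in> m" using Cons.prems by simp
    have "reg x J \<and> reg y (R.span (insert x J)) \<longleftrightarrow> reg y J \<and> reg x (R.span (insert y J))"
      using reg_swap[OF Cons.prems(1,2), of y] reg_swap[OF Cons.prems(1) y, of x] by blast
    then show ?thesis unfolding regs.simps span_insert2[of y x J] by blast
  qed
  then show ?case using IH by simp
qed

text \<open>If \<open>a\<close> had no nonzerodivisor on R / J, avoidance would place it inside an
  associated prime J : v, and v would contradict the hypothesis.\<close>

lemma ex_reg:
  fixes a J :: "'a set"
  assumes a: "R.subspace a" and J: "R.subspace J"
    and u: "\<And>u. (\<And>w. w \<in> a \<Longrightarrow> w * u \<in> J) \<Longrightarrow> u \<in> J"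
  shows "\<exists>w\<in>a. reg w J"
proof -
  obtain F where F: "finite F" "F \<subseteq> assoc_primes J" "\<And>y. \<not> reg y J \<Longrightarrow> \<exists>P\<in>F. y \<in> P"
    using finite_assoc_primes[OF noeth J] by metis
  have "\<exists>b\<in>a. \<forall>P\<in>F. 0 + b \<notin> P"
  proof (rule avoidance[OF F(1) _ a])
    fix P assume "P \<in> F"
    then have P: "P \<in> assoc_primes J" using F(2) by blast
    then show "prime_ideal P" by (simp add: assoc_primes_def)
    from P obtain v where "v \<notin> J" "P = colon J v" unfolding assoc_primes_def by blast
    then have "\<not> a \<subseteq> P" using u[of v] by (auto simp: colon_def)
    then show "0 \<notin> P \<or> \<not> a \<subseteq> P" ..
  qed
  then show ?thesis using F(3) by auto
qed

text \<open>An ideal with a nonzerodivisor on each R / J lies in none of the finitely many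
  associated primes involved, so one element avoids them all.\<close>

lemma common_reg:
  fixes a :: "'a set"
  assumes a: "R.subspace a" and fin: "finite JJ"
    and JJ: "\<And>J. J \<in> JJ \<Longrightarrow> R.subspace J" "\<And>J. J \<in> JJ \<Longrightarrow> \<exists>w\<in>a. reg w J"
  shows "\<exists>w\<in>a. \<forall>J\<in>JJ. reg w J"
proof -
  have "\<exists>F. finite F \<and> F \<subseteq> assoc_primes J \<and> (\<forall>y. \<not> reg y J \<longrightarrow> (\<exists>P\<in>F. y \<in> P))" if "J \<in> JJ" for J
    using finite_assoc_primes[OF noeth JJ(1)[OF that]] by metis
  then obtain F where F: "\<And>J. J \<in> JJ \<Longrightarrow> finite (F J)" "\<And>J. J \<in> JJ \<Longrightarrow> F J \<subseteq> assoc_primes J"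
    "\<And>J y. J \<in> JJ \<Longrightarrow> \<not> reg y J \<Longrightarrow> \<exists>P\<in>F J. y \<in> P" by metis
  have "\<exists>b\<in>a. \<forall>P\<in>\<Union>(F ` JJ). 0 + b \<notin> P"
  proof (rule avoidance[OF _ _ a])
    show "finite (\<Union>(F ` JJ))" using fin F(1) by blast
    fix P assume "P \<in> \<Union>(F ` JJ)"
    then obtain J where J: "J \<in> JJ" "P \<in> assoc_primes J" using F(2) by blast
    then show "prime_ideal P" by (simp add: assoc_primes_def)
    from J obtain v where v: "v \<notin> J" "P = colon J v" unfolding assoc_primes_def by blast
    obtain w where "w \<in> a" "reg w J" using JJ(2) J by blast
    with v have "w \<in> a" "w \<notin> P" by (auto simp: colon_def reg_def)
    then show "0 \<notin> P \<or> \<not> a \<subseteq> P" by blast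
  qed
  then obtain b where b: "b \<in> a" "\<And>J P. J \<in> JJ \<Longrightarrow> P \<in> F J \<Longrightarrow> b \<notin> P" by auto
  have "reg b J" if "J \<in> JJ" for J using F(3)[OF that, of b] b(2)[OF that] by blast
  with b(1) show ?thesis by blast
qed

section \<open>Grade and the exchange of regular sequences\<close>

definition grade_ge :: "'a set \<Rightarrow> nat \<Rightarrow> 'a set \<Rightarrow> bool" where
  "grade_ge a n J \<longleftrightarrow> (\<exists>ys. length ys = n \<and> set ys \<subseteq> a \<and> regs J ys)"

lemma grade_geI: "length ys = n \<Longrightarrow> set ys \<subseteq> a \<Longrightarrow> regs J ys \<Longrightarrow> grade_ge a n J"
  by (auto simp: grade_ge_def)

lemma grade_ge_Cons:
  "x \<in> a \<Longrightarrow> reg x J \<Longrightarrow> grade_ge a n (R.span (insert x J)) \<Longrightarrow> grade_ge a (Suc n) J"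
  unfolding grade_ge_def
proof (elim exE conjE)
  fix ys assume "x \<in> a" "reg x J" "length ys = n" "set ys \<subseteq> a" "regs (R.span (insert x J)) ys"
  then show "\<exists>ys. length ys = Suc n \<and> set ys \<subseteq> a \<and> regs J ys"
    by (intro exI[of _ "x # ys"]) auto
qed

text \<open>Let \<open>a\<close> * u be contained in J + (y), and write x1 * u = v * y and x2 * u =
  t * y modulo J. Cancelling y in x2 * v * y = x1 * t * y shows that v is a multiple of x1 modulo J,
  and cancelling x1 that u is a multiple of y. So \<open>ex_reg\<close> applies to J + (y).\<close>

lemma ex_reg_exchange:
  fixes a J :: "'a set"
  assumes a: "R.subspace a" and J: "R.subspace J" and x: "x1 \<in> a" "x2 \<in> a"
    and r: "reg x1 J" "reg x2 (R.span (insert x1 J))" "reg y J"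
  shows "\<exists>w\<in>a. reg w (R.span (insert y J))"
proof (rule ex_reg[OF a R.subspace_span])
  fix u assume u: "\<And>w. w \<in> a \<Longrightarrow> w * u \<in> R.span (insert y J)"
  obtain v where v: "x1 * u - v * y \<in> J" using u[OF x(1)] mem_span_insert[OF J] by blast
  obtain t where t: "x2 * u - t * y \<in> J" using u[OF x(2)] mem_span_insert[OF J] by blast
  have "x1 * (x2 * u - t * y) - x2 * (x1 * u - v * y) \<in> J"
    using v t J R.subspace_scale R.subspace_diff by blast
  then have "y * (x2 * v - t * x1) \<in> J" by (simp add: algebra_simps)
  then have "x2 * v - t * x1 \<in> J" using r(3) by (simp add: reg_def)
  then have "x2 * v \<in> R.span (insert x1 J)" using mem_span_insert[OF J, of "x2 * v" x1] by blast
  then have "v \<in> R.span (insert x1 J)" using r(2) by (simp add: reg_def)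
  then obtain s where s: "v - s * x1 \<in> J" using mem_span_insert[OF J, of v x1] by blast
  have "(x1 * u - v * y) + y * (v - s * x1) \<in> J"
    using v s J R.subspace_scale R.subspace_add by blast
  then have "x1 * (u - s * y) \<in> J" by (simp add: algebra_simps)
  then have "u - s * y \<in> J" using r(1) by (simp add: reg_def)
  then show "u \<in> R.span (insert y J)" using mem_span_insert[OF J, of u y] by blast
qed

text \<open>Elementary substitute for the Ext proof that maximal regular sequences have equal
  length. The connecting element w is regular on J, J + (x1) and J + (y): exchange w modulo x1, move
  x1 behind w, exchange y modulo w, and finally move w behind y.\<close>

lemma grade_exchange:
  assumes "R.subspace a" "a \<subseteq> m" "R.subspace J" "grade_ge a (Suc n) J" "y \<in> a" "reg y J"
  shows "grade_ge a n (R.span (insert y J))"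
  using assms
proof (induction n arbitrary: J y)
  case 0
  then show ?case by (simp add: grade_ge_def)
next
  case (Suc k)
  note a = Suc.prems(1,2) and J = Suc.prems(3)
  from Suc.prems(4) obtain ys where ys: "length ys = Suc (Suc k)" "set ys \<subseteq> a" "regs J ys"
    unfolding grade_ge_def by blast
  then obtain x1 x2 zs where [simp]: "ys = x1 # x2 # zs" by (auto simp: length_Suc_conv)
  have x: "x1 \<in> a" "x2 \<in> a" "reg x1 J" "reg x2 (R.span (insert x1 J))" using ys by auto
  have "\<exists>w\<in>a. \<forall>I\<in>{J, R.span (insert x1 J), R.span (insert y J)}. reg w I"
    using x J Suc.prems(5,6) ex_reg_exchange[OF a(1) J x(1,2,3,4) Suc.prems(6)]
    by (intro common_reg[OF a(1)]) auto
  then obtain w where w: "w \<in> a" "reg w J" "reg w (R.span (insert x1 J))" "reg w (R.span (insert y J))"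
    by auto
  have x1w: "reg x1 (R.span (insert w J))"
    using reg_swap(2)[OF J _ x(3) w(3)] x a by blast
  have yw: "reg y (R.span (insert w J))"
    using reg_swap(2)[OF J _ Suc.prems(6) w(4)] Suc.prems(5) a by blast
  have "grade_ge a (Suc k) (R.span (insert x1 J))"
    using ys by (intro grade_geI[of "x2 # zs"]) auto
  then have "grade_ge a k (R.span (insert w (R.span (insert x1 J))))"
    using w by (intro Suc.IH[OF a]) auto
  then have "grade_ge a (Suc k) (R.span (insert w J))"
    using x1w x by (intro grade_ge_Cons[of x1]) (auto simp: span_insert2[of x1])
  then have "grade_ge a k (R.span (insert y (R.span (insert w J))))"
    using yw Suc.prems(5) by (intro Suc.IH[OF a]) auto
  then show ?case using w by (intro grade_ge_Cons[of w]) (auto simp: span_insert2[of w])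
qed

text \<open>Elements outside the associated primes are found by replacing \<open>x\<close> by \<open>x + j\<close> with \<open>j\<close> in the
  ideal of the remaining generators, which does not change the ideal; the original generator is
  recovered after moving it to the end of the sequence.\<close>

lemma regs_of_grade:
  assumes "R.subspace J" "J \<subseteq> m" "set xs \<subseteq> m" "grade_ge (R.span (J \<union> set xs)) (length xs) J"
  shows "regs J xs"
  using assms
proof (induction xs arbitrary: J)
  case Nil
  then show ?case by simp
next
  case (Cons x xs)
  note J = Cons.prems(1)
  define a where "a = R.span (J \<union> set (x # xs))"
  have a: "R.subspace a" "J \<subseteq> a" "x \<in> a" "set xs \<subseteq> a"
    using R.span_superset[of "J \<union> set (x # xs)"] by (auto simp: a_def)
  have am: "a \<subseteq> m" unfolding a_def
    using Cons.prems by (intro R.span_minimal m_subspace) auto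
  have gr: "grade_ge a (Suc (length xs)) J" using Cons.prems by (simp add: a_def)
  then obtain y where y: "y \<in> a" "reg y J"
    unfolding grade_ge_def by (auto simp: length_Suc_conv)
  obtain F where F: "finite F" "F \<subseteq> assoc_primes J" "\<And>y. \<not> reg y J \<Longrightarrow> \<exists>P\<in>F. y \<in> P"
    using finite_assoc_primes[OF noeth J] by metis
  have "\<exists>b\<in>R.span (set xs). \<forall>P\<in>F. x + b \<notin> P"
  proof (rule avoidance[OF F(1) _ R.subspace_span])
    fix P assume "P \<in> F"
    then have P: "P \<in> assoc_primes J" using F(2) by blast
    then show pP: "prime_ideal P" by (simp add: assoc_primes_def)
    from P obtain v where v: "v \<notin> J" "P = colon J v" unfolding assoc_primes_def by blast
    show "x \<notin> P \<or> \<not> R.span (set xs) \<subseteq> P"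
    proof (rule ccontr)
      assume "\<not> (x \<notin> P \<or> \<not> R.span (set xs) \<subseteq> P)"
      then have "insert x (set xs) \<subseteq> P" using R.span_superset[of "set xs"] by blast
      moreover have "J \<subseteq> P" using v J subspace_mult_right by (auto simp: colon_def)
      ultimately have "a \<subseteq> P" unfolding a_def
        by (intro R.span_minimal prime_subspace[OF pP]) auto
      then show False using y v by (auto simp: colon_def reg_def)
    qed
  qed
  then obtain b where b: "b \<in> R.span (set xs)" "\<forall>P\<in>F. x + b \<notin> P" by blast
  define x' where "x' = x + b"
  have rx': "reg x' J" using b F(3) by (auto simp: x'_def)
  have "R.span (set xs) \<subseteq> a" by (rule R.span_minimal[OF a(4,1)])
  then have x'a: "x' \<in> a" using b(1) a by (auto simp: x'_def intro: R.subspace_add)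
  have "R.span (R.span (insert x' J) \<union> set xs) = a"
  proof (rule antisym)
    show "R.span (R.span (insert x' J) \<union> set xs) \<subseteq> a"
      using a x'a by (simp add: span_Un_span R.span_minimal)
    have "b \<in> R.span (insert x' (J \<union> set xs))"
      using b(1) R.span_mono[of "set xs" "insert x' (J \<union> set xs)"] by blast
    moreover have "x' \<in> R.span (insert x' (J \<union> set xs))" by (simp add: R.span_base)
    ultimately have "x' - b \<in> R.span (insert x' (J \<union> set xs))" by (rule R.span_diff[rotated])
    then have "x \<in> R.span (insert x' (J \<union> set xs))" by (simp add: x'_def)
    then show "a \<subseteq> R.span (R.span (insert x' J) \<union> set xs)"
      unfolding a_def span_Un_span using R.span_superset[of "insert x' (J \<union> set xs)"]
      by (intro R.span_minimal) auto
  qed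
  moreover have "grade_ge a (length xs) (R.span (insert x' J))"
    by (rule grade_exchange[OF a(1) am J gr x'a rx'])
  moreover have "R.span (insert x' J) \<subseteq> m"
    using x'a am Cons.prems by (intro R.span_minimal m_subspace) auto
  ultimately have "regs (R.span (insert x' J)) xs" using Cons by simp
  with rx' have "regs J (x' # xs)" by simp
  then have "regs J (xs @ [x'])"
    using regs_rotate[OF J, of x' xs] x'a am Cons.prems by auto
  then have xs: "regs J xs" "reg x' (R.span (J \<union> set xs))" by (auto simp: regs_append[OF J])
  have "b \<in> R.span (J \<union> set xs)" using b(1) R.span_mono[of "set xs" "J \<union> set xs"] by blast
  then have "x' - x \<in> R.span (J \<union> set xs)" by (simp add: x'_def)
  from reg_cong[OF R.subspace_span this xs(2)] have "regs J (xs @ [x])"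
    using xs by (auto simp: regs_append[OF J])
  then show ?case using regs_rotate[OF J, of x xs] Cons.prems by auto
qed

end

section \<open>Heights in Cohen--Macaulay local rings\<close>

lemma span_insert_zero [simp]: "R.span (insert 0 S) = R.span (S :: 'a::comm_ring_1 set)"
  using span_Un_span[of "{}" S] by simp

lemma regs_nth:
  "R.subspace J \<Longrightarrow> regs J xs \<longleftrightarrow> (\<forall>i<length xs. reg (xs ! i) (R.span (J \<union> set (take i xs))))"
proof (induction xs arbitrary: J)
  case Nil
  then show ?case by simp
next
  case (Cons x xs)
  have eq: "R.span (R.span (insert x J) \<union> S) = R.span (insert x (J \<union> S))" for S
    by (simp add: span_Un_span)
  have "R.span J = J" using Cons.prems by (rule R.span_eq_iff[THEN iffD2])
  then show ?case using Cons.IH[of "R.span (insert x J)"]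
    by (simp add: eq All_less_Suc2 del: R.span_eq_iff)
qed

lemma reg_power: "reg x J \<Longrightarrow> s * x ^ k \<in> J \<Longrightarrow> s \<in> J"
proof (induction k)
  case (Suc k)
  have "x * (s * x ^ k) \<in> J" using Suc.prems(2) by (simp add: mult_ac)
  then show ?case using Suc by (simp add: reg_def)
qed simp

section \<open>Chains of primes and heights\<close>

definition prime_chain :: "nat \<Rightarrow> (nat \<Rightarrow> 'a::comm_ring_1 set) \<Rightarrow> bool" where
  "prime_chain n c \<longleftrightarrow> (\<forall>i\<le>n. prime_ideal (c i)) \<and> (\<forall>i<n. c i \<subset> c (Suc i))"

lemma prime_height_chain: "prime_height P = Sup {enat n | n. \<exists>c. prime_chain n c \<and> c n = P}"
  unfolding prime_height_def prime_chain_def by (simp add: conj_assoc)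

lemma prime_chain_0: "prime_ideal P \<Longrightarrow> prime_chain 0 (\<lambda>_. P)"
  by (simp add: prime_chain_def)

lemma prime_chain_snoc:
  assumes "prime_chain n c" "prime_ideal Q" "c n \<subset> Q"
  shows "prime_chain (Suc n) (\<lambda>i. if i \<le> n then c i else Q)"
  using assms by (auto simp: prime_chain_def less_Suc_eq le_Suc_eq)

lemma prime_chain_Cons:
  assumes "prime_chain n c" "prime_ideal P" "P \<subset> c 0"
  shows "prime_chain (Suc n) (\<lambda>i. case i of 0 \<Rightarrow> P | Suc j \<Rightarrow> c j)"
  using assms by (auto simp: prime_chain_def split: nat.split)

lemma prime_chain_append:
  assumes "prime_chain n c" "prime_chain k e" "c n = e 0"
  shows "prime_chain (n + k) (\<lambda>i. if i \<le> n then c i else e (i - n))"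
  unfolding prime_chain_def
proof (intro conjI allI impI)
  fix i assume "i \<le> n + k"
  then show "prime_ideal (if i \<le> n then c i else e (i - n))"
    using assms by (auto simp: prime_chain_def)
next
  fix i assume i: "i < n + k"
  consider "i < n" | "i = n" "0 < k" | "i > n" using i by linarith
  then show "(if i \<le> n then c i else e (i - n)) \<subset> (if Suc i \<le> n then c (Suc i) else e (Suc i - n))"
  proof cases
    case 1
    then show ?thesis using assms(1) by (simp add: prime_chain_def)
  next
    case 2
    then show ?thesis using assms(2,3) by (simp add: prime_chain_def)
  next
    case 3
    then have "e (i - n) \<subset> e (Suc (i - n))"
      using assms(2) i by (simp add: prime_chain_def)
    moreover have "Suc i - n = Suc (i - n)" using 3 by simp
    ultimately show ?thesis using 3 by simp
  qed
qed

lemma prime_height_ge: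
  assumes "prime_chain n c" "c n = P"
  shows "enat n \<le> prime_height P"
  unfolding prime_height_chain by (rule Sup_upper) (use assms in auto)

text \<open>The height is a supremum that may be infinite, so only some chain of length at least n
  is obtained. If all chains were shorter than n, the supremum would be at most n - 1; the chain of
  length 0 excludes n = 0.\<close>

lemma prime_height_geD:
  assumes P: "prime_ideal P" and h: "enat n \<le> prime_height P"
  shows "\<exists>k\<ge>n. \<exists>c. prime_chain k c \<and> c k = P"
proof (rule ccontr)
  assume n: "\<not> ?thesis"
  have "prime_chain 0 (\<lambda>_. P) \<and> (\<lambda>_. P) (0::nat) = P" using prime_chain_0[OF P] by simp
  then have "n \<noteq> 0" using n by (metis order_refl)
  have "prime_height P \<le> enat (n - 1)"
    unfolding prime_height_chain
  proof (rule Sup_least, clarify)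
    fix k c assume "prime_chain k c" "P = c k"
    then have "\<not> n \<le> k" using n by blast
    then show "enat k \<le> enat (n - 1)" by simp
  qed
  with h have "enat n \<le> enat (n - 1)" by (rule order_trans)
  with \<open>n \<noteq> 0\<close> show False by simp
qed

lemma ideal_height_geD:
  "n \<le> ideal_height I \<Longrightarrow> prime_ideal P \<Longrightarrow> I \<subseteq> P \<Longrightarrow> n \<le> prime_height P"
  unfolding ideal_height_def by (auto simp: le_INF_iff)

lemma ideal_height_geI:
  "(\<And>P. prime_ideal P \<Longrightarrow> I \<subseteq> P \<Longrightarrow> n \<le> prime_height P) \<Longrightarrow> n \<le> ideal_height I"
  unfolding ideal_height_def by (auto simp: le_INF_iff)

context noetherian_local
begin

lemma assoc_prime_above:
  fixes B :: "'a set"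
  assumes B: "R.subspace B" and J: "R.subspace J" and n: "\<And>w. w \<in> B \<Longrightarrow> \<not> reg w J"
  shows "\<exists>P\<in>assoc_primes J. B \<subseteq> P"
proof (rule ccontr)
  assume n': "\<not> ?thesis"
  obtain F where F: "finite F" "F \<subseteq> assoc_primes J" "\<And>y. \<not> reg y J \<Longrightarrow> \<exists>P\<in>F. y \<in> P"
    using finite_assoc_primes[OF noeth J] by metis
  have "\<exists>b\<in>B. \<forall>P\<in>F. 0 + b \<notin> P"
  proof (rule avoidance[OF F(1) _ B])
    fix P assume "P \<in> F"
    then have P: "P \<in> assoc_primes J" using F(2) by blast
    then show "prime_ideal P" by (simp add: assoc_primes_def)
    show "0 \<notin> P \<or> \<not> B \<subseteq> P" using P n' by blast
  qed
  then show False using F(3) n by auto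
qed

text \<open>Replaces localization at P: a prime that misses all s * x^k with s outside P lies inside
  P and avoids x. The ideal J misses these products because x is regular on J and J lies in
  P.\<close>

lemma prime_below:
  fixes P :: "'a set"
  assumes P: "prime_ideal P" and J: "R.subspace J" "J \<subseteq> P" and x: "reg x J"
  obtains Q where "prime_ideal Q" "J \<subseteq> Q" "Q \<subseteq> P" "x \<notin> Q"
proof -
  define S where "S = {s * x ^ k | s k. s \<notin> P}"
  have "1 \<in> S" unfolding S_def using prime_one[OF P] by (intro CollectI exI[of _ 1] exI[of _ 0]) simp
  moreover have "y * z \<in> S" if yz: "y \<in> S" "z \<in> S" for y z
  proof -
    obtain s k t l where *: "y = s * x ^ k" "s \<notin> P" "z = t * x ^ l" "t \<notin> P"
      using yz by (auto simp: S_def)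
    then have "y * z = (s * t) * x ^ (k + l)" by (simp add: power_add mult_ac)
    moreover have "s * t \<notin> P" using * prime_mult[OF P] by blast
    ultimately show ?thesis unfolding S_def by blast
  qed
  moreover have "J \<inter> S = {}" using reg_power[OF x] J by (auto simp: S_def)
  ultimately obtain Q where Q: "prime_ideal Q" "J \<subseteq> Q" "Q \<inter> S = {}"
    by (rule prime_avoiding[OF noeth _ _ J(1)])
  have "s \<in> S" if "s \<notin> P" for s
    unfolding S_def using that by (intro CollectI exI[of _ s] exI[of _ 0]) simp
  with Q have "Q \<subseteq> P" by blast
  moreover have "x \<in> S"
    unfolding S_def using prime_one[OF P] by (intro CollectI exI[of _ 1]) (simp add: exI[of _ 1])
  ultimately show ?thesis using that Q by blast
qed

text \<open>The ideal J : P is not contained in J + (x), since otherwise J : P = J + x (J : P) and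
  Nakayama would give J : P = J. An element v of it outside J + (x) is killed by P and by x modulo J
  + (x), so an associated prime contains both, while x is not in P.\<close>

lemma assoc_prime_chain_step:
  assumes J: "R.subspace J" and P: "P \<in> assoc_primes J" and x: "x \<in> m" "reg x J"
  shows "\<exists>Q\<in>assoc_primes (R.span (insert x J)). P \<subset> Q"
proof -
  obtain u where u: "u \<notin> J" "P = colon J u" using P unfolding assoc_primes_def by blast
  define K where "K = {v. \<forall>r\<in>P. r * v \<in> J}"
  have K: "R.subspace K" unfolding K_def using J by (auto simp: R.subspace_def distrib_left mult.left_commute)
  have "\<not> K \<subseteq> R.span (insert x J)"
  proof
    assume KJ: "K \<subseteq> R.span (insert x J)"
    have "K \<subseteq> J"
    proof (rule nakayama1[OF noeth local J K x(1)])
      fix k assume k: "k \<in> K"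
      then obtain r where r: "k - r * x \<in> J" using KJ mem_span_insert[OF J, of k x] by blast
      have "s * r \<in> J" if "s \<in> P" for s
      proof -
        have "s * k - s * (k - r * x) \<in> J"
          using k r that J R.subspace_diff R.subspace_scale unfolding K_def by blast
        then have "x * (s * r) \<in> J" by (simp add: algebra_simps)
        then show ?thesis using x(2) by (simp add: reg_def)
      qed
      then have "r \<in> K" by (simp add: K_def)
      with r show "\<exists>k'\<in>K. k - x * k' \<in> J" by (auto simp: mult.commute)
    qed
    moreover have "u \<in> K" using u by (simp add: K_def colon_def)
    ultimately show False using u by blast
  qed
  then obtain v where v: "v \<in> K" "v \<notin> R.span (insert x J)" by blast
  let ?J = "R.span (insert x J)"
  have JJ: "insert x J \<subseteq> ?J" by (rule R.span_superset)
  have "\<exists>Q\<in>assoc_primes ?J. colon ?J v \<subseteq> Q"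
  proof (rule assoc_prime_above)
    fix w assume "w \<in> colon ?J v"
    then show "\<not> reg w ?J" using v by (auto simp: colon_def reg_def)
  qed (simp_all add: subspace_colon)
  then obtain Q where Q: "Q \<in> assoc_primes ?J" "colon ?J v \<subseteq> Q" by blast
  have "P \<subseteq> colon ?J v" using v JJ by (auto simp: K_def colon_def)
  moreover have "x \<in> colon ?J v" using JJ subspace_mult_right[OF R.subspace_span, of x] by (simp add: colon_def)
  moreover have "x \<notin> P" using u x by (auto simp: colon_def reg_def)
  ultimately show ?thesis using Q by blast
qed

lemma prime_sub_m: "prime_ideal P \<Longrightarrow> P \<subseteq> m"
  using proper_in_max[OF noeth local] by (auto simp: prime_ideal_def ideal_simps)

lemma assoc_prime_chain:
  assumes "R.subspace J" "P \<in> assoc_primes J" "set xs \<subseteq> m" "regs J xs"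
  shows "\<exists>c. prime_chain (length xs) c \<and> c 0 = P"
  using assms
proof (induction xs arbitrary: J P)
  case Nil
  then show ?case using prime_chain_0[of P] by (auto simp: assoc_primes_def)
next
  case (Cons x xs)
  then obtain Q where Q: "Q \<in> assoc_primes (R.span (insert x J))" "P \<subset> Q"
    using assoc_prime_chain_step[of J P x] by auto
  then obtain c where c: "prime_chain (length xs) c" "c 0 = Q"
    using Cons.IH[of "R.span (insert x J)" Q] Cons.prems by auto
  then show ?case using prime_chain_Cons[OF c(1), of P] Cons.prems Q
    by (intro exI[of _ "\<lambda>i. case i of 0 \<Rightarrow> P | Suc j \<Rightarrow> c j"]) (simp add: assoc_primes_def)
qed

lemma grade_exchange_list:
  assumes "R.subspace J" "set ys \<subseteq> m" "regs J ys" "grade_ge m (length ys + n) J"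
  shows "grade_ge m n (R.span (J \<union> set ys))"
  using assms
proof (induction ys arbitrary: J)
  case Nil
  then show ?case by (simp add: R.span_eq_iff[THEN iffD2])
next
  case (Cons y ys)
  have "grade_ge m (length ys + n) (R.span (insert y J))"
    using Cons.prems by (intro grade_exchange m_subspace) auto
  then have "grade_ge m n (R.span (R.span (insert y J) \<union> set ys))"
    using Cons.prems by (intro Cons.IH) auto
  then show ?case by (simp add: span_Un_span)
qed

text \<open>The last element x is regular modulo the preceding ones, so below P there is a prime
  that contains these and misses x; the chain grows downwards from P.\<close>

lemma regs_prime_chain:
  fixes xs :: "'a list"
  assumes "regs {0} xs" "prime_ideal P" "set xs \<subseteq> P"
  shows "\<exists>c. prime_chain (length xs) c \<and> c (length xs) = P"
  using assms
proof (induction xs arbitrary: P rule: rev_induct)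
  case Nil
  then show ?case using prime_chain_0[of P] by auto
next
  case (snoc x xs)
  let ?J = "R.span (set xs)"
  have r: "regs {0} xs" "reg x ?J" using snoc.prems(1) by (auto simp: regs_append)
  have "?J \<subseteq> P" using snoc.prems by (intro R.span_minimal prime_subspace) auto
  then obtain Q where Q: "prime_ideal Q" "?J \<subseteq> Q" "Q \<subseteq> P" "x \<notin> Q"
    using prime_below[OF snoc.prems(2) R.subspace_span _ r(2)] by blast
  then have QP: "Q \<subset> P" using snoc.prems(3) by auto
  have "set xs \<subseteq> Q" using Q R.span_superset[of "set xs"] by blast
  then obtain c where c: "prime_chain (length xs) c" "c (length xs) = Q"
    using snoc.IH[OF r(1) Q(1)] by blast
  then have "prime_chain (Suc (length xs)) (\<lambda>i. if i \<le> length xs then c i else P)"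
    using prime_chain_snoc[OF c(1) snoc.prems(2)] QP by simp
  then show ?case by (intro exI[of _ "\<lambda>i. if i \<le> length xs then c i else P"]) simp
qed

end

section \<open>Unmixedness, parameters and nonzerodivisors in a Cohen-Macaulay local ring\<close>

locale cm_local_ring = noetherian_local m for m :: "'a::comm_ring_1 set" +
  fixes d :: nat
  assumes CM: "CM_local m d"
begin

lemma m_height: "prime_height m = enat d"
proof -
  have "{P. prime_ideal P \<and> m \<subseteq> P} = {m}"
    using m_prime prime_sub_m by auto
  then have "ideal_height m = prime_height m" by (simp add: ideal_height_def)
  then show ?thesis using CM by (simp add: CM_local_def)
qed

lemma prime_chain_le:
  fixes c :: "nat \<Rightarrow> 'a set"
  assumes "prime_chain n c"
  shows "n \<le> d"
proof (cases "c n = m")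
  case True
  from prime_height_ge[OF assms this] show ?thesis by (simp add: m_height)
next
  case False
  then have "c n \<subset> m" using prime_sub_m[of "c n"] assms by (auto simp: prime_chain_def)
  from prime_height_ge[OF prime_chain_snoc[OF assms m_prime this], of m] show ?thesis
    by (simp add: m_height)
qed

lemma prime_chain_le_strict:
  fixes c :: "nat \<Rightarrow> 'a set"
  assumes "prime_chain n c" "c n \<noteq> m"
  shows "n < d"
proof -
  have "c n \<subset> m" using prime_sub_m[of "c n"] assms by (auto simp: prime_chain_def)
  from prime_chain_le[OF prime_chain_snoc[OF assms(1) m_prime this]] show ?thesis by simp
qed

lemma grade_m: "grade_ge m d {0}"
proof -
  obtain xs where xs: "length xs = d" "set xs \<subseteq> m" "regular_seq xs"
    using CM unfolding CM_local_def by blast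
  have "regs {0} xs"
    using xs(3) by (simp add: regs_nth regular_seq_def ideal_simps reg_def)
  with xs show ?thesis by (auto simp: grade_ge_def)
qed

lemma regs_length_le:
  assumes "set xs \<subseteq> m" "regs {0} xs"
  shows "length xs \<le> d"
  using regs_prime_chain[OF assms(2) m_prime assms(1)] prime_chain_le by blast

text \<open>Unmixedness: a chain below an associated prime continues upwards by the remaining depth.\<close>

lemma unmixed:
  fixes P :: "'a set"
  assumes xs: "set xs \<subseteq> m" "regs {0} xs" and P: "P \<in> assoc_primes (R.span (set xs))"
    and c: "prime_chain k c" "c k = P"
  shows "k \<le> length xs"
proof -
  have l: "length xs + (d - length xs) = d" using regs_length_le[OF xs] by simp
  have "grade_ge m (d - length xs) (R.span ({0} \<union> set xs))"
    by (rule grade_exchange_list) (use xs grade_m l in auto)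
  then obtain ys where ys: "length ys = d - length xs" "set ys \<subseteq> m" "regs (R.span (set xs)) ys"
    by (auto simp: grade_ge_def)
  obtain e where e: "prime_chain (length ys) e" "e 0 = P"
    using assoc_prime_chain[OF R.subspace_span P ys(2,3)] by blast
  have "k + length ys \<le> d"
    using prime_chain_le[OF prime_chain_append[OF c(1) e(1)]] c(2) e(2) by simp
  then show ?thesis using ys(1) l by linarith
qed

text \<open>A regular sequence \<open>ys\<close> in I of length j < n can be prolonged inside I:
  otherwise I would lie in an associated prime of the ideal of \<open>ys\<close>, and by unmixedness
  chains of primes ending there have length at most j.\<close>

lemma grade_of_height:
  assumes I: "R.subspace I" "I \<subseteq> m" and h: "enat n \<le> ideal_height I"
  shows "grade_ge I n {0}"
proof -
  have "grade_ge I j {0}" if "j \<le> n" for j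
    using that
  proof (induction j)
    case 0
    show ?case by (rule grade_geI[of "[]"]) auto
  next
    case (Suc j)
    then obtain ys where ys: "length ys = j" "set ys \<subseteq> I" "regs {0} ys"
      by (auto simp: grade_ge_def)
    have "\<exists>w\<in>I. reg w (R.span (set ys))"
    proof (rule ccontr)
      assume "\<not> ?thesis"
      then obtain P where P: "P \<in> assoc_primes (R.span (set ys))" "I \<subseteq> P"
        using assoc_prime_above[OF I(1) R.subspace_span, of "set ys"] by blast
      have pP: "prime_ideal P" using P by (simp add: assoc_primes_def)
      obtain k c where "k \<ge> n" "prime_chain k c" "c k = P"
        using prime_height_geD[OF pP ideal_height_geD[OF h pP P(2)]] by blast
      moreover have "set ys \<subseteq> m" using ys I by blast
      ultimately have "k \<le> j" using unmixed[OF _ ys(3) P(1)] ys by blast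
      with \<open>k \<ge> n\<close> Suc.prems show False by simp
    qed
    then obtain w where "w \<in> I" "reg w (R.span (set ys))" by blast
    then show ?case using ys by (intro grade_geI[of "ys @ [w]"]) (auto simp: regs_append)
  qed
  then show ?thesis by simp
qed

lemma parameter_regs:
  assumes "R.span (set xs) \<noteq> UNIV" "enat (length xs) \<le> ideal_height (R.span (set xs))"
  shows "set xs \<subseteq> m" "regs {0} xs"
proof -
  have sm: "R.span (set xs) \<subseteq> m" using proper_in_max[OF noeth local] assms by blast
  then show xm: "set xs \<subseteq> m" using R.span_superset by blast
  have "grade_ge (R.span (set xs)) (length xs) {0}"
    by (rule grade_of_height) (use sm assms in auto)
  then show "regs {0} xs"
    using xm R.subspace_0[OF m_subspace] by (intro regs_of_grade) auto
qed

lemma sop_prime: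
  assumes "sop m d as" "prime_ideal P" "set as \<subseteq> P"
  shows "P = m"
proof (rule antisym[OF prime_sub_m[OF assms(2)]])
  have "R.span (set as) \<subseteq> P" using assms by (intro R.span_minimal prime_subspace)
  then show "m \<subseteq> P"
    using assms(1) prime_ideal_power[OF assms(2)] by (fastforce simp: sop_def radical_def ideal_simps)
qed

lemma sop_height:
  assumes "sop m d as"
  shows "ideal_height (R.span (set as)) = enat d"
proof -
  have "R.span (set as) \<subseteq> m" using assms m_subspace by (intro R.span_minimal) (auto simp: sop_def)
  then have "{P. prime_ideal P \<and> R.span (set as) \<subseteq> P} = {m}"
    using sop_prime[OF assms] m_prime R.span_superset[of "set as"] by blast
  then show ?thesis using m_height by (simp add: ideal_height_def)
qed

lemma sop_proper: "sop m d as \<Longrightarrow> R.span (set as) \<subseteq> m"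
  using m_subspace by (intro R.span_minimal) (auto simp: sop_def)

lemma sop_regs:
  assumes "sop m d as"
  shows "regs {0} as"
proof (rule parameter_regs)
  show "R.span (set as) \<noteq> UNIV" using sop_proper[OF assms] m_one by auto
  show "enat (length as) \<le> ideal_height (R.span (set as))"
    using sop_height[OF assms] assms by (simp add: sop_def)
qed

text \<open>If no power of some x in \<open>m\<close> lay in the ideal, a prime over the ideal would
  miss all powers of x. Recognising parameters by the primes above them makes the passage to powers
  immediate.\<close>

lemma sop_primeI:
  assumes "length L = d" "set L \<subseteq> m" "\<And>P. prime_ideal P \<Longrightarrow> set L \<subseteq> P \<Longrightarrow> P = m"
  shows "sop m d L"
  unfolding sop_def radical_def ideal_simps
proof (intro conjI assms subsetI CollectI)
  fix x assume x: "x \<in> m"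
  show "\<exists>n. x ^ n \<in> R.span (set L)"
  proof (rule ccontr)
    assume n: "\<not> ?thesis"
    obtain P where P: "prime_ideal P" "R.span (set L) \<subseteq> P" "P \<inter> range (\<lambda>n. x ^ n) = {}"
    proof (rule prime_avoiding[OF noeth, of "range (\<lambda>n. x ^ n)" "R.span (set L)"])
      show "1 \<in> range (\<lambda>n. x ^ n)" by (rule range_eqI[of _ _ 0]) simp
      fix y z assume "y \<in> range (\<lambda>n. x ^ n)" "z \<in> range (\<lambda>n. x ^ n)"
      then show "y * z \<in> range (\<lambda>n. x ^ n)" by (auto simp flip: power_add)
    qed (use n in blast)+
    have "x \<in> range (\<lambda>n. x ^ n)" by (rule range_eqI[of _ _ 1]) simp
    moreover have "P = m" using assms(3)[OF P(1)] P(2) R.span_superset[of "set L"] by (meson order_trans)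
    ultimately show False using x P(3) by blast
  qed
qed

lemma regs_sop:
  assumes "length xs = d" "set xs \<subseteq> m" "regs {0} xs"
  shows "sop m d xs"
proof (rule sop_primeI[OF assms(1,2)])
  fix P assume P: "prime_ideal P" "set xs \<subseteq> P"
  then obtain c where "prime_chain d c" "c d = P"
    using regs_prime_chain[OF assms(3)] assms(1) by blast
  then show "P = m" using prime_chain_le_strict by blast
qed

lemma regs_extend_sop:
  assumes "set xs \<subseteq> m" "regs {0} xs"
  shows "\<exists>ys. sop m d (xs @ ys)"
proof -
  have l: "length xs + (d - length xs) = d" using regs_length_le[OF assms] by simp
  have "grade_ge m (d - length xs) (R.span ({0} \<union> set xs))"
    by (rule grade_exchange_list) (use assms grade_m l in auto)
  then obtain ys where "length ys = d - length xs" "set ys \<subseteq> m" "regs (R.span (set xs)) ys"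
    by (auto simp: grade_ge_def)
  then show ?thesis using assms l
    by (intro exI[of _ ys] regs_sop) (auto simp: regs_append)
qed

lemma assoc_prime_0_height:
  fixes P :: "'a set"
  assumes "P \<in> assoc_primes {0}" "prime_chain k c" "c k = P"
  shows "k = 0"
  using unmixed[of "[]" P k c] assms by simp

text \<open>By unmixedness the associated primes of 0 are minimal; conversely,
  \<open>prime_below\<close> shows that a minimal prime contains no nonzerodivisor.\<close>

lemma R_circ_iff: "(r :: 'a) \<in> R_circ \<longleftrightarrow> reg r {0}"
proof
  assume r: "r \<in> R_circ"
  show "reg r {0}"
  proof (rule ccontr)
    assume "\<not> reg r {0}"
    then obtain z where z: "r * z = 0" "z \<noteq> 0" by (auto simp: reg_def)
    have "\<exists>P\<in>assoc_primes {0}. colon {0} z \<subseteq> P"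
    proof (rule assoc_prime_above)
      show "R.subspace (colon {0} z)" by (rule subspace_colon) simp
      fix w assume "w \<in> colon {0} z"
      then show "\<not> reg w {0}" using z by (auto simp: reg_def colon_def)
    qed simp
    then obtain P where P: "P \<in> assoc_primes {0}" "r \<in> P" using z by (auto simp: colon_def)
    have "minimal_prime P"
      unfolding minimal_prime_def
    proof (intro conjI allI impI)
      show pP: "prime_ideal P" using P by (simp add: assoc_primes_def)
      fix Q assume Q: "prime_ideal Q \<and> Q \<subseteq> P"
      show "Q = P"
      proof (rule ccontr)
        assume "Q \<noteq> P"
        with Q have "Q \<subset> P" by blast
        from prime_chain_snoc[OF prime_chain_0 pP this] Q
        have "prime_chain (Suc 0) (\<lambda>i. if i \<le> 0 then Q else P)" by blast
        from assoc_prime_0_height[OF P(1) this] show False by simp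
      qed
    qed
    with r P show False by (simp add: R_circ_def)
  qed
next
  assume r: "reg r {0}"
  show "r \<in> R_circ"
    unfolding R_circ_def
  proof (intro CollectI allI impI notI)
    fix P assume P: "minimal_prime P" "r \<in> P"
    then have pP: "prime_ideal P" by (simp add: minimal_prime_def)
    have "{0} \<subseteq> P" using R.subspace_0[OF prime_subspace[OF pP]] by simp
    then obtain Q where "prime_ideal Q" "Q \<subseteq> P" "r \<notin> Q"
      using prime_below[OF pP R.subspace_single_0 _ r] by metis
    with P show False unfolding minimal_prime_def by metis
  qed
qed

lemma height_ge_1_iff:
  fixes b :: "'a set"
  assumes b: "R.subspace b"
  shows "1 \<le> ideal_height b \<longleftrightarrow> (\<exists>c\<in>b. reg c {0})"
proof
  assume h: "1 \<le> ideal_height b"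
  show "\<exists>c\<in>b. reg c {0}"
  proof (rule ccontr)
    assume "\<not> ?thesis"
    then obtain P where P: "P \<in> assoc_primes {0}" "b \<subseteq> P"
      using assoc_prime_above[OF b R.subspace_single_0] by blast
    then have pP: "prime_ideal P" by (simp add: assoc_primes_def)
    have "enat 1 \<le> prime_height P"
      using ideal_height_geD[OF h pP P(2)] by (simp add: one_enat_def)
    then obtain k c where "k \<ge> 1" "prime_chain k c" "c k = P"
      using prime_height_geD[OF pP] by blast
    with assoc_prime_0_height[OF P(1)] show False by fastforce
  qed
next
  assume "\<exists>c\<in>b. reg c {0}"
  then obtain c where c: "c \<in> b" "reg c {0}" by blast
  show "1 \<le> ideal_height b"
  proof (rule ideal_height_geI)
    fix P assume P: "prime_ideal P" "b \<subseteq> P"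
    have "c \<in> P" using c P by blast
    with regs_prime_chain[of "[c]" P] c P(1) obtain e where "prime_chain 1 e" "e 1 = P" by auto
    then show "1 \<le> prime_height P" using prime_height_ge[of 1 e P] by (simp add: one_enat_def)
  qed
qed

end

section \<open>Artinian modules and duality\<close>

locale local_module = noetherian_local m + module scale
  for m :: "'a::comm_ring_1 set" and scale :: "'a \<Rightarrow> 'h::ab_group_add \<Rightarrow> 'h" (infixr "*s" 75)
begin

lemma span_ident: "subspace W \<Longrightarrow> span W = W"
  by simp

text \<open>The Artinian property of W / Z. Quotient modules are never formed: they are represented
  throughout by pairs of nested submodules of one type.\<close>

definition dcc :: "'h set \<Rightarrow> 'h set \<Rightarrow> bool" where
  "dcc Z W \<longleftrightarrow> (\<forall>F. F \<noteq> {} \<longrightarrow> (\<forall>N\<in>F. subspace N \<and> Z \<subseteq> N \<and> N \<subseteq> W) \<longrightarrow>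
     (\<exists>N\<in>F. \<forall>N'\<in>F. N' \<subseteq> N \<longrightarrow> N' = N))"

lemma dcc_minimal:
  assumes "dcc Z W" "subspace N0" "Z \<subseteq> N0" "N0 \<subseteq> W" "Q N0"
  obtains N where "subspace N" "Z \<subseteq> N" "N \<subseteq> W" "Q N"
    "\<And>N'. subspace N' \<Longrightarrow> Z \<subseteq> N' \<Longrightarrow> N' \<subseteq> N \<Longrightarrow> Q N' \<Longrightarrow> N' = N"
proof -
  let ?F = "{N. subspace N \<and> Z \<subseteq> N \<and> N \<subseteq> W \<and> Q N}"
  have "?F \<noteq> {}" using assms by blast
  with assms(1) obtain N where "N \<in> ?F" "\<forall>N'\<in>?F. N' \<subseteq> N \<longrightarrow> N' = N"
    unfolding dcc_def by (metis (no_types, lifting) mem_Collect_eq)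
  then show ?thesis using that[of N] by (smt (verit, best) mem_Collect_eq order_trans)
qed

lemma dcc_mono: "dcc Z W \<Longrightarrow> Z \<subseteq> Z' \<Longrightarrow> W' \<subseteq> W \<Longrightarrow> dcc Z' W'"
  unfolding dcc_def by (meson order_trans)

lemma span_insert_iff: "subspace W \<Longrightarrow> z \<in> span (insert u W) \<longleftrightarrow> (\<exists>r. z - r *s u \<in> W)"
  by (simp add: span_insert span_ident)

lemma span_Un_iff:
  "subspace V \<Longrightarrow> subspace W \<Longrightarrow> z \<in> span (V \<union> W) \<longleftrightarrow> (\<exists>v\<in>V. z - v \<in> W)"
proof -
  assume "subspace V" "subspace W"
  then have "z \<in> span (V \<union> W) \<longleftrightarrow> (\<exists>x y. z = x + y \<and> x \<in> V \<and> y \<in> W)"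
    by (simp add: span_Un span_ident)
  also have "\<dots> \<longleftrightarrow> (\<exists>v\<in>V. z - v \<in> W)"
    by (metis add_diff_cancel_left' diff_add_cancel add.commute)
  finally show ?thesis .
qed

lemma unit_scale: "r \<notin> m \<Longrightarrow> \<exists>s. \<forall>h. s *s (r *s h) = h"
  using local_unit[OF noeth local] by (metis scale_one scale_scale)

text \<open>Finite length over \<open>B\<close>: in each step \<open>m\<close> * u already lies in
  U, so the new factor is zero or a copy of the residue field.\<close>

inductive fin_over :: "'h set \<Rightarrow> 'h set \<Rightarrow> bool" for B where
  fin_base: "fin_over B B"
| fin_step: "fin_over B U \<Longrightarrow> (\<And>y. y \<in> m \<Longrightarrow> y *s u \<in> U) \<Longrightarrow> fin_over B (span (insert u U))"

lemma fin_over_subspace: "fin_over B U \<Longrightarrow> subspace B \<Longrightarrow> subspace U \<and> B \<subseteq> U"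
proof (induction rule: fin_over.induct)
  case (fin_step U u)
  have "insert u U \<subseteq> span (insert u U)" by (rule span_superset)
  with fin_step.IH[OF fin_step.prems] show ?case by (metis insert_subset order_trans subspace_span)
qed simp

lemma fin_over_trans:
  assumes "fin_over U V" "fin_over B U"
  shows "fin_over B V"
  using assms(1)
proof (induction rule: fin_over.induct)
  case fin_base
  show ?case by (rule assms(2))
next
  case (fin_step V u)
  show ?case by (rule fin_over.fin_step[OF fin_step.IH fin_step.hyps(2)])
qed

text \<open>Take N1 with minimal trace on U. If no smaller member lies inside U, every N' below N1
  contains some w outside U; its coefficient at u is a unit, so N' and N1 agree modulo U as well as
  on U.\<close>

lemma fin_over_dcc: "fin_over B U \<Longrightarrow> subspace B \<Longrightarrow> dcc B U"
proof (induction rule: fin_over.induct)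
  case fin_base
  show ?case
    unfolding dcc_def
  proof (intro allI impI)
    fix F assume F: "F \<noteq> {}" "\<forall>N\<in>F. subspace N \<and> B \<subseteq> N \<and> N \<subseteq> B"
    then have "N = B" if "N \<in> F" for N using that by (intro antisym) auto
    with F(1) show "\<exists>N\<in>F. \<forall>N'\<in>F. N' \<subseteq> N \<longrightarrow> N' = N" by (metis ex_in_conv)
  qed
next
  case (fin_step U u)
  have U: "subspace U" using fin_over_subspace fin_step by blast
  show ?case
    unfolding dcc_def
  proof (intro allI impI)
    fix F assume F: "F \<noteq> {}" "\<forall>N\<in>F. subspace N \<and> B \<subseteq> N \<and> N \<subseteq> span (insert u U)"
    let ?F = "(\<lambda>N. N \<inter> U) ` F"
    have BU: "B \<subseteq> U" using fin_over_subspace fin_step by blast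
    have "?F \<noteq> {}" "\<forall>N\<in>?F. subspace N \<and> B \<subseteq> N \<and> N \<subseteq> U"
      using F U BU by (auto intro: subspace_inter)
    with fin_step have "\<exists>N\<in>?F. \<forall>N'\<in>?F. N' \<subseteq> N \<longrightarrow> N' = N" unfolding dcc_def by metis
    then obtain N1 where N1: "N1 \<in> F" "\<And>N'. N' \<in> F \<Longrightarrow> N' \<inter> U \<subseteq> N1 \<inter> U \<Longrightarrow> N' \<inter> U = N1 \<inter> U"
      by auto
    show "\<exists>N\<in>F. \<forall>N'\<in>F. N' \<subseteq> N \<longrightarrow> N' = N"
    proof (cases "\<exists>N\<in>F. N \<subseteq> U \<and> N \<subseteq> N1")
      case True
      then obtain N where N: "N \<in> F" "N \<subseteq> U" "N \<subseteq> N1" by blast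
      have "N' = N" if "N' \<in> F" "N' \<subseteq> N" for N'
        using N1(2)[OF that(1)] N1(2)[OF N(1)] that N by blast
      then show ?thesis using N by blast
    next
      case False
      have "N' = N1" if N': "N' \<in> F" "N' \<subseteq> N1" for N'
      proof (rule antisym[OF N'(2)], rule subsetI)
        fix n assume n: "n \<in> N1"
        have sN: "subspace N'" "subspace N1" using F N' N1 by auto
        obtain w where w: "w \<in> N'" "w \<notin> U" using False N' by blast
        have "w \<in> span (insert u U)" "n \<in> span (insert u U)" using F N' N1 w n by blast+
        then obtain r s where r: "w - r *s u \<in> U" and s: "n - s *s u \<in> U"
          using span_insert_iff[OF U] by blast
        have "r \<notin> m"
        proof
          assume "r \<in> m"
          then have "(w - r *s u) + r *s u \<in> U" using r fin_step U subspace_add by blast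
          with w show False by simp
        qed
        then obtain t where t: "\<forall>h. t *s (r *s h) = h" using unit_scale by blast
        define z where "z = n - s *s (t *s w)"
        have "s *s (t *s (w - r *s u)) = s *s (t *s w) - s *s u"
          using t by (simp only: scale_right_diff_distrib)
        then have "z = (n - s *s u) - s *s (t *s (w - r *s u))"
          by (simp only: z_def) simp
        then have "z \<in> U" using r s U subspace_diff subspace_scale by metis
        moreover have "z \<in> N1" unfolding z_def using n w N' sN subspace_diff subspace_scale by blast
        moreover have "N' \<inter> U = N1 \<inter> U" using N'(2) by (intro N1(2)[OF N'(1)]) auto
        ultimately have "z \<in> N'" by (metis IntI IntD1)
        then have "z + s *s (t *s w) \<in> N'"
          by (rule subspace_add[OF sN(1) _ subspace_scale[OF sN(1) subspace_scale[OF sN(1) w(1)]]])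
        then show "n \<in> N'" by (simp add: z_def)
      qed
      then show ?thesis using N1(1) by metis
    qed
  qed
qed

text \<open>\<open>tors k W\<close> is W : \<open>m\<close>^k, the part of the module that the k-th
  power of \<open>m\<close> sends into W.\<close>

fun tors :: "nat \<Rightarrow> 'h set \<Rightarrow> 'h set" where
  "tors 0 W = W"
| "tors (Suc k) W = {h. \<forall>y\<in>m. y *s h \<in> tors k W}"

lemma tors_subspace: "subspace W \<Longrightarrow> subspace (tors k W)"
proof (induction k)
  case (Suc k)
  then show ?case
    by (auto simp: subspace_def scale_right_distrib scale_left_commute simp del: scale_scale)
qed simp

lemma tors_mono: "W \<subseteq> W' \<Longrightarrow> tors k W \<subseteq> tors k W'"
  by (induction k) auto

lemma tors_Suc: "subspace W \<Longrightarrow> tors k W \<subseteq> tors (Suc k) W"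
proof (induction k)
  case 0
  then show ?case by (auto intro: subspace_scale)
next
  case (Suc k)
  then show ?case by auto
qed

lemma tors_le: "subspace W \<Longrightarrow> k \<le> l \<Longrightarrow> tors k W \<subseteq> tors l W"
  by (rule lift_Suc_mono_le[of "\<lambda>k. tors k W"]) (auto simp: tors_Suc simp del: tors.simps)

text \<open>Before h, adjoin y h for finitely many generators y of \<open>m\<close>; these lie one
  torsion level lower.\<close>

lemma fin_over_tors: "subspace W \<Longrightarrow> h \<in> tors k W \<Longrightarrow> fin_over W (span (insert h W))"
proof (induction k arbitrary: W h)
  case 0
  then have "span (insert h W) = W" by (simp add: insert_absorb)
  then show ?case by (simp add: fin_base)
next
  case (Suc k)
  obtain S where S: "finite S" "m = R.span S" using noetherian_fg[OF noeth m_subspace] by blast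
  let ?V = "\<lambda>T. span (W \<union> (\<lambda>y. y *s h) ` T)"
  have "fin_over W (?V T)" if "finite T" "T \<subseteq> m" for T
    using that
  proof (induction T)
    case empty
    show ?case using Suc.prems fin_base by (simp add: span_ident)
  next
    case (insert y T)
    have "W \<subseteq> ?V T" using span_superset[of "W \<union> (\<lambda>y. y *s h) ` T"] by blast
    then have "y *s h \<in> tors k (?V T)" using Suc.prems insert tors_mono[of W "?V T" k] by auto
    then have "fin_over (?V T) (span (insert (y *s h) (?V T)))" by (intro Suc.IH) auto
    also have "span (insert (y *s h) (?V T)) = ?V (insert y T)"
      by (simp add: span_insert span_span)
    finally show ?case using insert fin_over_trans by auto
  qed
  moreover have Sm: "S \<subseteq> m" using S R.span_superset by blast
  ultimately have f: "fin_over W (?V S)" using S by blast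
  have yh: "y *s h \<in> ?V S" if "y \<in> m" for y
  proof -
    have "R.subspace {y. y *s h \<in> ?V S}"
      unfolding R.subspace_def
      by (auto simp: span_zero scale_left_distrib span_add)
        (metis scale_scale span_scale)
    moreover have "S \<subseteq> {y. y *s h \<in> ?V S}" by (auto intro: span_base)
    ultimately have "R.span S \<subseteq> {y. y *s h \<in> ?V S}" by (intro R.span_minimal)
    with that S show ?thesis by blast
  qed
  have "span (insert h (?V S)) = span (insert h W)"
  proof (rule antisym)
    have "h \<in> span (insert h W)" "W \<subseteq> span (insert h W)" using span_superset by blast+
    then have "?V S \<subseteq> span (insert h W)" by (intro span_minimal) (auto intro: span_scale)
    then show "span (insert h (?V S)) \<subseteq> span (insert h W)"
      using \<open>h \<in> span (insert h W)\<close> by (intro span_minimal) auto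
    show "span (insert h W) \<subseteq> span (insert h (?V S))"
      using span_superset[of "W \<union> (\<lambda>y. y *s h) ` S"] by (intro span_mono) auto
  qed
  then show ?case using fin_step[OF f, of h] yh by simp
qed

text \<open>If \<open>G / B\<close> is \<open>m\<close>-torsion, then its socle is simple and generated by \<open>h\<close>.\<close>

definition irr :: "'h set \<Rightarrow> 'h \<Rightarrow> 'h set \<Rightarrow> bool" where
  "irr G h B \<longleftrightarrow> subspace B \<and> B \<subseteq> G \<and> h \<in> G \<and> h \<notin> B \<and>
     (\<forall>W. subspace W \<longrightarrow> B \<subseteq> W \<longrightarrow> W \<subseteq> G \<longrightarrow> h \<notin> W \<longrightarrow> W = B)"

lemma ex_irr:
  assumes "subspace U" "U \<subseteq> G" "h \<in> G" "h \<notin> U"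
  obtains B where "irr G h B" "U \<subseteq> B"
proof -
  let ?F = "{W. subspace W \<and> U \<subseteq> W \<and> W \<subseteq> G \<and> h \<notin> W}"
  have "\<exists>B\<in>?F. \<forall>W\<in>?F. B \<subseteq> W \<longrightarrow> W = B"
  proof (rule subset_Zorn_nonempty)
    show "?F \<noteq> {}" using assms by blast
    fix C assume C: "C \<noteq> {}" "subset.chain ?F C"
    then have chain: "\<And>I J. I \<in> C \<Longrightarrow> J \<in> C \<Longrightarrow> I \<subseteq> J \<or> J \<subseteq> I" and CF: "C \<subseteq> ?F"
      by (auto simp: subset.chain_def)
    have "subspace (\<Union>C)" using C chain CF by (intro subspace_Union_chain) auto
    then show "\<Union>C \<in> ?F" using C CF by blast
  qed
  then obtain B where B: "B \<in> ?F" "\<forall>W\<in>?F. B \<subseteq> W \<longrightarrow> W = B" ..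
  have "irr G h B"
    unfolding irr_def
  proof (intro conjI allI impI)
    fix W assume "subspace W" "B \<subseteq> W" "W \<subseteq> G" "h \<notin> W"
    then have "W \<in> ?F" using B(1) by blast
    from B(2)[rule_format, OF this \<open>B \<subseteq> W\<close>] show "W = B" .
  qed (use B assms in auto)
  with B that show ?thesis by blast
qed

lemma irr_mem_span:
  assumes G: "subspace G" and B: "irr G h0 B" and g: "g \<in> G" "g \<notin> B"
  shows "\<exists>r. h0 - r *s g \<in> B"
proof -
  have sB: "subspace B" "B \<subseteq> G" using B by (auto simp: irr_def)
  have "insert g B \<subseteq> span (insert g B)" by (rule span_superset)
  moreover have "span (insert g B) \<subseteq> G" using g G sB by (intro span_minimal) auto
  ultimately have "h0 \<in> span (insert g B)"
    using B g unfolding irr_def by (metis insert_subset subspace_span)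
  then show ?thesis using span_insert_iff[OF sB(1)] by blast
qed

text \<open>Both g and h, if outside B, generate h0 modulo B: h0 = r g and h0 = s h. As
  \<open>m\<close> h lies in B and h0 does not, s is a unit, and h = (r / s) g modulo B.\<close>

lemma irr_socle:
  assumes G: "subspace G" and B: "irr G h0 B"
    and g: "g \<in> G" "g \<notin> B" "\<And>y. y \<in> m \<Longrightarrow> y *s g \<in> B"
    and h: "h \<in> G" "\<And>y. y \<in> m \<Longrightarrow> y *s h \<in> B"
  shows "\<exists>r. h - r *s g \<in> B"
proof (cases "h \<in> B")
  case True
  then show ?thesis by (intro exI[of _ 0]) simp
next
  case False
  have sB: "subspace B" using B by (simp add: irr_def)
  obtain r where r: "h0 - r *s g \<in> B" using irr_mem_span[OF G B g(1,2)] by blast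
  obtain s where s: "h0 - s *s h \<in> B" using irr_mem_span[OF G B h(1) False] by blast
  have "s \<notin> m"
  proof
    assume "s \<in> m"
    then have "(h0 - s *s h) + s *s h \<in> B" using h s sB subspace_add by blast
    then show False using B by (simp add: irr_def)
  qed
  then obtain t where t: "\<forall>h. t *s (s *s h) = h" using unit_scale by blast
  have "t *s ((h0 - r *s g) - (h0 - s *s h)) \<in> B"
    using r s sB subspace_diff subspace_scale by blast
  moreover have "t *s ((h0 - r *s g) - (h0 - s *s h)) = h - (t * r) *s g"
    using t by (simp add: scale_right_diff_distrib del: scale_scale) (simp add: scale_scale[symmetric] del: scale_scale)
  ultimately show ?thesis by metis
qed

text \<open>Let V be minimal without finite length over B. Then V differs from \<open>m\<close> V +
  B, as otherwise iteration would give V = B. A submodule W over \<open>m\<close> V + B that is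
  maximal without some v has finite length by minimality of V, and V is one step above it.\<close>

lemma fin_over_killed:
  assumes d: "dcc B G" and B: "subspace B" and U: "subspace U" "B \<subseteq> U" "U \<subseteq> G" "U \<subseteq> tors k B"
  shows "fin_over B U"
proof (rule ccontr)
  assume nU: "\<not> fin_over B U"
  have dU: "dcc B U" by (rule dcc_mono[OF d order_refl U(3)])
  obtain V where V: "subspace V" "B \<subseteq> V" "V \<subseteq> U" "\<not> fin_over B V"
    and mn: "\<And>N'. subspace N' \<Longrightarrow> B \<subseteq> N' \<Longrightarrow> N' \<subseteq> V \<Longrightarrow> \<not> fin_over B N' \<Longrightarrow> N' = V"
    by (rule dcc_minimal[OF dU, of U "\<lambda>N. \<not> fin_over B N"]) (use U nU in auto)
  define V' where "V' = span (B \<union> {y *s v | y v. y \<in> m \<and> v \<in> V})"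
  have V'V: "V' \<subseteq> V" unfolding V'_def
    using V by (intro span_minimal) (auto intro: subspace_scale)
  have BV': "B \<subseteq> V'" and mV': "\<And>y v. y \<in> m \<Longrightarrow> v \<in> V \<Longrightarrow> y *s v \<in> V'"
    unfolding V'_def by (auto intro: span_base)
  have "V' \<noteq> V"
  proof
    assume eq: "V' = V"
    have "V \<subseteq> tors (k - j) B" if "j \<le> k" for j
      using that
    proof (induction j)
      case 0
      then show ?case using V U by auto
    next
      case (Suc j)
      then have "V \<subseteq> tors (Suc (k - Suc j)) B" by (simp del: tors.simps add: Suc_diff_Suc)
      then have "{y *s v | y v. y \<in> m \<and> v \<in> V} \<subseteq> tors (k - Suc j) B" by auto
      moreover have "B \<subseteq> tors (k - Suc j) B" using tors_le[OF B, of 0] by simp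
      ultimately have "V' \<subseteq> tors (k - Suc j) B"
        unfolding V'_def by (intro span_minimal tors_subspace[OF B]) auto
      with eq show ?case by simp
    qed
    from this[of k] have "V = B" using V by auto
    with V fin_base show False by auto
  qed
  then obtain v where v: "v \<in> V" "v \<notin> V'" using V'V by blast
  obtain W where W: "irr V v W" "V' \<subseteq> W"
    by (rule ex_irr[of V' V v]) (use v V'V in \<open>auto simp: V'_def\<close>)
  have sW: "subspace W" "W \<subseteq> V" "v \<notin> W" using W by (auto simp: irr_def)
  have "fin_over B W" using mn[of W] sW v W BV' by blast
  moreover have "y *s v \<in> W" if "y \<in> m" for y using mV' that v W by blast
  ultimately have "fin_over B (span (insert v W))" by (rule fin_step)
  moreover have "span (insert v W) = V"
  proof (rule antisym)
    show "span (insert v W) \<subseteq> V" using v sW V by (intro span_minimal) auto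
    show "V \<subseteq> span (insert v W)"
    proof
      fix y assume y: "y \<in> V"
      show "y \<in> span (insert v W)"
      proof (cases "y \<in> W")
        case True
        then show ?thesis by (simp add: span_base)
      next
        case False
        have "\<exists>r. y - r *s v \<in> W"
          by (rule irr_socle[OF V(1) W(1) v(1) sW(3) _ y]) (use mV' v y W in blast)+
        then show ?thesis by (simp add: span_insert_iff[OF sW(1)])
      qed
    qed
  qed
  ultimately show False using V by simp
qed

text \<open>The part of Matlis duality for finite length that is used: U is recovered from its
  annihilating scalars. If some c0 kills U but not u modulo B, then c0 u spans the simple socle, so
  c0 h = r c0 u, and the induction hypothesis applies to h - r u.\<close>

lemma fin_over_duality:
  assumes "fin_over B U" and G: "subspace G" and B: "irr G h0 B"
    and "U \<subseteq> G" "h \<in> G" "\<And>c. (\<And>u. u \<in> U \<Longrightarrow> c *s u \<in> B) \<Longrightarrow> c *s h \<in> B"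
  shows "h \<in> U"
  using assms(1,4-6)
proof (induction arbitrary: h rule: fin_over.induct)
  case fin_base
  from fin_base(3)[of 1] show ?case by simp
next
  case (fin_step U u)
  have sB: "subspace B" using B by (simp add: irr_def)
  have sU: "subspace U" "B \<subseteq> U" using fin_over_subspace[OF fin_step.hyps(1) sB] by auto
  have UG: "u \<in> G" "U \<subseteq> G" using fin_step.prems(1) span_superset[of "insert u U"] by auto
  have ext: "c *s v \<in> B" if c: "\<And>x. x \<in> U \<Longrightarrow> c *s x \<in> B" "c *s u \<in> B" and v: "v \<in> span (insert u U)" for c v
  proof -
    obtain r where "v - r *s u \<in> U" using v span_insert_iff[OF sU(1)] by blast
    then have "c *s (v - r *s u) + r *s (c *s u) \<in> B"
      using c sB subspace_add subspace_scale by blast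
    then show ?thesis by (simp add: scale_right_diff_distrib mult.commute)
  qed
  show ?case
  proof (cases "\<forall>c. (\<forall>x\<in>U. c *s x \<in> B) \<longrightarrow> c *s u \<in> B")
    case True
    have "h \<in> U"
    proof (rule fin_step.IH[OF UG(2) fin_step.prems(2)])
      fix c assume c: "\<And>x. x \<in> U \<Longrightarrow> c *s x \<in> B"
      then have "c *s u \<in> B" using True by blast
      with c show "c *s h \<in> B" by (intro fin_step.prems(3)) (rule ext)
    qed
    then show ?thesis by (simp add: span_base)
  next
    case False
    then obtain c0 where c0: "\<And>x. x \<in> U \<Longrightarrow> c0 *s x \<in> B" "c0 *s u \<notin> B" by blast
    have soc: "y *s (c *s u) \<in> B" if "y \<in> m" "\<And>x. x \<in> U \<Longrightarrow> c *s x \<in> B" for y c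
      using that fin_step.hyps(2)[of y] by (metis scale_left_commute)
    have c0h: "y *s (c0 *s h) \<in> B" if "y \<in> m" for y
    proof -
      have "(y * c0) *s h \<in> B"
      proof (rule fin_step.prems(3), rule ext)
        show "(y * c0) *s x \<in> B" if "x \<in> U" for x
          using c0(1)[OF that] sB subspace_scale by (metis scale_scale)
        show "(y * c0) *s u \<in> B" using soc[OF that c0(1)] by simp
      qed
      then show ?thesis by simp
    qed
    have G': "c0 *s u \<in> G" "c0 *s h \<in> G" using UG fin_step.prems(2) G subspace_scale by blast+
    obtain r where r: "c0 *s h - r *s (c0 *s u) \<in> B"
      using irr_socle[OF G B G'(1) c0(2) soc[OF _ c0(1)] G'(2) c0h] by blast
    have "h - r *s u \<in> U"
    proof (rule fin_step.IH[OF UG(2)])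
      show "h - r *s u \<in> G" using UG fin_step.prems(2) G subspace_scale subspace_diff by blast
      fix c assume c: "\<And>x. x \<in> U \<Longrightarrow> c *s x \<in> B"
      have "c *s u \<in> G" using UG G subspace_scale by blast
      then obtain l where l: "c *s u - l *s (c0 *s u) \<in> B"
        using irr_socle[OF G B G'(1) c0(2) soc[OF _ c0(1)] _ soc[OF _ c]] by blast
      \<comment> \<open>This scalar kills U, and it kills u by the choice of l; so the hypothesis on
        h applies to it.\<close>
      have "(c - l * c0) *s h \<in> B"
      proof (rule fin_step.prems(3), rule ext)
        show "(c - l * c0) *s x \<in> B" if "x \<in> U" for x
          using c[OF that] c0(1)[OF that] sB subspace_scale subspace_diff
          by (metis scale_left_diff_distrib scale_scale)
        show "(c - l * c0) *s u \<in> B" using l by (simp add: scale_left_diff_distrib)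
      qed
      then have "(c - l * c0) *s h + l *s (c0 *s h - r *s (c0 *s u)) - r *s (c *s u - l *s (c0 *s u)) \<in> B"
        using l r sB subspace_add subspace_diff subspace_scale by blast
      then show "c *s (h - r *s u) \<in> B"
        by (simp add: scale_left_diff_distrib scale_right_diff_distrib mult_ac)
    qed
    then show ?thesis using span_insert_iff[OF sU(1)] by blast
  qed
qed

end

section \<open>Powers of the maximal ideal and scalars of the completion\<close>

context noetherian_local
begin

fun mpow :: "nat \<Rightarrow> 'a set" where
  "mpow 0 = UNIV"
| "mpow (Suc k) = R.span {y * z | y z. y \<in> m \<and> z \<in> mpow k}"

lemma mpow_subspace: "R.subspace (mpow k)"
  by (cases k) auto

lemma mpow_Suc_subset: "mpow (Suc k) \<subseteq> mpow k"
proof -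
  have "{y * z | y z. y \<in> m \<and> z \<in> mpow k} \<subseteq> mpow k"
    using R.subspace_scale[OF mpow_subspace] by auto
  then show ?thesis by (simp add: R.span_minimal mpow_subspace)
qed

lemma mpow_antimono: "k \<le> l \<Longrightarrow> mpow l \<subseteq> mpow k"
  by (rule lift_Suc_antimono_le[of mpow]) (rule mpow_Suc_subset)

lemma mult_mpow: "y \<in> m \<Longrightarrow> z \<in> mpow k \<Longrightarrow> y * z \<in> mpow (Suc k)"
  by (auto intro: R.span_base)

sublocale ring_module: local_module m "(*) :: 'a \<Rightarrow> 'a \<Rightarrow> 'a"
  by unfold_locales

lemma mpow_ring_tors: "z \<in> mpow j \<Longrightarrow> z \<in> ring_module.tors i (mpow (j + i))"
proof (induction i arbitrary: j z)
  case (Suc i)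
  show ?case using Suc.IH[OF mult_mpow[OF _ Suc.prems]] by simp
qed simp

lemma dcc_mpow: "ring_module.dcc (mpow k) UNIV"
proof -
  have "1 \<in> ring_module.tors k (mpow k)" using mpow_ring_tors[of 1 0 k] by simp
  then have "ring_module.fin_over (mpow k) (R.span (insert 1 (mpow k)))"
    by (intro ring_module.fin_over_tors mpow_subspace)
  moreover have "R.span (insert 1 (mpow k)) = UNIV"
    by (rule subspace_one_iff[THEN iffD2]) (auto intro: R.span_base)
  ultimately show ?thesis using ring_module.fin_over_dcc mpow_subspace by metis
qed

end

context local_module
begin

lemma subspace_annihilator: "subspace W \<Longrightarrow> R.subspace {r. r *s h \<in> W}"
  using subspace_scale[of W] by (auto simp: R.subspace_def subspace_0 scale_left_distrib subspace_add
      simp flip: scale_scale)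

lemma subspace_annihilator_set: "subspace W \<Longrightarrow> R.subspace {r. \<forall>h\<in>N. r *s h \<in> W}"
  using subspace_scale[of W] by (auto simp: R.subspace_def subspace_0 scale_left_distrib subspace_add
      simp flip: scale_scale)

lemma mpow_tors: "subspace W \<Longrightarrow> r \<in> mpow k \<Longrightarrow> h \<in> tors k W \<Longrightarrow> r *s h \<in> W"
proof (induction k arbitrary: r h)
  case (Suc k)
  have "{y * z | y z. y \<in> m \<and> z \<in> mpow k} \<subseteq> {r. r *s h \<in> W}"
  proof clarify
    fix y z assume "y \<in> m" "z \<in> mpow k"
    then have "z *s (y *s h) \<in> W" using Suc by (simp del: scale_scale)
    then show "(y * z) *s h \<in> W" by (simp add: mult.commute)
  qed
  then have "mpow (Suc k) \<subseteq> {r. r *s h \<in> W}"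
    using subspace_annihilator[OF Suc.prems(1)] by (simp add: R.span_minimal)
  with Suc.prems show ?case by blast
qed (simp add: subspace_scale)

text \<open>The elements of the completion of the ring act on an \<open>m\<close>-torsion module by maps that agree
  with a scalar on every finite set; this is the only property of the completion that is needed.\<close>

definition loc_scalar :: "'h set \<Rightarrow> ('h \<Rightarrow> 'h) \<Rightarrow> bool" where
  "loc_scalar Z f \<longleftrightarrow> (\<forall>F. finite F \<longrightarrow> (\<exists>r. \<forall>h\<in>F. f h - r *s h \<in> Z))"

lemma loc_scalarD: "loc_scalar Z f \<Longrightarrow> finite F \<Longrightarrow> \<exists>r. \<forall>h\<in>F. f h - r *s h \<in> Z"
  by (simp add: loc_scalar_def)

lemma loc_scalar_id: "subspace Z \<Longrightarrow> loc_scalar Z (\<lambda>h. h)"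
  unfolding loc_scalar_def by (intro allI impI exI[of _ 1]) (simp add: subspace_0)

lemma mem_cong: "subspace N \<Longrightarrow> a - b \<in> N \<Longrightarrow> a \<in> N \<longleftrightarrow> b \<in> N"
  by (metis add_diff_cancel_left' add_diff_eq diff_diff_eq2 subspace_add subspace_diff diff_add_cancel)

lemma loc_scalar_comp:
  assumes Z: "subspace Z" and f: "loc_scalar Z f" and g: "loc_scalar Z g"
  shows "loc_scalar Z (\<lambda>h. f (g h))"
  unfolding loc_scalar_def
proof (intro allI impI)
  fix F :: "'h set" assume F: "finite F"
  obtain s where s: "\<forall>h\<in>F. g h - s *s h \<in> Z" using loc_scalarD[OF g F] by blast
  obtain r where r: "\<forall>h\<in>g ` F. f h - r *s h \<in> Z" using loc_scalarD[OF f, of "g ` F"] F by blast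
  have "f (g h) - (r * s) *s h \<in> Z" if "h \<in> F" for h
  proof -
    have "(f (g h) - r *s g h) + r *s (g h - s *s h) \<in> Z"
      using that r s by (intro subspace_add[OF Z] subspace_scale[OF Z]) auto
    then show ?thesis by (simp add: scale_right_diff_distrib)
  qed
  then show "\<exists>r. \<forall>h\<in>F. f (g h) - r *s h \<in> Z" by blast
qed

lemma loc_scalar_funpow: "subspace Z \<Longrightarrow> loc_scalar Z f \<Longrightarrow> loc_scalar Z (f ^^ n)"
proof (induction n)
  case 0
  then show ?case using loc_scalar_id by (simp add: id_def)
next
  case (Suc n)
  then show ?case using loc_scalar_comp[of Z f "f ^^ n"] by (simp add: comp_def)
qed

lemma loc_scalar_mem:
  assumes N: "subspace N" "Z \<subseteq> N" and f: "loc_scalar Z f" and h: "h \<in> N"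
  shows "f h \<in> N"
proof -
  obtain r where r: "f h - r *s h \<in> Z" using loc_scalarD[OF f, of "{h}"] by auto
  then have "f h - r *s h \<in> N" using N by blast
  then show ?thesis using mem_cong[OF N(1)] subspace_scale[OF N(1) h] by blast
qed

lemma loc_scalar_commute:
  assumes Z: "subspace Z" and f: "loc_scalar Z f" and g: "loc_scalar Z g"
  shows "f (g h) - g (f h) \<in> Z"
proof -
  obtain r where r: "f h - r *s h \<in> Z" "f (g h) - r *s g h \<in> Z"
    using loc_scalarD[OF f, of "{h, g h}"] by auto
  obtain s where s: "g h - s *s h \<in> Z" "g (f h) - s *s f h \<in> Z"
    using loc_scalarD[OF g, of "{h, f h}"] by auto
  have "(f (g h) - r *s g h) + r *s (g h - s *s h) - (g (f h) - s *s f h) - s *s (f h - r *s h) \<in> Z"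
    using r s by (simp only: subspace_add[OF Z] subspace_diff[OF Z] subspace_scale[OF Z])
  then show ?thesis by (simp add: scale_right_diff_distrib mult.commute)
qed

lemma loc_scalar_preimage:
  assumes Z: "subspace Z" and f: "loc_scalar Z f" and N: "subspace N" "Z \<subseteq> N"
  shows "subspace {h. f h \<in> N}"
  unfolding subspace_def
proof (intro conjI ballI allI)
  show "0 \<in> {h. f h \<in> N}" using loc_scalar_mem[OF N f subspace_0[OF N(1)]] by simp
next
  fix x y assume xy: "x \<in> {h. f h \<in> N}" "y \<in> {h. f h \<in> N}"
  obtain r where r: "f x - r *s x \<in> Z" "f y - r *s y \<in> Z" "f (x + y) - r *s (x + y) \<in> Z"
    using loc_scalarD[OF f, of "{x, y, x + y}"] by auto
  have "(f (x + y) - r *s (x + y)) - (f x - r *s x) - (f y - r *s y) \<in> N"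
    using r subsetD[OF N(2)] by (simp only: subspace_diff[OF N(1)])
  then have "f (x + y) - (f x + f y) \<in> N" by (simp add: scale_right_distrib algebra_simps)
  then show "x + y \<in> {h. f h \<in> N}" using xy mem_cong[OF N(1)] subspace_add[OF N(1)] by auto
next
  fix c x assume x: "x \<in> {h. f h \<in> N}"
  obtain r where r: "f x - r *s x \<in> Z" "f (c *s x) - r *s (c *s x) \<in> Z"
    using loc_scalarD[OF f, of "{x, c *s x}"] by auto
  have "(f (c *s x) - r *s (c *s x)) - c *s (f x - r *s x) \<in> N"
    using r subsetD[OF N(2)] by (simp only: subspace_diff[OF N(1)] subspace_scale[OF N(1)])
  then have "f (c *s x) - c *s f x \<in> N" by (simp add: scale_right_diff_distrib mult.commute)
  then show "c *s x \<in> {h. f h \<in> N}" using x mem_cong[OF N(1)] subspace_scale[OF N(1)] by auto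
qed

text \<open>For each torsion level k, duality of finite length gives a scalar that kills the part of
  U of level k and moves h. A Mittag-Leffler argument over the Artinian rings R / \<open>m\<close>^k
  glues such scalars into one completion scalar.\<close>

lemma duality:
  assumes Z: "subspace Z" and d: "dcc Z G" and tor: "\<And>h. \<exists>k. h \<in> tors k Z"
    and G: "subspace G" and B: "irr G h0 B" "Z \<subseteq> B"
    and U: "subspace U" "B \<subseteq> U" "U \<subseteq> G" and h: "h \<in> G" "h \<notin> U"
  shows "\<exists>f. loc_scalar Z f \<and> (\<forall>u\<in>U. f u \<in> B) \<and> f h \<notin> B"
proof -
  have sB: "subspace B" using B by (simp add: irr_def)
  define I where "I k = {c. \<forall>u\<in>U \<inter> tors k B. c *s u \<in> B}" for k
  have sI: "R.subspace (I k)" for k unfolding I_def by (rule subspace_annihilator_set[OF sB])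
  have I_anti: "I l \<subseteq> I k" if "k \<le> l" for k l
    unfolding I_def using tors_le[OF sB that] by blast
  have mI: "mpow k \<subseteq> I k" for k
    unfolding I_def using mpow_tors[OF sB] by blast
  have Ih: "\<exists>c\<in>I k. c *s h \<notin> B" for k
  proof (rule ccontr)
    assume n: "\<not> ?thesis"
    have "fin_over B (U \<inter> tors k B)"
    proof (rule fin_over_killed[OF dcc_mono[OF d B(2) order_refl] sB])
      show "subspace (U \<inter> tors k B)" by (intro subspace_inter U tors_subspace sB)
      show "B \<subseteq> U \<inter> tors k B" using U tors_le[OF sB, of 0 k] by auto
      show "U \<inter> tors k B \<subseteq> G" using U by blast
    qed blast
    moreover have "c *s h \<in> B" if "\<And>u. u \<in> U \<inter> tors k B \<Longrightarrow> c *s u \<in> B" for c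
      using n that unfolding I_def by blast
    ultimately have "h \<in> U \<inter> tors k B"
      using U by (intro fin_over_duality[OF _ G B(1) _ h(1)]) auto
    with h show False by blast
  qed
  \<comment> \<open>The stable image of the decreasing ideals \<open>I l\<close> in R /
    \<open>m\<close>^k; its elements can be lifted from level k to level k + 1.\<close>
  define Y where "Y k = (\<Inter>l. R.span (I l \<union> mpow k))" for k
  have stab: "\<exists>l0. \<forall>l\<ge>l0. Y k = R.span (I l \<union> mpow k)" for k
  proof -
    have anti: "R.span (I l' \<union> mpow k) \<subseteq> R.span (I l \<union> mpow k)" if "l \<le> l'" for l l'
      using I_anti[OF that] by (intro R.span_mono) auto
    have base: "mpow k \<subseteq> R.span (I 0 \<union> mpow k)"
      using R.span_superset[of "I 0 \<union> mpow k"] by blast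
    obtain N where N: "R.subspace N" "mpow k \<subseteq> N" "N \<subseteq> UNIV" "\<exists>l. N = R.span (I l \<union> mpow k)"
      and mn: "\<And>N'. R.subspace N' \<Longrightarrow> mpow k \<subseteq> N' \<Longrightarrow> N' \<subseteq> N \<Longrightarrow>
        \<exists>l. N' = R.span (I l \<union> mpow k) \<Longrightarrow> N' = N"
      by (rule ring_module.dcc_minimal[OF dcc_mpow, of "R.span (I 0 \<union> mpow k)" k
            "\<lambda>N. \<exists>l. N = R.span (I l \<union> mpow k)"]) (use base in auto)
    then obtain l0 where l0: "N = R.span (I l0 \<union> mpow k)" by blast
    have eq: "R.span (I l \<union> mpow k) = N" if "l0 \<le> l" for l
    proof (rule mn)
      show "mpow k \<subseteq> R.span (I l \<union> mpow k)" using R.span_superset[of "I l \<union> mpow k"] by blast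
      show "R.span (I l \<union> mpow k) \<subseteq> N" unfolding l0 by (rule anti[OF that])
    qed auto
    have "N \<subseteq> R.span (I l \<union> mpow k)" for l
      using anti[of l "max l l0"] eq[of "max l l0"] by simp
    then have "Y k = N" unfolding Y_def using l0 by blast
    with eq show ?thesis by (intro exI[of _ l0]) simp
  qed
  have lift: "\<exists>y'\<in>Y (Suc k). y' - y \<in> mpow k" if y: "y \<in> Y k" for k y
  proof -
    obtain l0 where l0: "\<forall>l\<ge>l0. Y k = R.span (I l \<union> mpow k)" using stab by blast
    obtain l1 where l1: "\<forall>l\<ge>l1. Y (Suc k) = R.span (I l \<union> mpow (Suc k))" using stab by blast
    define l where "l = max l0 l1"
    have "y \<in> R.span (I l \<union> mpow k)" using y l0[rule_format, of l] by (simp add: l_def)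
    then obtain x z where xz: "y = x + z" "x \<in> I l" "z \<in> mpow k"
      by (auto simp: R.span_Un R.span_eq_iff[THEN iffD2] sI mpow_subspace)
    have "x \<in> R.span (I l \<union> mpow (Suc k))" using xz by (auto intro: R.span_base)
    then have "x \<in> Y (Suc k)" using l1[rule_format, of l] by (simp add: l_def)
    moreover have "x - y \<in> mpow k" using xz R.subspace_neg[OF mpow_subspace] by simp
    ultimately show ?thesis by blast
  qed
  obtain k0 where k0: "h \<in> tors k0 Z" using tor by blast
  obtain c0 where c0: "c0 \<in> Y k0" "c0 *s h \<notin> B"
  proof -
    obtain l0 where l0: "\<forall>l\<ge>l0. Y k0 = R.span (I l \<union> mpow k0)" using stab by blast
    obtain c where "c \<in> I l0" "c *s h \<notin> B" using Ih by blast
    with l0 show ?thesis using that[of c] by (auto intro: R.span_base)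
  qed
  have "\<exists>c. \<forall>n. (c n \<in> Y (k0 + n) \<and> (n = 0 \<longrightarrow> c n *s h \<notin> B)) \<and> c (Suc n) - c n \<in> mpow (k0 + n)"
  proof (rule dependent_nat_choice)
    show "\<exists>x. x \<in> Y (k0 + 0) \<and> (0 = 0 \<longrightarrow> x *s h \<notin> B)" using c0 by auto
    fix x n assume "x \<in> Y (k0 + n) \<and> (n = 0 \<longrightarrow> x *s h \<notin> B)"
    then show "\<exists>y. (y \<in> Y (k0 + Suc n) \<and> (Suc n = 0 \<longrightarrow> y *s h \<notin> B)) \<and> y - x \<in> mpow (k0 + n)"
      using lift[of x "k0 + n"] by auto
  qed
  then obtain c where c: "\<And>n. c n \<in> Y (k0 + n)" "c 0 *s h \<notin> B"
    "\<And>n. c (Suc n) - c n \<in> mpow (k0 + n)" by blast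
  have coh: "c (n + i) - c n \<in> mpow (k0 + n)" for n i
  proof (induction i)
    case 0
    show ?case using R.subspace_0[OF mpow_subspace] by simp
  next
    case (Suc i)
    have "c (Suc (n + i)) - c (n + i) \<in> mpow (k0 + n)"
      using c(3)[of "n + i"] mpow_antimono[of "k0 + n" "k0 + (n + i)"] by auto
    from R.subspace_add[OF mpow_subspace this Suc] show ?case by simp
  qed
  \<comment> \<open>Terms after c (lv v) differ from it by elements of \<open>m\<close>^(k0 + lv v),
    which kill v modulo Z; so c (lv v) acts on v as the limit does. The offset k0 yields lv h = 0,
    so that h is moved by c 0.\<close>
  define lv where "lv v = (LEAST n. v \<in> tors (k0 + n) Z)" for v
  have lv: "v \<in> tors (k0 + lv v) Z" for v
  proof -
    obtain k where "v \<in> tors k Z" using tor by blast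
    then have "v \<in> tors (k0 + k) Z" using tors_le[OF Z, of k "k0 + k"] by auto
    then show ?thesis unfolding lv_def by (rule LeastI)
  qed
  define f where "f v = c (lv v) *s v" for v
  have f: "f v - c n *s v \<in> Z" if "lv v \<le> n" for v n
  proof -
    have "(c n - c (lv v)) *s v \<in> Z"
      using coh[of "lv v" "n - lv v"] that by (intro mpow_tors[OF Z _ lv]) simp
    then have "- ((c n - c (lv v)) *s v) \<in> Z" by (rule subspace_neg[OF Z])
    then show ?thesis by (simp add: f_def scale_left_diff_distrib)
  qed
  have "loc_scalar Z f"
    unfolding loc_scalar_def
  proof (intro allI impI)
    fix F :: "'h set" assume F: "finite F"
    have "lv v \<le> Max (lv ` F)" if "v \<in> F" for v using F that by simp
    then show "\<exists>r. \<forall>h\<in>F. f h - r *s h \<in> Z" using f by (intro exI[of _ "c (Max (lv ` F))"]) auto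
  qed
  moreover have "f u \<in> B" if u: "u \<in> U" for u
  proof -
    define n where "n = k0 + lv u"
    have "Y n \<subseteq> R.span (I n \<union> mpow n)" unfolding Y_def by blast
    also have "\<dots> \<subseteq> I n" using mI by (intro R.span_minimal sI) auto
    finally have "c (lv u) \<in> I n" using c(1)[of "lv u"] by (auto simp: n_def)
    moreover have "u \<in> U \<inter> tors n B" using u lv[of u] tors_mono[OF B(2), of n] by (auto simp: n_def)
    ultimately show ?thesis unfolding f_def I_def by blast
  qed
  moreover have "f h \<notin> B"
  proof -
    have "lv h = 0" unfolding lv_def using k0 by (simp add: Least_eq_0)
    then show ?thesis using c by (simp add: f_def)
  qed
  ultimately show ?thesis by blast
qed

end

section \<open>The Hartshorne--Speiser--Lyubeznik theorem\<close>

text \<open>The module under study is \<open>'h\<close> modulo \<open>Z\<close>, with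
  \<open>X\<close> as the action of x; the Artinian and torsion properties refer to this
  quotient.\<close>

locale frobenius_module = local_module m scale
  for m :: "'a::comm_ring_1 set" and scale :: "'a \<Rightarrow> 'h::ab_group_add \<Rightarrow> 'h" (infixr "*s" 75) +
  fixes p :: nat and X :: "'h \<Rightarrow> 'h" and Z :: "'h set"
  assumes p2: "p \<ge> 2"
    and X_add: "X (g + h) = X g + X h"
    and X_scale: "X (r *s h) = r ^ p *s X h"
    and Z: "subspace Z" and X_Z: "h \<in> Z \<Longrightarrow> X h \<in> Z"
    and artinian: "dcc Z UNIV"
    and torsion: "\<exists>k. h \<in> tors k Z"
begin

lemma X_zero [simp]: "X 0 = 0"
  using X_add[of 0 0] by simp

lemma X_diff: "X (g - h) = X g - X h"
  using X_add[of "g - h" h] by (simp add: algebra_simps)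

lemma Xn_add: "(X ^^ n) (g + h) = (X ^^ n) g + (X ^^ n) h"
  by (induction n) (simp_all add: X_add)

lemma Xn_zero [simp]: "(X ^^ n) 0 = 0"
  by (induction n) simp_all

lemma Xn_diff: "(X ^^ n) (g - h) = (X ^^ n) g - (X ^^ n) h"
  by (induction n) (simp_all add: X_diff)

lemma Xn_scale: "(X ^^ n) (r *s h) = r ^ (p ^ n) *s (X ^^ n) h"
  by (induction n) (simp_all add: X_scale power_mult[symmetric] mult.commute)

definition stable :: "'h set \<Rightarrow> bool" where
  "stable N \<longleftrightarrow> subspace N \<and> Z \<subseteq> N \<and> (\<forall>h\<in>N. X h \<in> N)"

lemma stableD: "stable N \<Longrightarrow> subspace N" "stable N \<Longrightarrow> Z \<subseteq> N" "stable N \<Longrightarrow> h \<in> N \<Longrightarrow> X h \<in> N"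
  by (auto simp: stable_def)

lemma stable_Xn: "stable N \<Longrightarrow> h \<in> N \<Longrightarrow> (X ^^ n) h \<in> N"
  by (induction n) (auto dest: stableD)

lemma stable_Z: "stable Z"
  by (simp add: stable_def Z X_Z)

lemma Xn_preimage: "subspace N \<Longrightarrow> subspace {h. (X ^^ n) h \<in> N}"
  by (auto simp: subspace_def Xn_add Xn_scale)

lemma X_preimage: "subspace N \<Longrightarrow> subspace {h. X h \<in> N}"
  using Xn_preimage[of N 1] by simp

lemma stable_span:
  assumes "Z \<subseteq> S" "\<And>h. h \<in> S \<Longrightarrow> X h \<in> span S"
  shows "stable (span S)"
proof -
  have "span S \<subseteq> {h. X h \<in> span S}"
    using assms by (intro span_minimal X_preimage) auto
  moreover have "Z \<subseteq> span S" using assms span_superset by blast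
  ultimately show ?thesis by (auto simp: stable_def)
qed

definition ker :: "nat \<Rightarrow> 'h set" where
  "ker n = {h. (X ^^ n) h \<in> Z}"

lemma ker_subspace: "subspace (ker n)"
  unfolding ker_def by (rule Xn_preimage[OF Z])

lemma ker_stable: "stable (ker n)"
  using Z X_Z stable_Xn[OF stable_Z]
  by (auto simp: stable_def ker_subspace) (auto simp: ker_def simp flip: funpow_swap1)

lemma ker_Z: "Z \<subseteq> ker n"
  using stableD(2)[OF ker_stable] .

lemma ker_add: "(X ^^ k) h \<in> ker n \<longleftrightarrow> h \<in> ker (n + k)"
  by (simp add: ker_def funpow_add)

lemma ker_mono: "n \<le> k \<Longrightarrow> ker n \<subseteq> ker k"
proof
  fix h assume "n \<le> k" "h \<in> ker n"
  then have "(X ^^ (k - n)) ((X ^^ n) h) \<in> Z" by (simp add: ker_def stable_Xn[OF stable_Z])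
  moreover have "(X ^^ (k - n)) ((X ^^ n) h) = (X ^^ (k - n + n)) h" by (simp only: funpow_add comp_apply)
  ultimately show "h \<in> ker k" using \<open>n \<le> k\<close> by (simp add: ker_def)
qed

lemma ker_0: "ker 0 = Z"
  by (simp add: ker_def)

text \<open>Take one scalar r that agrees with f on h and on the iterates (f ^^ n) (X h) for n up to
  p; modulo Z, both terms are then r^p X h.\<close>

lemma loc_scalar_X:
  assumes f: "loc_scalar Z f"
  shows "X (f h) - (f ^^ p) (X h) \<in> Z"
proof -
  have "finite ((\<lambda>n. (f ^^ n) (X h)) ` {..p} \<union> {h})" by simp
  then obtain r where r: "\<forall>g\<in>(\<lambda>n. (f ^^ n) (X h)) ` {..p} \<union> {h}. f g - r *s g \<in> Z"
    using loc_scalarD[OF f] by blast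
  have "(f ^^ n) (X h) - r ^ n *s X h \<in> Z" if "n \<le> p" for n
    using that
  proof (induction n)
    case 0
    then show ?case using subspace_0[OF Z] by simp
  next
    case (Suc n)
    have "f ((f ^^ n) (X h)) - r *s (f ^^ n) (X h) \<in> Z" using r Suc.prems by auto
    moreover have "r *s ((f ^^ n) (X h) - r ^ n *s X h) \<in> Z"
      using Suc by (intro subspace_scale[OF Z]) auto
    ultimately have "(f ((f ^^ n) (X h)) - r *s (f ^^ n) (X h)) + r *s ((f ^^ n) (X h) - r ^ n *s X h) \<in> Z"
      by (rule subspace_add[OF Z])
    then show ?case by (simp add: scale_right_diff_distrib)
  qed
  then have "(f ^^ p) (X h) - r ^ p *s X h \<in> Z" by simp
  moreover have "X (f h) - r ^ p *s X h \<in> Z"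
    using r X_Z[of "f h - r *s h"] by (simp add: X_diff X_scale)
  ultimately have "(X (f h) - r ^ p *s X h) - ((f ^^ p) (X h) - r ^ p *s X h) \<in> Z"
    by (simp only: subspace_diff[OF Z])
  then show ?thesis by simp
qed

lemma loc_scalar_Xn:
  assumes f: "loc_scalar Z f"
  shows "(X ^^ n) (f h) - (f ^^ (p ^ n)) ((X ^^ n) h) \<in> Z"
proof (induction n)
  case 0
  show ?case using subspace_0[OF Z] by simp
next
  case (Suc n)
  let ?g = "f ^^ (p ^ n)"
  have g: "loc_scalar Z ?g" by (rule loc_scalar_funpow[OF Z f])
  have "X ((X ^^ n) (f h)) - X (?g ((X ^^ n) h)) \<in> Z" using X_Z[OF Suc] by (simp add: X_diff)
  moreover have "X (?g ((X ^^ n) h)) - (?g ^^ p) (X ((X ^^ n) h)) \<in> Z" by (rule loc_scalar_X[OF g])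
  ultimately have "X ((X ^^ n) (f h)) - (?g ^^ p) (X ((X ^^ n) h)) \<in> Z"
    using subspace_add[OF Z] by fastforce
  moreover have "?g ^^ p = f ^^ (p ^ Suc n)" by (simp add: funpow_mult mult.commute)
  ultimately show ?case by simp
qed

definition nil_bounded :: "'h set \<Rightarrow> bool" where
  "nil_bounded N \<longleftrightarrow> (\<exists>e. N \<subseteq> ker e)"

section \<open>Gabber's minimal counterexample\<close>

context
  fixes G :: "'h set"
  assumes G: "stable G" and G_tor: "\<And>h. h \<in> G \<Longrightarrow> \<exists>n. h \<in> ker n" and G_nb: "\<not> nil_bounded G"
    and G_min: "\<And>N. stable N \<Longrightarrow> N \<subseteq> G \<Longrightarrow> N \<noteq> G \<Longrightarrow> nil_bounded N"
begin

lemmas sG = stableD(1)[OF G] and ZG = stableD(2)[OF G]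

text \<open>If X^e G spanned a proper submodule, some X^k would kill it by minimality, and then X^(k
  + e) would kill G.\<close>

lemma G_span_Xn: "span (Z \<union> (X ^^ e) ` G) = G"
proof (rule ccontr)
  assume ne: "span (Z \<union> (X ^^ e) ` G) \<noteq> G"
  have "stable (span (Z \<union> (X ^^ e) ` G))"
  proof (rule stable_span)
    fix h assume "h \<in> Z \<union> (X ^^ e) ` G"
    then have "X h \<in> Z \<union> (X ^^ e) ` G"
      using X_Z stableD(3)[OF G] by (auto simp: funpow_swap1)
    then show "X h \<in> span (Z \<union> (X ^^ e) ` G)" by (rule span_base)
  qed blast
  moreover have "span (Z \<union> (X ^^ e) ` G) \<subseteq> G"
    using ZG stable_Xn[OF G] by (intro span_minimal sG) auto
  ultimately obtain k where k: "span (Z \<union> (X ^^ e) ` G) \<subseteq> ker k"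
    using G_min ne unfolding nil_bounded_def by blast
  have "G \<subseteq> ker (k + e)"
  proof
    fix h assume "h \<in> G"
    then have "(X ^^ e) h \<in> ker k" using k span_base[of "(X ^^ e) h" "Z \<union> (X ^^ e) ` G"] by blast
    then show "h \<in> ker (k + e)" by (simp add: ker_add)
  qed
  then show False using G_nb by (auto simp: nil_bounded_def)
qed

text \<open>The analogue of a prime ideal of the completion: its elements turn out to be nilpotent
  on G, and outside it every operator has an image spanning G.\<close>

definition nilops :: "('h \<Rightarrow> 'h) set" where
  "nilops = {f. loc_scalar Z f \<and> (\<exists>e. \<forall>h\<in>G. f h \<in> ker e)}"

lemma nilopsI: "loc_scalar Z f \<Longrightarrow> (\<And>h. h \<in> G \<Longrightarrow> f h \<in> ker e) \<Longrightarrow> f \<in> nilops"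
  by (auto simp: nilops_def)

lemma G_op: "loc_scalar Z f \<Longrightarrow> h \<in> G \<Longrightarrow> f h \<in> G"
  by (rule loc_scalar_mem[OF sG ZG])

text \<open>Since X f = f^p X modulo Z, the span of f G is stable; by minimality it is G or
  boundedly nilpotent.\<close>

lemma span_op:
  assumes f: "loc_scalar Z f" "f \<notin> nilops"
  shows "span (Z \<union> f ` G) = G"
proof (rule ccontr)
  assume ne: "span (Z \<union> f ` G) \<noteq> G"
  have "stable (span (Z \<union> f ` G))"
  proof (rule stable_span)
    fix h assume "h \<in> Z \<union> f ` G"
    then consider "h \<in> Z" | g where "g \<in> G" "h = f g" by blast
    then show "X h \<in> span (Z \<union> f ` G)"
    proof cases
      case 1
      then show ?thesis by (intro span_base) (simp add: X_Z)
    next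
      case 2
      obtain q where q: "p = Suc q" using p2 by (cases p) auto
      have "(f ^^ q) (X g) \<in> G"
        by (rule G_op[OF loc_scalar_funpow[OF Z f(1)] stableD(3)[OF G 2(1)]])
      then have "(f ^^ p) (X g) \<in> span (Z \<union> f ` G)" by (intro span_base) (simp add: q)
      moreover have "X (f g) - (f ^^ p) (X g) \<in> span (Z \<union> f ` G)"
        using loc_scalar_X[OF f(1)] by (intro span_base) simp
      ultimately show ?thesis using span_add 2(2) by fastforce
    qed
  qed blast
  moreover have "span (Z \<union> f ` G) \<subseteq> G"
    using ZG G_op[OF f(1)] by (intro span_minimal sG) auto
  ultimately obtain k where k: "span (Z \<union> f ` G) \<subseteq> ker k"
    using G_min ne unfolding nil_bounded_def by blast
  have "f \<in> nilops"
    by (rule nilopsI[OF f(1), of k]) (use k span_superset[of "Z \<union> f ` G"] in blast)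
  with f show False by simp
qed

lemma nilops_prime:
  assumes f: "loc_scalar Z f" "f \<notin> nilops" and g: "loc_scalar Z g" "g \<notin> nilops"
  shows "(\<lambda>h. f (g h)) \<notin> nilops"
proof
  assume "(\<lambda>h. f (g h)) \<in> nilops"
  then obtain e where e: "\<And>h. h \<in> G \<Longrightarrow> f (g h) \<in> ker e" by (auto simp: nilops_def)
  have "span (Z \<union> g ` G) \<subseteq> {h. f h \<in> ker e}"
    using e loc_scalar_mem[OF Z order_refl f(1)] ker_Z
    by (intro span_minimal loc_scalar_preimage[OF Z f(1) ker_subspace ker_Z]) auto
  then have "f \<in> nilops" using span_op[OF g] by (intro nilopsI[OF f(1), of e]) auto
  with f show False by simp
qed

text \<open>If X^e f vanishes on G, then so does f^(p^e) X^e; hence f^(p^e) kills X^e G, which spans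
  G.\<close>

lemma nilops_nilpotent:
  assumes f: "f \<in> nilops"
  shows "\<exists>n. \<forall>h\<in>G. (f ^^ n) h \<in> Z"
proof -
  have lf: "loc_scalar Z f" using f by (simp add: nilops_def)
  obtain e where e: "\<And>h. h \<in> G \<Longrightarrow> f h \<in> ker e" using f by (auto simp: nilops_def)
  let ?g = "f ^^ (p ^ e)"
  have lg: "loc_scalar Z ?g" by (rule loc_scalar_funpow[OF Z lf])
  have "?g ((X ^^ e) h) \<in> Z" if "h \<in> G" for h
  proof -
    have "(X ^^ e) (f h) \<in> Z" using e[OF that] by (simp add: ker_def)
    with mem_cong[OF Z loc_scalar_Xn[OF lf, of e h]] show ?thesis by simp
  qed
  then have "span (Z \<union> (X ^^ e) ` G) \<subseteq> {h. ?g h \<in> Z}"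
    using loc_scalar_mem[OF Z order_refl lg]
    by (intro span_minimal loc_scalar_preimage[OF Z lg Z order_refl]) auto
  then show ?thesis using G_span_Xn[of e] by (intro exI[of _ "p ^ e"]) auto
qed

lemma absorb_nilops:
  assumes "finite J" "J \<subseteq> nilops" and B: "subspace B" "Z \<subseteq> B"
    and "G \<subseteq> span (B \<union> (\<Union>j\<in>J. j ` G))"
  shows "G \<subseteq> B"
  using assms(1,2,5)
proof (induction J)
  case empty
  then show ?case using B by (simp add: span_ident)
next
  case (insert j J)
  define W where "W = span (B \<union> (\<Union>j\<in>J. j ` G))"
  have W: "subspace W" "Z \<subseteq> W"
    using B span_superset[of "B \<union> (\<Union>j\<in>J. j ` G)"] by (auto simp: W_def)
  have lj: "loc_scalar Z j" using insert by (simp add: nilops_def)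
  have eq: "span (B \<union> (\<Union>i\<in>insert j J. i ` G)) \<subseteq> span (W \<union> j ` G)"
  proof (rule span_minimal)
    have "B \<union> (\<Union>j\<in>J. j ` G) \<subseteq> W" unfolding W_def by (rule span_superset)
    then show "B \<union> (\<Union>i\<in>insert j J. i ` G) \<subseteq> span (W \<union> j ` G)"
      using span_superset[of "W \<union> j ` G"] by auto
  qed simp
  have it: "G \<subseteq> span (W \<union> (j ^^ n) ` G)" for n
  proof (induction n)
    case 0
    show ?case using span_superset[of "W \<union> G"] by simp
  next
    case (Suc n)
    let ?V = "span (W \<union> (j ^^ Suc n) ` G)"
    have V: "subspace ?V" "Z \<subseteq> ?V" "W \<subseteq> ?V"
      using W span_superset[of "W \<union> (j ^^ Suc n) ` G"] by auto
    have ln: "loc_scalar Z (j ^^ n)" by (rule loc_scalar_funpow[OF Z lj])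
    have "G \<subseteq> span (W \<union> j ` G)" using eq insert.prems by blast
    also have "\<dots> \<subseteq> {h. (j ^^ n) h \<in> ?V}"
    proof (rule span_minimal[OF _ loc_scalar_preimage[OF Z ln V(1,2)]])
      have "(j ^^ n) w \<in> ?V" if "w \<in> W" for w using loc_scalar_mem[OF W ln that] V by blast
      moreover have "(j ^^ n) (j h) \<in> ?V" if "h \<in> G" for h
        using that by (intro span_base) (auto simp: funpow_swap1)
      ultimately show "W \<union> j ` G \<subseteq> {h. (j ^^ n) h \<in> ?V}" by auto
    qed
    finally have "(j ^^ n) ` G \<subseteq> ?V" by blast
    then have "span (W \<union> (j ^^ n) ` G) \<subseteq> ?V" using V by (intro span_minimal) auto
    with Suc show ?case by blast
  qed
  obtain n where "\<forall>h\<in>G. (j ^^ n) h \<in> Z" using nilops_nilpotent[of j] insert by blast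
  then have "W \<union> (j ^^ n) ` G = W" using W by blast
  then have "G \<subseteq> W" using it[of n] W by (simp add: span_ident)
  then show ?case unfolding W_def using insert by blast
qed

text \<open>All images of G under \<open>nilops\<close> together span a stable submodule. If it is
  proper, minimality bounds it. If it is G, the chain condition finds finitely many operators whose
  images span G over a proper irreducible B, against \<open>absorb_nilops\<close>.\<close>

lemma nilops_uniform: "\<exists>e. \<forall>f\<in>nilops. \<forall>h\<in>G. f h \<in> ker e"
proof -
  let ?S = "Z \<union> {f h | f h. f \<in> nilops \<and> h \<in> G}"
  have lop: "loc_scalar Z f" if "f \<in> nilops" for f using that by (simp add: nilops_def)
  have "stable (span ?S)"
  proof (rule stable_span)
    fix h assume "h \<in> ?S"
    then consider "h \<in> Z" | f g where "f \<in> nilops" "g \<in> G" "h = f g" by blast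
    then show "X h \<in> span ?S"
    proof cases
      case 1
      then show ?thesis by (intro span_base) (simp add: X_Z)
    next
      case 2
      obtain q where q: "p = Suc q" using p2 by (cases p) auto
      have "(f ^^ q) (X g) \<in> G"
        by (rule G_op[OF loc_scalar_funpow[OF Z lop[OF 2(1)]] stableD(3)[OF G 2(2)]])
      then have "f ((f ^^ q) (X g)) \<in> span ?S" using 2 by (intro span_base) blast
      then have "(f ^^ p) (X g) \<in> span ?S" by (simp add: q)
      moreover have "X (f g) - (f ^^ p) (X g) \<in> span ?S"
        using loc_scalar_X[OF lop[OF 2(1)]] by (intro span_base) simp
      ultimately show ?thesis using span_add 2(3) by fastforce
    qed
  qed blast
  moreover have sub: "span ?S \<subseteq> G"
    using ZG G_op[OF lop] by (intro span_minimal sG) auto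
  moreover have "span ?S \<noteq> G"
  proof
    assume eq: "span ?S = G"
    have "G \<noteq> Z" using G_nb ker_0 by (auto simp: nil_bounded_def)
    then obtain h0 where h0: "h0 \<in> G" "h0 \<notin> Z" using ZG by blast
    obtain B where B: "irr G h0 B" "Z \<subseteq> B" by (rule ex_irr[OF Z ZG h0])
    have sB: "subspace B" "B \<subseteq> G" "h0 \<notin> B" using B by (auto simp: irr_def)
    define D where "D J = G \<inter> (\<Inter>j\<in>J. {h. j h \<in> B})" for J :: "('h \<Rightarrow> 'h) set"
    have sD: "subspace (D J)" "Z \<subseteq> D J" if "J \<subseteq> nilops" for J
    proof -
      have "subspace {h. j h \<in> B}" if "j \<in> J" for j
        using loc_scalar_preimage[OF Z lop sB(1) B(2)] that \<open>J \<subseteq> nilops\<close> by blast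
      then show "subspace (D J)" unfolding D_def by (intro subspace_inter sG subspace_Int)
      show "Z \<subseteq> D J"
        unfolding D_def using ZG loc_scalar_mem[OF Z order_refl lop] that B(2) by blast
    qed
    \<comment> \<open>Minimality of D J substitutes for finite generation of the ideal
      \<open>nilops\<close>: adding another operator to J imposes no further condition.\<close>
    obtain N where N: "subspace N" "Z \<subseteq> N" "N \<subseteq> UNIV" "\<exists>J. finite J \<and> J \<subseteq> nilops \<and> N = D J"
      and mn: "\<And>N'. subspace N' \<Longrightarrow> Z \<subseteq> N' \<Longrightarrow> N' \<subseteq> N \<Longrightarrow>
        \<exists>J. finite J \<and> J \<subseteq> nilops \<and> N' = D J \<Longrightarrow> N' = N"
      by (rule dcc_minimal[OF artinian, of "D {}" "\<lambda>N. \<exists>J. finite J \<and> J \<subseteq> nilops \<and> N = D J"])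
        (use sD[of "{}"] in auto)
    then obtain J where J: "finite J" "J \<subseteq> nilops" "N = D J" by blast
    let ?U = "span (B \<union> (\<Union>j\<in>J. j ` G))"
    have UG: "?U \<subseteq> G" using sB J G_op lop by (intro span_minimal sG) blast
    have BU: "B \<subseteq> ?U" using span_superset[of "B \<union> (\<Union>j\<in>J. j ` G)"] by blast
    have in_U: "f h \<in> ?U" if f: "f \<in> nilops" and h: "h \<in> G" for f h
    proof (rule ccontr)
      assume n: "f h \<notin> ?U"
      \<comment> \<open>Because s commutes with the operators modulo Z, s h lies in D J; then f (s
        h) lies in B, against the choice of s.\<close>
      obtain s where s: "loc_scalar Z s" "\<forall>u\<in>?U. s u \<in> B" "s (f h) \<notin> B"
        using duality[OF Z dcc_mono[OF artinian order_refl subset_UNIV] torsion sG B _ BU UG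
            G_op[OF lop[OF f] h] n] by blast
      have "s h \<in> D J"
      proof -
        have "j (s h) \<in> B" if "j \<in> J" for j
        proof -
          have "j h \<in> ?U" using that h by (intro span_base) blast
          then have "s (j h) \<in> B" using s by blast
          moreover have "j (s h) - s (j h) \<in> B"
            using loc_scalar_commute[OF Z lop s(1), of j h] that J B(2) by blast
          ultimately show ?thesis using mem_cong[OF sB(1)] by blast
        qed
        moreover have "s h \<in> G" by (rule G_op[OF s(1) h])
        ultimately show ?thesis unfolding D_def by blast
      qed
      moreover have "D (insert f J) = N"
      proof (rule mn)
        show "subspace (D (insert f J))" "Z \<subseteq> D (insert f J)" using sD[of "insert f J"] J f by auto
        show "D (insert f J) \<subseteq> N" unfolding J(3) D_def by blast
        show "\<exists>J'. finite J' \<and> J' \<subseteq> nilops \<and> D (insert f J) = D J'"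
          using J f by (intro exI[of _ "insert f J"]) auto
      qed
      ultimately have "s h \<in> D (insert f J)" using J by simp
      then have "f (s h) \<in> B" unfolding D_def by blast
      moreover have "f (s h) - s (f h) \<in> B"
        using loc_scalar_commute[OF Z lop[OF f] s(1), of h] B(2) by blast
      ultimately show False using mem_cong[OF sB(1)] s(3) by blast
    qed
    have "?S \<subseteq> ?U" using in_U B(2) BU by blast
    then have "G \<subseteq> ?U" using eq span_minimal[of ?S ?U] by auto
    then have "G \<subseteq> B" by (rule absorb_nilops[OF J(1,2) sB(1) B(2)])
    with h0 sB show False by blast
  qed
  ultimately obtain e where e: "span ?S \<subseteq> ker e" using G_min unfolding nil_bounded_def by blast
  then show ?thesis using span_superset[of ?S] by (intro exI[of _ e]) blast
qed

text \<open>Among the finite intersections of irreducible submodules over K one is minimal; an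
  element of it outside K could be excluded by one more irreducible submodule.\<close>

lemma finite_irr_decomposition:
  assumes K: "subspace K" "Z \<subseteq> K" "K \<subseteq> G"
  obtains Bs where "\<forall>B\<in>set Bs. K \<subseteq> B \<and> (\<exists>h. irr G h B)" "G \<inter> \<Inter> (set Bs) = K"
proof -
  let ?P = "\<lambda>N. \<exists>Bs. (\<forall>B\<in>set Bs. K \<subseteq> B \<and> (\<exists>h. irr G h B)) \<and> N = G \<inter> \<Inter> (set Bs)"
  have "?P G" by (intro exI[of _ "[]"]) simp
  obtain N where N: "subspace N" "Z \<subseteq> N" "N \<subseteq> UNIV" "?P N"
    and mn: "\<And>N'. subspace N' \<Longrightarrow> Z \<subseteq> N' \<Longrightarrow> N' \<subseteq> N \<Longrightarrow> ?P N' \<Longrightarrow> N' = N"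
    by (rule dcc_minimal[OF artinian sG ZG subset_UNIV, of ?P]) (use \<open>?P G\<close> in auto)
  then obtain Bs where Bs: "\<forall>B\<in>set Bs. K \<subseteq> B \<and> (\<exists>h. irr G h B)" "N = G \<inter> \<Inter> (set Bs)" by blast
  have "N \<subseteq> K"
  proof (rule ccontr)
    assume "\<not> N \<subseteq> K"
    then obtain h where h: "h \<in> N" "h \<notin> K" by blast
    then have "h \<in> G" using Bs by blast
    obtain B where B: "irr G h B" "K \<subseteq> B" by (rule ex_irr[OF K(1,3) \<open>h \<in> G\<close> h(2)])
    have sB: "subspace B" "h \<notin> B" using B by (auto simp: irr_def)
    have "N \<inter> B = N"
    proof (rule mn)
      show "subspace (N \<inter> B)" by (intro subspace_inter N sB)
      show "Z \<subseteq> N \<inter> B" using N K B by blast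
      have "N \<inter> B = G \<inter> \<Inter> (set (B # Bs))" using Bs by auto
      then show "?P (N \<inter> B)" using Bs B by (intro exI[of _ "B # Bs"]) auto
    qed blast
    with h sB show False by blast
  qed
  moreover have "K \<subseteq> N" using Bs K by blast
  ultimately show ?thesis using that[of Bs] Bs by auto
qed

text \<open>For every n, one of the finitely many components B i detects membership in
  \<open>nilops\<close> on the step from K n to K (n + 1). Two values n < n' share a component, and
  duality then yields a scalar that is and is not in \<open>nilops\<close>.\<close>

lemma no_minimal_counterexample: False
proof -
  obtain e where e: "\<And>f h. f \<in> nilops \<Longrightarrow> h \<in> G \<Longrightarrow> f h \<in> ker e" using nilops_uniform by blast
  \<comment> \<open>The shift by e is chosen so that every operator in \<open>nilops\<close> maps G
    into K 0.\<close>
  define K where "K n = ker (e + n) \<inter> G" for n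
  have sK: "subspace (K n)" "Z \<subseteq> K n" "K n \<subseteq> G" for n
    unfolding K_def using ker_Z ZG by (auto intro: subspace_inter ker_subspace sG)
  have K_mono: "K n \<subseteq> K n'" if "n \<le> n'" for n n'
    unfolding K_def using ker_mono[of "e + n" "e + n'"] that by auto
  obtain Bs where Bs: "\<forall>B\<in>set Bs. K 0 \<subseteq> B \<and> (\<exists>h. irr G h B)" "G \<inter> \<Inter> (set Bs) = K 0"
    by (rule finite_irr_decomposition[OF sK(1)[of 0] sK(2) sK(3)])
  define r where "r = length Bs"
  define B where "B i = Bs ! i" for i
  have B: "K 0 \<subseteq> B i" "\<exists>h. irr G h (B i)" if "i < r" for i
    using Bs(1)[rule_format, of "B i"] that by (auto simp: B_def r_def)
  have sB: "subspace (B i)" if "i < r" for i using B(2)[OF that] by (auto simp: irr_def)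
  define L where "L i = G \<inter> (\<Inter>j<i. B j)" for i
  have sL: "subspace (L i)" if "i \<le> r" for i
    unfolding L_def using sB that by (intro subspace_inter sG subspace_Int) auto
  have Lr: "L r = K 0"
  proof -
    have "\<Inter> (set Bs) = (\<Inter>j<length Bs. Bs ! j)" by (auto simp: set_conv_nth)
    then show ?thesis unfolding L_def Bs(2)[symmetric] r_def B_def by simp
  qed
  have id_nn: "(\<lambda>h. h) \<notin> nilops"
    using G_nb by (auto simp: nilops_def nil_bounded_def)
  \<comment> \<open>Here p at least 2 is used. If s^2 (X h) lies in K n, then so does s^p (X h),
    which is X (s h) modulo Z; hence s h lies in K (n + 1) and s (s h) in K n. So s^2 is in
    \<open>nilops\<close>, and primeness gives s.\<close>
  have square: "s \<in> nilops" if s: "loc_scalar Z s" "\<And>h. h \<in> K (Suc n) \<Longrightarrow> s h \<in> K n" for s n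
  proof -
    have ss: "loc_scalar Z (\<lambda>h. s (s h))" by (rule loc_scalar_comp[OF Z s(1,1)])
    have *: "s (s h) \<in> K n" if "h \<in> K (n + j)" for h j
      using that
    proof (induction j arbitrary: h)
      case 0
      then show ?case using loc_scalar_mem[OF sK(1,2) s(1)] by simp
    next
      case (Suc j)
      have hG: "h \<in> G" using Suc.prems by (simp add: K_def)
      have "X h \<in> ker (e + (n + j))"
        using Suc.prems ker_add[of 1 h "e + (n + j)"] by (simp add: K_def)
      then have "X h \<in> K (n + j)" using stableD(3)[OF G hG] by (simp add: K_def)
      then have "s (s (X h)) \<in> K n" by (rule Suc.IH)
      then have "(s ^^ (p - 2)) (s (s (X h))) \<in> K n"
        by (rule loc_scalar_mem[OF sK(1,2) loc_scalar_funpow[OF Z s(1)]])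
      moreover have "(s ^^ p) (X h) = (s ^^ (p - 2)) ((s ^^ 2) (X h))"
        using p2 by (metis comp_apply funpow_add le_add_diff_inverse2)
      ultimately have "(s ^^ p) (X h) \<in> K n" by (simp add: numeral_2_eq_2)
      moreover have "X (s h) - (s ^^ p) (X h) \<in> K n" using loc_scalar_X[OF s(1)] sK(2) by blast
      ultimately have "X (s h) \<in> ker (e + n)" using mem_cong[OF sK(1)] by (auto simp: K_def)
      then have "s h \<in> ker (e + Suc n)" using ker_add[of 1 "s h" "e + n"] by simp
      then have "s h \<in> K (Suc n)" using G_op[OF s(1) hG] by (simp add: K_def)
      then show ?case by (rule s(2))
    qed
    have "s (s h) \<in> ker (e + n)" if "h \<in> G" for h
    proof -
      obtain k where "h \<in> ker k" using G_tor[OF \<open>h \<in> G\<close>] by blast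
      then have "h \<in> K (n + k)" using ker_mono[of k "e + (n + k)"] that by (auto simp: K_def)
      then show ?thesis using *[of h k] by (simp add: K_def)
    qed
    then have "(\<lambda>h. s (s h)) \<in> nilops" by (rule nilopsI[OF ss])
    then show ?thesis using nilops_prime[OF s(1) _ s(1)] by blast
  qed
  have "\<exists>i<r. \<forall>s. loc_scalar Z s \<longrightarrow> (\<forall>h\<in>K (Suc n) \<inter> L i. s h \<in> span ((K n \<inter> L i) \<union> B i)) \<longrightarrow> s \<in> nilops" for n
  proof (rule ccontr)
    assume neg: "\<not> ?thesis"
    then have "\<forall>i<r. \<exists>s. loc_scalar Z s \<and> (\<forall>h\<in>K (Suc n) \<inter> L i. s h \<in> span ((K n \<inter> L i) \<union> B i)) \<and> s \<notin> nilops"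
      by blast
    then obtain t where t: "\<And>i. i < r \<Longrightarrow> loc_scalar Z (t i)" "\<And>i. i < r \<Longrightarrow> t i \<notin> nilops"
      "\<And>i h. i < r \<Longrightarrow> h \<in> K (Suc n) \<inter> L i \<Longrightarrow> t i h \<in> span ((K n \<inter> L i) \<union> B i)"
      by metis
    \<comment> \<open>Composing t 0, ..., t (i - 1) sends K (n + 1) into K n + L i and stays outside
      \<open>nilops\<close> by primeness. For i = r the target is K n, which \<open>square\<close>
      forbids.\<close>
    have "\<exists>s. loc_scalar Z s \<and> s \<notin> nilops \<and> (\<forall>h\<in>K (Suc n). \<exists>k\<in>K n. s h - k \<in> K (Suc n) \<inter> L i)"
      if "i \<le> r" for i
      using that
    proof (induction i)
      case 0
      have "h \<in> L 0" if "h \<in> K (Suc n)" for h using that sK(3) by (auto simp: L_def)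
      then have "\<forall>h\<in>K (Suc n). \<exists>k\<in>K n. h - k \<in> K (Suc n) \<inter> L 0"
        using subspace_0[OF sK(1)] by (auto intro!: bexI[of _ 0])
      with id_nn loc_scalar_id[OF Z] show ?case by blast
    next
      case (Suc i)
      then have i: "i < r" by simp
      from Suc obtain s where s: "loc_scalar Z s" "s \<notin> nilops"
        "\<And>h. h \<in> K (Suc n) \<Longrightarrow> \<exists>k\<in>K n. s h - k \<in> K (Suc n) \<inter> L i" by auto
      have "\<exists>k\<in>K n. t i (s h) - k \<in> K (Suc n) \<inter> L (Suc i)" if h: "h \<in> K (Suc n)" for h
      proof -
        obtain k where k: "k \<in> K n" "s h - k \<in> K (Suc n)" "s h - k \<in> L i" using s(3)[OF h] by blast
        have "t i (s h - k) \<in> span ((K n \<inter> L i) \<union> B i)" using t(3)[OF i] k by blast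
        then obtain k' where k': "k' \<in> K n" "k' \<in> L i" "t i (s h - k) - k' \<in> B i"
          using span_Un_iff[OF subspace_inter[OF sK(1) sL] sB] i by (metis IntE less_imp_le)
        have "Z \<subseteq> B j" if "j < i" for j using sK(2)[of 0] B(1)[of j] i that by auto
        then have "Z \<subseteq> L i" unfolding L_def using ZG by auto
        then have ti: "t i (s h - k) \<in> K (Suc n)" "t i (s h - k) \<in> L i"
          using loc_scalar_mem[OF sK(1,2) t(1)[OF i] k(2)] loc_scalar_mem[OF sL _ t(1)[OF i] k(3)] i
          by auto
        define b where "b = t i (s h - k) - k'"
        have "k' \<in> K (Suc n)" using k' K_mono[of n "Suc n"] by auto
        then have bK: "b \<in> K (Suc n)" unfolding b_def using ti by (intro subspace_diff[OF sK(1)])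
        have "b \<in> L i" unfolding b_def using ti k' i by (intro subspace_diff[OF sL]) auto
        then have bL: "b \<in> L (Suc i)" using k'(3) by (auto simp: L_def b_def less_Suc_eq)
        obtain c where c: "t i (s h) - c *s s h \<in> Z" "t i k - c *s k \<in> Z" "t i (s h - k) - c *s (s h - k) \<in> Z"
          using loc_scalarD[OF t(1)[OF i], of "{s h, k, s h - k}"] by auto
        \<comment> \<open>The operator t i is additive only modulo Z; z measures the defect.\<close>
        define z where "z = (t i (s h) - c *s s h) - (t i k - c *s k) - (t i (s h - k) - c *s (s h - k))"
        have "z \<in> Z" unfolding z_def using c by (simp only: subspace_diff[OF Z])
        then have "z \<in> K n" using sK(2) by blast
        moreover have "t i k \<in> K n" by (rule loc_scalar_mem[OF sK(1,2) t(1)[OF i] k(1)])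
        ultimately have "z + t i k + k' \<in> K n" using k'(1) by (simp only: subspace_add[OF sK(1)])
        moreover have "t i (s h) - (z + t i k + k') = b"
          by (simp add: z_def b_def scale_right_diff_distrib)
        ultimately show ?thesis using bK bL by (metis IntI)
      qed
      then show ?case
        using loc_scalar_comp[OF Z t(1)[OF i] s(1)] nilops_prime[OF t(1,2)[OF i] s(1,2)]
        by (intro exI[of _ "\<lambda>h. t i (s h)"]) blast
    qed
    from this[OF order_refl] obtain s where s: "loc_scalar Z s" "s \<notin> nilops"
      "\<And>h. h \<in> K (Suc n) \<Longrightarrow> \<exists>k\<in>K n. s h - k \<in> L r" by blast
    have "s h \<in> K n" if h: "h \<in> K (Suc n)" for h
    proof -
      obtain k where k: "k \<in> K n" "s h - k \<in> L r" using s(3)[OF h] by blast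
      then have "s h - k \<in> K n" using Lr K_mono[of 0 n] by auto
      with k mem_cong[OF sK(1)] show ?thesis by blast
    qed
    from square[OF s(1) this] s(2) show False by blast
  qed
  then obtain idx where idx: "\<And>n. idx n < r"
    "\<And>n s. loc_scalar Z s \<Longrightarrow> (\<And>h. h \<in> K (Suc n) \<inter> L (idx n) \<Longrightarrow>
        s h \<in> span ((K n \<inter> L (idx n)) \<union> B (idx n))) \<Longrightarrow> s \<in> nilops"
    by metis
  \<comment> \<open>There are r + 1 steps but only r components.\<close>
  have "\<not> inj_on idx {..r}"
  proof
    assume "inj_on idx {..r}"
    then have "card {..r} \<le> card {..<r}" using idx(1) by (intro card_inj_on_le[of idx]) auto
    then show False by simp
  qed
  then obtain n0 n1 where n01: "n0 \<noteq> n1" "idx n0 = idx n1" unfolding inj_on_def by blast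
  define n n' where "n = min n0 n1" and "n' = max n0 n1"
  have nn: "n < n'" "idx n = idx n'" using n01 by (auto simp: n_def n'_def min_def max_def)
  define i where "i = idx n'"
  have i: "i < r" using idx(1) by (simp add: i_def)
  define V where "V = span ((K n' \<inter> L i) \<union> B i)"
  have VG: "V \<subseteq> G" unfolding V_def using sK(3) B(2)[OF i]
    by (intro span_minimal sG) (auto simp: irr_def)
  have BV: "B i \<subseteq> V" using span_superset[of "(K n' \<inter> L i) \<union> B i"] by (auto simp: V_def)
  \<comment> \<open>Otherwise the identity would satisfy the criterion attached to idx n' and lie in
    \<open>nilops\<close>.\<close>
  have "\<exists>h\<in>K (Suc n') \<inter> L i. h \<notin> V"
    using idx(2)[OF loc_scalar_id[OF Z], of n'] id_nn by (auto simp: V_def i_def)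
  then obtain h where h: "h \<in> K (Suc n')" "h \<notin> V" by blast
  then have hG: "h \<in> G" using sK(3) by blast
  obtain h0 where h0: "irr G h0 (B i)" using B(2)[OF i] by blast
  have ZB: "Z \<subseteq> B i" using B(1)[OF i] sK(2)[of 0] by blast
  obtain s where s: "loc_scalar Z s" "\<forall>u\<in>V. s u \<in> B i" "s h \<notin> B i"
    using duality[OF Z dcc_mono[OF artinian order_refl subset_UNIV] torsion sG h0 ZB _ BV VG hG h(2)]
    by (auto simp: V_def)
  have "s \<notin> nilops"
  proof
    assume "s \<in> nilops"
    then have "s h \<in> K 0" using e[OF _ hG] G_op[OF s(1) hG] by (simp add: K_def)
    with B(1)[OF i] s(3) show False by blast
  qed
  \<comment> \<open>As n < n', K (n + 1) is contained in K n', whose intersection with L i is sent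
    into B i by s.\<close>
  moreover have "s \<in> nilops"
  proof (rule idx(2)[OF s(1), of n])
    fix g assume g: "g \<in> K (Suc n) \<inter> L (idx n)"
    then have "g \<in> K n' \<inter> L i" using K_mono[of "Suc n" n'] nn by (auto simp: i_def)
    then have "g \<in> V" unfolding V_def by (intro span_base) simp
    then have "s g \<in> B (idx n)" using s nn by (simp add: i_def)
    then show "s g \<in> span ((K n \<inter> L (idx n)) \<union> B (idx n))" by (intro span_base) simp
  qed
  ultimately show False by blast
qed

end

section \<open>The x-torsion submodule and the HSL-number\<close>

definition gamma :: "'h set" where
  "gamma = {h. \<exists>n. h \<in> ker n}"

lemma gamma_subspace: "subspace gamma"
  unfolding subspace_def
proof (intro conjI ballI allI)
  show "0 \<in> gamma" using subspace_0[OF ker_subspace] by (auto simp: gamma_def)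
next
  fix x y assume "x \<in> gamma" "y \<in> gamma"
  then obtain i j where "x \<in> ker i" "y \<in> ker j" by (auto simp: gamma_def)
  then have "x \<in> ker (max i j)" "y \<in> ker (max i j)"
    using ker_mono[of i "max i j"] ker_mono[of j "max i j"] by auto
  from subspace_add[OF ker_subspace this] show "x + y \<in> gamma" by (auto simp: gamma_def)
next
  fix c x assume "x \<in> gamma"
  then show "c *s x \<in> gamma" using subspace_scale[OF ker_subspace] by (auto simp: gamma_def)
qed

lemma Z_gamma: "Z \<subseteq> gamma"
  using ker_0 by (auto simp: gamma_def)

lemma gamma_stable: "stable gamma"
  unfolding stable_def
proof (intro conjI ballI gamma_subspace Z_gamma)
  show "X h \<in> gamma" if "h \<in> gamma" for h using that stableD(3)[OF ker_stable] by (auto simp: gamma_def)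
qed

theorem hartshorne_speiser_lyubeznik: "\<exists>e. \<forall>h n. (X ^^ n) h \<in> Z \<longrightarrow> (X ^^ e) h \<in> Z"
proof (rule ccontr)
  assume neg: "\<not> ?thesis"
  have not_nil: "\<not> nil_bounded gamma"
    using neg by (auto simp: nil_bounded_def gamma_def ker_def)
  obtain G where G: "subspace G" "Z \<subseteq> G" "G \<subseteq> UNIV" "stable G \<and> G \<subseteq> gamma \<and> \<not> nil_bounded G"
    and mn: "\<And>N'. subspace N' \<Longrightarrow> Z \<subseteq> N' \<Longrightarrow> N' \<subseteq> G \<Longrightarrow>
      stable N' \<and> N' \<subseteq> gamma \<and> \<not> nil_bounded N' \<Longrightarrow> N' = G"
    by (rule dcc_minimal[OF artinian gamma_subspace Z_gamma subset_UNIV,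
          of "\<lambda>N. stable N \<and> N \<subseteq> gamma \<and> \<not> nil_bounded N"]) (use gamma_stable not_nil in auto)
  show False
  proof (rule no_minimal_counterexample[of G])
    show "stable G" "\<not> nil_bounded G" using G by auto
    show "\<exists>n. h \<in> ker n" if "h \<in> G" for h using that G by (auto simp: gamma_def)
    show "nil_bounded N" if "stable N" "N \<subseteq> G" "N \<noteq> G" for N
    proof (rule ccontr)
      assume "\<not> nil_bounded N"
      then have "N = G" using that G by (intro mn) (auto dest: stableD)
      with that show False by simp
    qed
  qed
qed

end

section \<open>Special ideals\<close>

lemma prime_Inter:
  assumes P: "prime_ideal P" and F: "finite F" "\<And>I. I \<in> F \<Longrightarrow> R.subspace I" "\<Inter>F \<subseteq> P"
  shows "\<exists>I\<in>F. I \<subseteq> P"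
  using F
proof (induction F)
  case empty
  then show ?case using prime_one[OF P] by auto
next
  case (insert I F)
  show ?case
  proof (cases "I \<subseteq> P")
    case False
    then obtain a where a: "a \<in> I" "a \<notin> P" by blast
    have "\<Inter>F \<subseteq> P"
    proof
      fix b assume b: "b \<in> \<Inter>F"
      have "a * b \<in> I" using a insert.prems(1)[of I] subspace_mult_right by blast
      moreover have "a * b \<in> K" if "K \<in> F" for K
        using b that insert.prems(1)[of K] R.subspace_scale by blast
      ultimately have "a * b \<in> P" using insert.prems(2) by blast
      then show "b \<in> P" using a prime_mult[OF P] by blast
    qed
    then show ?thesis using insert by blast
  qed blast
qed

lemma reg_one: "reg 1 J"
  by (simp add: reg_def)

lemma reg_mult:
  assumes "reg a J" "reg b J"
  shows "reg (a * b) J"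
  unfolding reg_def
proof (intro allI impI)
  fix z assume "a * b * z \<in> J"
  then have "a * (b * z) \<in> J" by (simp only: mult.assoc)
  then have "b * z \<in> J" using assms(1) unfolding reg_def by blast
  then show "z \<in> J" using assms(2) unfolding reg_def by blast
qed

lemma reg_prod: "(\<And>i. i \<in> F \<Longrightarrow> reg (f i) J) \<Longrightarrow> reg (prod f F) J"
  by (induction F rule: infinite_finite_induct) (auto intro: reg_one reg_mult)

context frobenius_module
begin

text \<open>These are the stable T for which the quotient by T is x-torsion-free.\<close>

definition closed :: "'h set \<Rightarrow> bool" where
  "closed T \<longleftrightarrow> stable T \<and> (\<forall>h. X h \<in> T \<longrightarrow> h \<in> T)"

lemma closed_X:
  assumes "closed T" "X h \<in> T"
  shows "h \<in> T"
proof -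
  have "\<forall>h. X h \<in> T \<longrightarrow> h \<in> T" using assms(1) unfolding closed_def by (rule conjunct2)
  then have "X h \<in> T \<longrightarrow> h \<in> T" by (rule spec)
  then show ?thesis using assms(2) by (rule mp)
qed

lemma closed_stable: "closed T \<Longrightarrow> stable T"
  unfolding closed_def by (rule conjunct1)

lemma closed_subspace: "closed T \<Longrightarrow> subspace T"
  by (rule stableD(1)[OF closed_stable])

lemmas closedD = closed_stable closed_subspace

lemma closed_Xn: "closed T \<Longrightarrow> (X ^^ n) h \<in> T \<Longrightarrow> h \<in> T"
proof (induction n)
  case (Suc n)
  have "X ((X ^^ n) h) \<in> T" using Suc.prems(2) by simp
  then have "(X ^^ n) h \<in> T" by (rule closed_X[OF Suc.prems(1)])
  then show ?case by (rule Suc.IH[OF Suc.prems(1)])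
qed simp

definition ann :: "'h set \<Rightarrow> 'h set \<Rightarrow> 'a set" where
  "ann T N = {r. \<forall>h\<in>N. r *s h \<in> T}"

lemma ann_subspace: "subspace T \<Longrightarrow> R.subspace (ann T N)"
  unfolding ann_def by (rule subspace_annihilator_set)

lemma ann_UNIV_iff: "subspace T \<Longrightarrow> ann T N = UNIV \<longleftrightarrow> N \<subseteq> T"
  using subspace_one_iff[OF ann_subspace, of T N] by (auto simp: ann_def)

lemma scale_power_mem: "subspace T \<Longrightarrow> r ^ k *s h \<in> T \<Longrightarrow> k \<le> l \<Longrightarrow> r ^ l *s h \<in> T"
  using subspace_scale[of T "r ^ k *s h" "r ^ (l - k)"] by (simp flip: power_add)

lemma scale_pos_power_mem: "subspace T \<Longrightarrow> r *s h \<in> T \<Longrightarrow> 0 < l \<Longrightarrow> r ^ l *s h \<in> T"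
  using scale_power_mem[of T r 1 h l] by simp

text \<open>Since p^k exceeds k, r^(p^k) X^k h = X^k (r h) lies in T, and X^k can be cancelled
  because T is closed.\<close>

lemma ann_radical:
  assumes T: "closed T" and N: "stable N" and r: "r ^ k \<in> ann T N"
  shows "r \<in> ann T N"
proof -
  have "r *s h \<in> T" if h: "h \<in> N" for h
  proof -
    have "k < p ^ k" using p2 by (intro power_gt_expt) simp
    moreover have "r ^ k *s (X ^^ k) h \<in> T" using r stable_Xn[OF N h] by (simp add: ann_def)
    ultimately have "r ^ (p ^ k) *s (X ^^ k) h \<in> T" using scale_power_mem[OF closedD(2)[OF T]] by simp
    then have "(X ^^ k) (r *s h) \<in> T" by (simp add: Xn_scale)
    then show ?thesis by (rule closed_Xn[OF T])
  qed
  then show ?thesis by (simp add: ann_def)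
qed

text \<open>For closed T, the largest stable submodule annihilated by I modulo T; imposing the
  condition on all X^n h makes it stable.\<close>

definition killed :: "'h set \<Rightarrow> 'a set \<Rightarrow> 'h set" where
  "killed T I = {h. \<forall>c\<in>I. \<forall>n. c *s (X ^^ n) h \<in> T}"

lemma killed_antimono: "I \<subseteq> I' \<Longrightarrow> killed T I' \<subseteq> killed T I"
  by (auto simp: killed_def)

lemma killed_superset: "stable T \<Longrightarrow> T \<subseteq> killed T I"
  using stable_Xn[of T] subspace_scale[OF stableD(1), of T] by (auto simp: killed_def)

lemma killed_closed:
  assumes T: "closed T"
  shows "closed (killed T I)"
  unfolding closed_def stable_def
proof (intro conjI ballI allI impI)
  have sT: "subspace T" and stT: "stable T" using T by (auto dest: closedD)
  show "subspace (killed T I)"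
    unfolding subspace_def killed_def
  proof (intro conjI ballI allI CollectI)
    show "c *s (X ^^ n) 0 \<in> T" for c n using subspace_0[OF sT] by simp
    show "c *s (X ^^ n) (x + y) \<in> T"
      if "x \<in> {h. \<forall>c\<in>I. \<forall>n. c *s (X ^^ n) h \<in> T}" "y \<in> {h. \<forall>c\<in>I. \<forall>n. c *s (X ^^ n) h \<in> T}"
        "c \<in> I" for x y c n
      using that by (simp add: Xn_add scale_right_distrib subspace_add[OF sT])
    show "c *s (X ^^ n) (a *s x) \<in> T"
      if "x \<in> {h. \<forall>c\<in>I. \<forall>n. c *s (X ^^ n) h \<in> T}" "c \<in> I" for x a c n
    proof -
      have "c *s (X ^^ n) x \<in> T" using that by simp
      then have "a ^ (p ^ n) *s (c *s (X ^^ n) x) \<in> T" by (rule subspace_scale[OF sT])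
      then show ?thesis by (simp add: Xn_scale mult.commute)
    qed
  qed
  show "Z \<subseteq> killed T I" using killed_superset[OF stT] stableD(2)[OF stT] by blast
  show "X h \<in> killed T I" if "h \<in> killed T I" for h
    unfolding killed_def
  proof (intro CollectI ballI allI)
    fix c n assume "c \<in> I"
    then have "c *s (X ^^ Suc n) h \<in> T" using that by (simp add: killed_def del: funpow.simps)
    then show "c *s (X ^^ n) (X h) \<in> T" by (simp add: funpow_swap1)
  qed
  show "h \<in> killed T I" if h: "X h \<in> killed T I" for h
    unfolding killed_def
  proof (intro CollectI ballI allI)
    fix c n assume c: "c \<in> I"
    show "c *s (X ^^ n) h \<in> T"
    proof (cases n)
      case 0
      have "c *s (X ^^ 0) (X h) \<in> T" using h c unfolding killed_def by blast
      then have "c ^ p *s X h \<in> T" using p2 scale_pos_power_mem[OF sT, of c "X h" p] by simp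
      then have "X (c *s h) \<in> T" by (simp add: X_scale)
      then have "c *s h \<in> T" by (rule closed_X[OF T])
      then show ?thesis using 0 by simp
    next
      case (Suc k)
      have "c *s (X ^^ k) (X h) \<in> T" using h c by (simp add: killed_def)
      then show ?thesis by (simp add: Suc funpow_swap1)
    qed
  qed
qed

lemma sub_killed: "stable N \<Longrightarrow> I \<subseteq> ann T N \<Longrightarrow> N \<subseteq> killed T I"
  using stable_Xn by (fastforce simp: killed_def ann_def)

lemma ann_killed: "I \<subseteq> ann T (killed T I)"
proof
  fix c assume "c \<in> I"
  then have "c *s (X ^^ 0) h \<in> T" if "h \<in> killed T I" for h
    using that unfolding killed_def by blast
  then show "c \<in> ann T (killed T I)" by (simp add: ann_def)
qed

lemma stable_Int: "stable M \<Longrightarrow> stable N \<Longrightarrow> stable (M \<inter> N)"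
  by (auto simp: stable_def subspace_inter)

lemma stable_mult_span:
  assumes T: "stable T" and N: "stable N"
  shows "stable (span (T \<union> {c *s h | c h. c \<in> I \<and> h \<in> N}))"
proof (rule stable_span)
  show "Z \<subseteq> T \<union> {c *s h |c h. c \<in> I \<and> h \<in> N}" using stableD(2)[OF T] by blast
  fix g assume "g \<in> T \<union> {c *s h |c h. c \<in> I \<and> h \<in> N}"
  then consider "g \<in> T" | c h where "c \<in> I" "h \<in> N" "g = c *s h" by blast
  then show "X g \<in> span (T \<union> {c *s h |c h. c \<in> I \<and> h \<in> N})"
  proof cases
    case 1
    then show ?thesis using stableD(3)[OF T] by (intro span_base) simp
  next
    case 2
    have "p = Suc (p - 1)" using p2 by simp
    then have "c ^ p = c * c ^ (p - 1)" by (metis power_Suc)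
    then have "X g = c *s (c ^ (p - 1) *s X h)" using 2 by (simp add: X_scale)
    moreover have "c ^ (p - 1) *s X h \<in> N"
      using stableD(3)[OF N 2(2)] subspace_scale[OF stableD(1)[OF N]] by blast
    ultimately show ?thesis using 2 by (intro span_base) blast
  qed
qed

lemma ann_mult_span:
  assumes T: "subspace T"
  shows "ann T (span (T \<union> {c *s h | c h. c \<in> I \<and> h \<in> N})) = {r. \<forall>c\<in>I. \<forall>h\<in>N. (r * c) *s h \<in> T}"
    (is "ann T (span ?S) = ?A")
proof (rule antisym)
  show "ann T (span ?S) \<subseteq> ?A"
  proof
    fix r assume r: "r \<in> ann T (span ?S)"
    have "r *s (c *s h) \<in> T" if "c \<in> I" "h \<in> N" for c h
      using r that span_base[of "c *s h" ?S] unfolding ann_def by blast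
    then show "r \<in> ?A" by simp
  qed
  show "?A \<subseteq> ann T (span ?S)"
  proof
    fix r assume r: "r \<in> ?A"
    have "subspace {h. r *s h \<in> T}"
      using T subspace_scale[OF T]
      by (auto simp: subspace_def scale_right_distrib scale_left_commute simp del: scale_scale)
    then have "span ?S \<subseteq> {h. r *s h \<in> T}"
      using r subspace_scale[OF T] by (intro span_minimal) auto
    then show "r \<in> ann T (span ?S)" by (auto simp: ann_def)
  qed
qed

section \<open>Maximal special ideals of a torsion-free quotient\<close>

definition special_over :: "'h set \<Rightarrow> 'a set \<Rightarrow> bool" where
  "special_over T I \<longleftrightarrow> (\<exists>N. stable N \<and> T \<subseteq> N \<and> I = ann T N)"

definition maxspec :: "'h set \<Rightarrow> 'a set set" where
  "maxspec T = {P. special_over T P \<and> P \<noteq> UNIV \<and>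
     (\<forall>I. special_over T I \<longrightarrow> I \<noteq> UNIV \<longrightarrow> P \<subseteq> I \<longrightarrow> I = P)}"

lemma special_overI: "stable N \<Longrightarrow> T \<subseteq> N \<Longrightarrow> special_over T (ann T N)"
  by (auto simp: special_over_def)

lemma maxspec_eq: "P \<in> maxspec T \<Longrightarrow> special_over T I \<Longrightarrow> I \<noteq> UNIV \<Longrightarrow> P \<subseteq> I \<Longrightarrow> I = P"
  by (auto simp: maxspec_def)

text \<open>For s outside P, the submodule T + s N is stable with annihilator P : s, a proper
  special ideal containing P, hence equal to P.\<close>

lemma maxspec_prime:
  assumes T: "closed T" and P: "P \<in> maxspec T"
  shows "prime_ideal P"
proof -
  obtain N where N: "stable N" "T \<subseteq> N" "P = ann T N" and pr: "P \<noteq> UNIV"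
    using P by (auto simp: maxspec_def special_over_def)
  have sT: "subspace T" and sP: "R.subspace P" using T N ann_subspace by (auto dest: closedD)
  show ?thesis
  proof (rule prime_idealI[OF sP])
    show "1 \<notin> P" using pr subspace_one_iff[OF sP] by blast
    fix s t assume st: "s * t \<in> P" "s \<notin> P"
    let ?N = "span (T \<union> {c *s h | c h. c \<in> {s} \<and> h \<in> N})"
    have ann: "ann T ?N = {r. r * s \<in> P}" 
      unfolding ann_mult_span[OF sT] unfolding N(3) ann_def by simp
    have "special_over T (ann T ?N)"
    proof (intro special_overI stable_mult_span closed_stable[OF T] N(1))
      show "T \<subseteq> ?N" using span_superset[of "T \<union> {c *s h | c h. c \<in> {s} \<and> h \<in> N}"] by (rule le_supE)
    qed
    moreover have "ann T ?N \<noteq> UNIV" using st unfolding ann by (metis UNIV_I mem_Collect_eq mult_1)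
    moreover have "P \<subseteq> ann T ?N" unfolding ann using subspace_mult_right[OF sP] by blast
    ultimately have "ann T ?N = P" by (rule maxspec_eq[OF P])
    moreover have "t \<in> ann T ?N" using st unfolding ann by (simp add: mult.commute)
    ultimately show "t \<in> P" by simp
  qed
qed

lemma ex_maxspec:
  assumes T: "subspace T" and I: "special_over T I" "I \<noteq> UNIV"
  shows "\<exists>P\<in>maxspec T. I \<subseteq> P"
proof -
  have sub: "R.subspace K" if "special_over T K" for K
    using that ann_subspace[OF T] by (auto simp: special_over_def)
  obtain P where P: "R.subspace P" "special_over T P \<and> P \<noteq> UNIV \<and> I \<subseteq> P"
    and mx: "\<And>K. R.subspace K \<Longrightarrow> special_over T K \<and> K \<noteq> UNIV \<and> I \<subseteq> K \<Longrightarrow> P \<subseteq> K \<Longrightarrow> K = P"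
    by (rule noetherian_maximal[OF noeth, of I "\<lambda>K. special_over T K \<and> K \<noteq> UNIV \<and> I \<subseteq> K"])
      (use sub I in auto)
  have "K = P" if "special_over T K" "K \<noteq> UNIV" "P \<subseteq> K" for K
    using mx[OF sub[OF that(1)]] that P(2) by (meson order_trans)
  with P show ?thesis by (auto simp: maxspec_def)
qed

text \<open>The submodules killed by distinct maximal special ideals are independent, so that there are
  only finitely many such ideals by the descending chain condition.\<close>

lemma finite_maxspec:
  assumes T: "closed T"
  shows "finite (maxspec T)"
proof -
  have sT: "subspace T" and stT: "stable T" using T by (auto dest: closedD)
  have sk: "subspace (killed T I)" for I using killed_closed[OF T] by (rule closedD)
  \<comment> \<open>This collects what is killed by finite intersections of maximal special primes
    outside F. It shrinks as F grows, so the chain condition selects a finite F.\<close>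
  define M where "M F = (\<Union>F'\<in>{F'. finite F' \<and> F' \<subseteq> maxspec T - F}. killed T (\<Inter>F'))" for F
  have sM: "subspace (M F)" for F
    unfolding subspace_def
  proof (intro conjI ballI allI)
    \<comment> \<open>The empty intersection is the whole ring, so this term is T itself.\<close>
    have "killed T (\<Inter>{}) \<subseteq> M F" unfolding M_def by blast
    then show "0 \<in> M F" using subspace_0[OF sk] by blast
  next
    fix x y assume "x \<in> M F" "y \<in> M F"
    then obtain F1 F2 where F: "finite F1" "F1 \<subseteq> maxspec T - F" "x \<in> killed T (\<Inter>F1)"
      "finite F2" "F2 \<subseteq> maxspec T - F" "y \<in> killed T (\<Inter>F2)" unfolding M_def by blast
    then have "x \<in> killed T (\<Inter>(F1 \<union> F2))" "y \<in> killed T (\<Inter>(F1 \<union> F2))"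
      using killed_antimono[of "\<Inter>(F1 \<union> F2)" "\<Inter>F1" T] killed_antimono[of "\<Inter>(F1 \<union> F2)" "\<Inter>F2" T]
      by auto
    then have "x + y \<in> killed T (\<Inter>(F1 \<union> F2))" by (rule subspace_add[OF sk])
    moreover have "F1 \<union> F2 \<in> {F'. finite F' \<and> F' \<subseteq> maxspec T - F}" using F by simp
    ultimately show "x + y \<in> M F" unfolding M_def by (rule UN_I[rotated])
  next
    fix c x assume "x \<in> M F"
    then obtain F' where F': "F' \<in> {F'. finite F' \<and> F' \<subseteq> maxspec T - F}" "x \<in> killed T (\<Inter>F')"
      unfolding M_def by (rule UN_E)
    then show "c *s x \<in> M F" unfolding M_def by (intro UN_I[OF F'(1)] subspace_scale[OF sk])
  qed
  have ZM: "Z \<subseteq> M F" for F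
  proof -
    have "killed T (\<Inter>{}) \<subseteq> M F" unfolding M_def by blast
    then show ?thesis using killed_superset[OF stT] stableD(2)[OF stT] by blast
  qed
  have M_anti: "M (insert P F) \<subseteq> M F" for P F unfolding M_def by blast
  obtain N where N: "subspace N" "Z \<subseteq> N" "N \<subseteq> UNIV" "\<exists>F. finite F \<and> N = M F"
    and mn: "\<And>N'. subspace N' \<Longrightarrow> Z \<subseteq> N' \<Longrightarrow> N' \<subseteq> N \<Longrightarrow> \<exists>F. finite F \<and> N' = M F \<Longrightarrow> N' = N"
    by (rule dcc_minimal[OF artinian sM[of "{}"] ZM subset_UNIV, of "\<lambda>N. \<exists>F. finite F \<and> N = M F"])
      auto
  then obtain F where F: "finite F" "N = M F" by blast
  have "maxspec T \<subseteq> F"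
  proof (rule subsetI, rule ccontr)
    fix P assume P: "P \<in> maxspec T" "P \<notin> F"
    have pP: "prime_ideal P" by (rule maxspec_prime[OF T P(1)])
    obtain L where L: "stable L" "T \<subseteq> L" "P = ann T L" "P \<noteq> UNIV"
      using P by (auto simp: maxspec_def special_over_def)
    then obtain h where h: "h \<in> L" "h \<notin> T" using ann_UNIV_iff[OF sT] by blast
    \<comment> \<open>So an element killed by P is also killed by a finite intersection of other
      maximal special primes, and one of those must be contained in P.\<close>
    have "M (insert P F) = N"
      using F M_anti by (intro mn sM ZM exI[of _ "insert P F"]) auto
    have "h \<in> killed T (\<Inter>{P})" using sub_killed[OF L(1), of P T] L(3) h(1) by auto
    moreover have "{P} \<in> {F'. finite F' \<and> F' \<subseteq> maxspec T - F}" using P by simp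
    ultimately have "h \<in> M F" unfolding M_def by (rule UN_I[rotated])
    then have "h \<in> M (insert P F)" using \<open>M (insert P F) = N\<close> F by simp
    then obtain F' where F': "finite F'" "F' \<subseteq> maxspec T - insert P F" "h \<in> killed T (\<Inter>F')"
      unfolding M_def by blast
    let ?L = "L \<inter> killed T (\<Inter>F')"
    have "special_over T (ann T ?L)"
      using killed_closed[OF T] killed_superset[OF stT] L
      by (intro special_overI stable_Int) (auto dest: closedD)
    moreover have "ann T ?L \<noteq> UNIV" using ann_UNIV_iff[OF sT, of ?L] h F' by blast
    moreover have "P \<subseteq> ann T ?L" using L(3) by (auto simp: ann_def)
    ultimately have "ann T ?L = P" by (rule maxspec_eq[OF P(1)])
    moreover have "\<Inter>F' \<subseteq> ann T ?L" using ann_killed[of "\<Inter>F'" T] by (auto simp: ann_def)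
    ultimately have "\<Inter>F' \<subseteq> P" by simp
    then obtain P' where P': "P' \<in> F'" "P' \<subseteq> P"
      using prime_Inter[OF pP F'(1)] F'(2) maxspec_prime[OF T] prime_subspace by blast
    then have "P' \<in> maxspec T" using F' by blast
    moreover have "special_over T P" using P by (simp add: maxspec_def)
    ultimately have "P = P'" using maxspec_eq L(4) P'(2) by blast
    with P' F' show False by blast
  qed
  then show ?thesis using F finite_subset by blast
qed

section \<open>The filtration of H by layers\<close>

definition next_layer :: "'h set \<Rightarrow> 'h set" where
  "next_layer T = killed T (\<Inter>(maxspec T))"

definition chains_above :: "nat \<Rightarrow> 'h set \<Rightarrow> bool" where
  "chains_above t T \<longleftrightarrow> (\<forall>P. special_over T P \<longrightarrow> prime_ideal P \<longrightarrow> (\<exists>c. prime_chain t c \<and> c 0 = P))"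

text \<open>Let I be the intersection of \<open>maxspec T\<close>. A prime P special over the next
  layer through N is special over T through I N. It lies properly below a maximal special prime:
  otherwise I would be contained in P, so squares of elements of I would kill N modulo T, hence by
  radicality I would, and N would lie in the next layer.\<close>

lemma chains_above_next:
  assumes T: "closed T" and ch: "chains_above t T"
  shows "chains_above (Suc t) (next_layer T)"
  unfolding chains_above_def
proof (intro allI impI)
  let ?T = "next_layer T"
  let ?I = "\<Inter>(maxspec T)"
  have sT: "subspace T" and stT: "stable T" using T by (auto dest: closedD)
  have clT: "closed ?T" unfolding next_layer_def by (rule killed_closed[OF T])
  fix P assume "special_over ?T P" and pP: "prime_ideal P"
  then obtain N where N: "stable N" "?T \<subseteq> N" "P = ann ?T N" by (auto simp: special_over_def)
  let ?N = "span (T \<union> {c *s h | c h. c \<in> ?I \<and> h \<in> N})"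
  have annN: "ann T ?N = P"
  proof (rule antisym)
    show "ann T ?N \<subseteq> P"
    proof
      fix r assume "r \<in> ann T ?N"
      then have r: "\<And>c h. c \<in> ?I \<Longrightarrow> h \<in> N \<Longrightarrow> (r * c) *s h \<in> T" unfolding ann_mult_span[OF sT] by blast
      have "c *s (X ^^ n) (r *s h) \<in> T" if "c \<in> ?I" "h \<in> N" for c h n
      proof -
        have "r *s (c *s (X ^^ n) h) \<in> T" using r[OF that(1) stable_Xn[OF N(1) that(2)]] by simp
        then have "r ^ (p ^ n) *s (c *s (X ^^ n) h) \<in> T" by (rule scale_pos_power_mem[OF sT]) (use p2 in simp)
        then show ?thesis by (simp add: Xn_scale mult.commute)
      qed
      then show "r \<in> P" unfolding N(3) ann_def next_layer_def killed_def by blast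
    qed
    show "P \<subseteq> ann T ?N"
    proof
      fix r assume "r \<in> P"
      then have "c *s (X ^^ 0) (r *s h) \<in> T" if "c \<in> ?I" "h \<in> N" for c h
        using that unfolding N(3) ann_def next_layer_def killed_def by blast
      then show "r \<in> ann T ?N" unfolding ann_mult_span[OF sT] by (auto simp: mult.commute)
    qed
  qed
  have sp: "special_over T P"
    unfolding annN[symmetric] using span_superset by (intro special_overI stable_mult_span stT N) blast
  have PU: "P \<noteq> UNIV" using prime_one[OF pP] by blast
  obtain Q where Q: "Q \<in> maxspec T" "P \<subseteq> Q" using ex_maxspec[OF sT sp PU] by blast
  have "P \<noteq> Q"
  proof
    assume "P = Q"
    then have IP: "?I \<subseteq> P" using Q by blast
    have "?I \<subseteq> ann T N"
    proof
      fix c assume c: "c \<in> ?I"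
      then have "c \<in> ann T ?N" using IP annN by blast
      then have "(c * c) *s h \<in> T" if "h \<in> N" for h using c that unfolding ann_mult_span[OF sT] by blast
      then have "c ^ 2 \<in> ann T N" by (simp add: power2_eq_square ann_def)
      then show "c \<in> ann T N" by (rule ann_radical[OF T N(1)])
    qed
    then have "N \<subseteq> ?T" unfolding next_layer_def by (rule sub_killed[OF N(1)])
    then show False using ann_UNIV_iff[OF closedD(2)[OF clT]] N(3) PU by blast
  qed
  with Q have "P \<subset> Q" by blast
  have "special_over T Q" using Q by (simp add: maxspec_def)
  then obtain c where c: "prime_chain t c" "c 0 = Q"
    using ch maxspec_prime[OF T Q(1)] unfolding chains_above_def by blast
  from prime_chain_Cons[OF c(1) pP] \<open>P \<subset> Q\<close> c(2)
  show "\<exists>c. prime_chain (Suc t) c \<and> c 0 = P"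
    by (intro exI[of _ "\<lambda>i. case i of 0 \<Rightarrow> P | Suc j \<Rightarrow> c j"]) simp
qed

text \<open>The invariant carried along the layers: one nonzerodivisor e serves all admissible N at
  once, but only on their part inside T.\<close>

definition unif_killed :: "'h set \<Rightarrow> 'h set \<Rightarrow> bool" where
  "unif_killed G T \<longleftrightarrow> (\<exists>e. reg e {0} \<and>
     (\<forall>N. stable N \<longrightarrow> (\<exists>c\<in>ann G N. reg c {0}) \<longrightarrow> (\<forall>h\<in>N \<inter> T. e *s h \<in> G)))"

text \<open>The element e' lies in every maximal special prime that contains a nonzerodivisor. If e'
  h were outside T, the part of T + N killed by the intersection of the remaining primes would have
  its annihilator inside one of these, although c belongs to that annihilator.\<close>

lemma unif_killed_next:
  assumes G: "closed G" and T: "closed T" "G \<subseteq> T" and u: "unif_killed G T"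
  shows "unif_killed G (next_layer T)"
proof -
  have sT: "subspace T" and stT: "stable T" using T by (auto dest: closedD)
  obtain e where e: "reg e {0}"
    "\<And>N h. stable N \<Longrightarrow> \<exists>c\<in>ann G N. reg c {0} \<Longrightarrow> h \<in> N \<Longrightarrow> h \<in> T \<Longrightarrow> e *s h \<in> G"
    using u unfolding unif_killed_def by blast
  define A where "A = {P \<in> maxspec T. \<exists>c\<in>P. reg c {0}}"
  have "\<forall>P\<in>A. \<exists>c. c \<in> P \<and> reg c {0}" by (auto simp: A_def)
  then obtain f where f: "\<And>P. P \<in> A \<Longrightarrow> f P \<in> P \<and> reg (f P) {0}" by metis
  define e' where "e' = prod f A"
  have fA: "finite A" using finite_maxspec[OF T(1)] by (simp add: A_def)
  have re': "reg e' {0}" unfolding e'_def by (rule reg_prod) (use f in blast)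
  have sub: "R.subspace P" if "P \<in> maxspec T" for P
    using maxspec_prime[OF T(1) that] by (rule prime_subspace)
  have e'P: "e' \<in> P" if "P \<in> A" for P
  proof -
    have "e' = f P * prod f (A - {P})" unfolding e'_def using that fA by (rule prod.remove[rotated])
    moreover have "P \<in> maxspec T" using that by (simp add: A_def)
    ultimately show ?thesis using f[OF that] subspace_mult_right[OF sub] by simp
  qed
  let ?J = "maxspec T - A"
  have "(e * e') *s h \<in> G" if N: "stable N" "\<exists>c\<in>ann G N. reg c {0}" and h: "h \<in> N" "h \<in> next_layer T" for N h
  proof -
    obtain c where c: "c \<in> ann G N" "reg c {0}" using N by blast
    have "e' *s h \<in> T"
    proof (rule ccontr)
      assume nT: "e' *s h \<notin> T"
      \<comment> \<open>With scalars ranging over all of R, this is T + N.\<close>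
      let ?M = "span (T \<union> {c *s h | c h. c \<in> UNIV \<and> h \<in> N})"
      let ?L = "?M \<inter> killed T (\<Inter>?J)"
      have TM: "T \<subseteq> ?M" using span_superset by blast
      have clk: "closed (killed T (\<Inter>?J))" by (rule killed_closed[OF T(1)])
      have "e' *s h \<in> killed T (\<Inter>?J)"
        unfolding killed_def
      proof (intro CollectI ballI allI)
        fix d n assume d: "d \<in> \<Inter>?J"
        have "e' * d \<in> P" if "P \<in> maxspec T" for P
        proof (cases "P \<in> A")
          case True
          then show ?thesis using e'P subspace_mult_right[OF sub[OF that]] by blast
        next
          case False
          then show ?thesis using d that R.subspace_scale[OF sub[OF that]] by blast
        qed
        then have "e' * d \<in> \<Inter>(maxspec T)" by blast
        then have "(e' * d) *s (X ^^ n) h \<in> T" using h(2) unfolding next_layer_def killed_def by blast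
        then have "e' *s (d *s (X ^^ n) h) \<in> T" by simp
        then have "e' ^ (p ^ n) *s (d *s (X ^^ n) h) \<in> T" by (rule scale_pos_power_mem[OF sT]) (use p2 in simp)
        then show "d *s (X ^^ n) (e' *s h) \<in> T" by (simp add: Xn_scale mult.commute)
      qed
      moreover have "e' *s h \<in> ?M" using h by (intro span_base) blast
      ultimately have "\<not> ?L \<subseteq> T" using nT by blast
      then have "ann T ?L \<noteq> UNIV" using ann_UNIV_iff[OF sT, of ?L] by (simp only: not_False_eq_True)
      moreover have "special_over T (ann T ?L)"
        using TM killed_superset[OF stT] clk
        by (intro special_overI stable_Int stable_mult_span stT N) (auto dest: closedD)
      ultimately obtain P where P: "P \<in> maxspec T" "ann T ?L \<subseteq> P" using ex_maxspec[OF sT] by blast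
      have pP: "prime_ideal P" by (rule maxspec_prime[OF T(1) P(1)])
      have "\<Inter>?J \<subseteq> ann T ?L" using ann_killed[of "\<Inter>?J" T] by (auto simp: ann_def)
      then have "\<exists>P'\<in>?J. P' \<subseteq> P"
        using P(2) finite_maxspec[OF T(1)] sub by (intro prime_Inter[OF pP]) auto
      then obtain P' where P': "P' \<in> maxspec T" "P' \<notin> A" "P' \<subseteq> P" by blast
      have "P = P'"
        using maxspec_eq[OF P'(1) _ _ P'(3)] P(1) by (auto simp: maxspec_def)
      have "?M \<subseteq> {h. c *s h \<in> T}"
      proof (rule span_minimal)
        show "subspace {h. c *s h \<in> T}"
          using sT subspace_scale[OF sT]
          by (auto simp: subspace_def scale_right_distrib scale_left_commute simp del: scale_scale)
        have "c *s (a *s h) \<in> T" if "h \<in> N" for a h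
        proof -
          have "c *s h \<in> T" using c(1) that T(2) unfolding ann_def by blast
          then have "a *s (c *s h) \<in> T" by (rule subspace_scale[OF sT])
          then show ?thesis by (simp only: scale_left_commute)
        qed
        then show "T \<union> {c *s h |c h. c \<in> UNIV \<and> h \<in> N} \<subseteq> {h. c *s h \<in> T}"
          using subspace_scale[OF sT] by (auto simp del: scale_scale)
      qed
      then have "c \<in> ann T ?L" by (auto simp: ann_def)
      with P c(2) \<open>P = P'\<close> P' show False by (auto simp: A_def)
    qed
    moreover have "e' *s h \<in> N" using h(1) subspace_scale[OF stableD(1)[OF N(1)]] by blast
    ultimately show ?thesis using e(2)[OF N, of "e' *s h"] by simp
  qed
  moreover have "reg (e * e') {0}" by (rule reg_mult[OF e(1) re'])
  ultimately show ?thesis unfolding unif_killed_def by (intro exI[of _ "e * e'"]) blast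
qed

text \<open>After d + 1 layers each special prime over T would start a chain of length d + 1. So
  there is none, and T is everything.\<close>

theorem common_regular_annihilator:
  assumes G: "closed G" and d: "\<And>n c. prime_chain n (c :: nat \<Rightarrow> 'a set) \<Longrightarrow> n \<le> d"
  shows "\<exists>e. reg e {0} \<and> (\<forall>N. stable N \<longrightarrow> (\<exists>c\<in>ann G N. reg c {0}) \<longrightarrow> e \<in> ann G N)"
proof -
  have "\<exists>T. closed T \<and> G \<subseteq> T \<and> unif_killed G T \<and> chains_above t T" for t
  proof (induction t)
    case 0
    have "unif_killed G G"
      unfolding unif_killed_def by (intro exI[of _ 1]) (auto simp: reg_one)
    moreover have "chains_above 0 G"
      unfolding chains_above_def using prime_chain_0 by blast
    ultimately show ?case using G by blast
  next
    case (Suc t)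
    then obtain T where T: "closed T" "G \<subseteq> T" "unif_killed G T" "chains_above t T" by blast
    have "closed (next_layer T)" unfolding next_layer_def by (rule killed_closed[OF T(1)])
    moreover have "G \<subseteq> next_layer T"
      using T(2) killed_superset[OF closedD(1)[OF T(1)]] unfolding next_layer_def by blast
    ultimately show ?case using unif_killed_next[OF G T(1-3)] chains_above_next[OF T(1,4)] by blast
  qed
  then obtain T where T: "closed T" "unif_killed G T" "chains_above (Suc d) T" by blast
  have "T = UNIV"
  proof (rule ccontr)
    assume "T \<noteq> UNIV"
    have sT: "subspace T" using T by (auto dest: closedD)
    have "special_over T (ann T UNIV)" by (intro special_overI) (auto simp: stable_def)
    moreover have "ann T UNIV \<noteq> UNIV" using ann_UNIV_iff[OF sT, of UNIV] \<open>T \<noteq> UNIV\<close> by blast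
    ultimately obtain P where P: "P \<in> maxspec T" using ex_maxspec[OF sT] by blast
    then have "special_over T P" by (simp add: maxspec_def)
    then obtain c :: "nat \<Rightarrow> 'a set" where "prime_chain (Suc d) c"
      using T(3) maxspec_prime[OF T(1) P] unfolding chains_above_def by blast
    with d[of "Suc d" c] show False by simp
  qed
  then show ?thesis using T(2) unfolding unif_killed_def ann_def by auto
qed

end

section \<open>Systems of parameters and Frobenius\<close>

locale cm_local_char = cm_local_ring m d for m :: "'a::comm_ring_1 set" and d +
  fixes p :: nat
  assumes prime_p: "prime p" and char_p: "CHAR('a) = p"
begin

declare ring_module.scale_scale [simp del]

lemma frob_add: "((x :: 'a) + y) ^ (p ^ n) = x ^ (p ^ n) + y ^ (p ^ n)"
  using freshmans_dream'[where 'a = 'a] prime_p char_p by simp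

lemma frob_pos: "0 < p ^ n"
  using prime_p by (simp add: prime_gt_0_nat)

lemma frob_minus: "(- (x :: 'a)) ^ (p ^ n) = - (x ^ (p ^ n))"
proof -
  have "(- x + x) ^ (p ^ n) = (- x) ^ (p ^ n) + x ^ (p ^ n)" by (rule frob_add)
  then show ?thesis using zero_power[OF frob_pos[of n], where 'a = 'a] by (simp add: eq_neg_iff_add_eq_0)
qed

lemma frob_diff: "((x :: 'a) - y) ^ (p ^ n) = x ^ (p ^ n) - y ^ (p ^ n)"
  using frob_add[of x "- y" n] by (simp add: frob_minus)

lemma frob_preimage:
  assumes "R.subspace I"
  shows "R.subspace {r :: 'a. r ^ (p ^ n) \<in> I}"
  unfolding R.subspace_def
proof (intro conjI ballI allI CollectI)
  show "0 ^ (p ^ n) \<in> I" using zero_power[OF frob_pos[of n], where 'a = 'a] R.subspace_0[OF assms] by simp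
  show "(x + y) ^ (p ^ n) \<in> I" if "x \<in> {r. r ^ (p ^ n) \<in> I}" "y \<in> {r. r ^ (p ^ n) \<in> I}" for x y
    using that by (simp add: frob_add R.subspace_add[OF assms])
  show "(c * x) ^ (p ^ n) \<in> I" if "x \<in> {r. r ^ (p ^ n) \<in> I}" for c x
    using that by (simp add: power_mult_distrib R.subspace_scale[OF assms])
qed

lemma frob_span: "(x :: 'a) \<in> R.span S \<Longrightarrow> x ^ (p ^ n) \<in> R.span ((\<lambda>x. x ^ (p ^ n)) ` S)"
proof -
  have "S \<subseteq> {r. r ^ (p ^ n) \<in> R.span ((\<lambda>x. x ^ (p ^ n)) ` S)}" by (auto intro: R.span_base)
  then have "R.span S \<subseteq> {r. r ^ (p ^ n) \<in> R.span ((\<lambda>x. x ^ (p ^ n)) ` S)}"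
    by (intro R.span_minimal frob_preimage R.subspace_span)
  then show "x \<in> R.span S \<Longrightarrow> x ^ (p ^ n) \<in> R.span ((\<lambda>x. x ^ (p ^ n)) ` S)" by blast
qed

lemma frob_pow_span: "frob_pow (R.span S) (p ^ n) = R.span ((\<lambda>x :: 'a. x ^ (p ^ n)) ` S)"
  unfolding frob_pow_def ideal_gen_span
proof (rule antisym)
  show "R.span {r ^ (p ^ n) | r. r \<in> R.span S} \<subseteq> R.span ((\<lambda>x. x ^ (p ^ n)) ` S)"
    using frob_span by (intro R.span_minimal) auto
  show "R.span ((\<lambda>x. x ^ (p ^ n)) ` S) \<subseteq> R.span {r ^ (p ^ n) | r. r \<in> R.span S}"
    by (intro R.span_mono) (auto intro: R.span_base)
qed

lemma sop_cong: "sop m d xs \<Longrightarrow> length ys = length xs \<Longrightarrow> set ys = set xs \<Longrightarrow> sop m d ys"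
  by (simp add: sop_def)

lemma sop_reg: "sop m d (x # L) \<Longrightarrow> reg x (R.span (set L))"
  using sop_regs[OF sop_cong[of "x # L" "L @ [x]"]] by (simp add: regs_append)

section \<open>Comparison of systems of parameters\<close>

definition is_power :: "'a \<Rightarrow> 'a \<Rightarrow> bool" where
  "is_power y x \<longleftrightarrow> (\<exists>e\<ge>1. y = x ^ e)"

lemma is_powerI: "1 \<le> e \<Longrightarrow> is_power (x ^ e) x"
  by (auto simp: is_power_def)

lemma is_power_refl: "is_power x x"
  using is_powerI[of 1 x] by simp

lemma sop_powers:
  assumes L: "sop m d L" and pw: "list_all2 is_power L' L"
  shows "sop m d L'"
proof (rule sop_primeI)
  have len: "length L' = length L" and el: "\<And>i. i < length L \<Longrightarrow> is_power (L' ! i) (L ! i)"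
    using pw by (auto simp: list_all2_conv_all_nth)
  show "length L' = d" using len L by (simp add: sop_def)
  show "set L' \<subseteq> m"
  proof
    fix y assume "y \<in> set L'"
    then obtain i where i: "i < length L" "y = L' ! i" using len by (auto simp: in_set_conv_nth)
    then obtain e where e: "1 \<le> e" "y = (L ! i) ^ e" using el by (auto simp: is_power_def)
    then have "y = (L ! i) ^ (e - 1) * L ! i" by (metis One_nat_def Suc_pred less_eq_Suc_le power_Suc2)
    moreover have "L ! i \<in> m" using L i by (auto simp: sop_def)
    ultimately show "y \<in> m" using R.subspace_scale[OF m_subspace] by simp
  qed
  fix P assume P: "prime_ideal P" "set L' \<subseteq> P"
  have "set L \<subseteq> P"
  proof
    fix x assume "x \<in> set L"
    then obtain i where i: "i < length L" "x = L ! i" by (auto simp: in_set_conv_nth)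
    then obtain e where "L' ! i = x ^ e" using el by (auto simp: is_power_def)
    moreover have "L' ! i \<in> P" using P(2) i len nth_mem[of i L'] by (metis subsetD)
    ultimately show "x \<in> P" using prime_ideal_power[OF P(1)] by simp
  qed
  then show "P = m" by (rule sop_prime[OF L P(1)])
qed

lemma powers_map: "1 \<le> e \<Longrightarrow> list_all2 is_power (map (\<lambda>x. x ^ e) L) L"
  by (auto simp: list_all2_conv_all_nth intro!: is_powerI)

text \<open>Embeddings of \<open>R/(S)\<^bsup>[q]\<^esup>\<close> into \<open>R/(T)\<^bsup>[q]\<^esup>\<close> that are compatible with Frobenius.  Chains of them
  replace the independence of local cohomology of the choice of the system of parameters.\<close>

definition emb :: "'a set \<Rightarrow> 'a set \<Rightarrow> bool" where
  "emb S T \<longleftrightarrow> (\<exists>u. \<forall>n z. z \<in> R.span ((\<lambda>x. x ^ (p ^ n)) ` S) \<longleftrightarrow>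
     u ^ (p ^ n) * z \<in> R.span ((\<lambda>x. x ^ (p ^ n)) ` T))"

lemma emb_refl: "emb S S"
  unfolding emb_def by (rule exI[of _ 1]) simp

lemma emb_trans:
  assumes "emb S T" "emb T V"
  shows "emb S V"
proof -
  obtain u where u: "\<And>n z. z \<in> R.span ((\<lambda>x. x ^ (p ^ n)) ` S) \<longleftrightarrow> u ^ (p ^ n) * z \<in> R.span ((\<lambda>x. x ^ (p ^ n)) ` T)"
    using assms(1) unfolding emb_def by blast
  obtain v where v: "\<And>n z. z \<in> R.span ((\<lambda>x. x ^ (p ^ n)) ` T) \<longleftrightarrow> v ^ (p ^ n) * z \<in> R.span ((\<lambda>x. x ^ (p ^ n)) ` V)"
    using assms(2) unfolding emb_def by blast
  have "z \<in> R.span ((\<lambda>x. x ^ (p ^ n)) ` S) \<longleftrightarrow> (v * u) ^ (p ^ n) * z \<in> R.span ((\<lambda>x. x ^ (p ^ n)) ` V)" for n z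
    unfolding u[of z n] v[of "u ^ (p ^ n) * z" n] power_mult_distrib mult.assoc ..
  then show ?thesis unfolding emb_def by blast
qed

text \<open>Multiplication by e works because v = e * y modulo the ideal of L. For injectivity: if
  e^q t lies in \<open>J\<close>, then so does y^q e^q t, hence v^q t, and v^q is regular on
  \<open>J\<close>.\<close>

lemma emb_step:
  assumes y: "sop m d (y # L)" and v: "sop m d (v # L)" and e: "v - e * y \<in> R.span (set L)"
  shows "emb (insert y (set L)) (insert v (set L))"
  unfolding emb_def
proof (intro exI[of _ e] allI)
  fix n z
  define q where "q = p ^ n"
  define J where "J = R.span ((\<lambda>x. x ^ q) ` set L)"
  have q: "1 \<le> q" unfolding q_def using frob_pos[of n] by linarith
  have J: "R.subspace J" by (simp add: J_def)
  have vq: "reg (v ^ q) J"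
  proof -
    have "list_all2 is_power (map (\<lambda>x. x ^ q) (v # L)) (v # L)" by (rule powers_map[OF q])
    from sop_reg[OF sop_powers[OF v this, simplified]] show ?thesis by (simp add: J_def)
  qed
  have j: "v ^ q - e ^ q * y ^ q \<in> J"
    using frob_span[OF e, of n] by (simp add: frob_diff power_mult_distrib q_def J_def)
  have "z \<in> R.span (insert (y ^ q) J) \<longleftrightarrow> e ^ q * z \<in> R.span (insert (v ^ q) J)"
  proof
    assume "z \<in> R.span (insert (y ^ q) J)"
    then obtain a where "z - a * y ^ q \<in> J" using mem_span_insert[OF J] by blast
    then have "e ^ q * (z - a * y ^ q) - a * (v ^ q - e ^ q * y ^ q) \<in> J"
      using j J R.subspace_scale R.subspace_diff by blast
    then have "e ^ q * z - a * v ^ q \<in> J" by (simp add: algebra_simps)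
    then show "e ^ q * z \<in> R.span (insert (v ^ q) J)" using mem_span_insert[OF J] by blast
  next
    assume "e ^ q * z \<in> R.span (insert (v ^ q) J)"
    then obtain a where a: "e ^ q * z - a * v ^ q \<in> J" using mem_span_insert[OF J] by blast
    define t where "t = z - a * y ^ q"
    have "(e ^ q * z - a * v ^ q) + a * (v ^ q - e ^ q * y ^ q) \<in> J"
      using a j J R.subspace_scale R.subspace_add by blast
    then have "e ^ q * t \<in> J" by (simp add: algebra_simps t_def)
    then have "y ^ q * (e ^ q * t) + t * (v ^ q - e ^ q * y ^ q) \<in> J"
      using j J R.subspace_scale R.subspace_add by blast
    then have "v ^ q * t \<in> J" by (simp add: algebra_simps)
    then have "t \<in> J" using vq by (simp add: reg_def)
    then show "z \<in> R.span (insert (y ^ q) J)" using mem_span_insert[OF J] by (auto simp: t_def)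
  qed
  then show "z \<in> R.span ((\<lambda>x. x ^ (p ^ n)) ` insert y (set L)) \<longleftrightarrow>
      e ^ (p ^ n) * z \<in> R.span ((\<lambda>x. x ^ (p ^ n)) ` insert v (set L))"
    by (simp add: q_def J_def span_insert_span)
qed

text \<open>Entries x^e are replaced by x^j one at a time, with multiplier x^(j - e).\<close>

lemma emb_powers:
  assumes "list_all2 (\<lambda>y x. \<exists>e\<ge>1. e \<le> j \<and> y = x ^ e) A' A" "sop m d (A' @ B)"
  shows "emb (set (A' @ B)) ((\<lambda>x. x ^ j) ` set A \<union> set B)"
  using assms
proof (induction A' A arbitrary: B rule: list_all2_induct)
  case Nil
  then show ?case by (simp add: emb_refl)
next
  case (Cons y A' x A)
  then obtain e where e: "1 \<le> e" "e \<le> j" "y = x ^ e" by auto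
  define L where "L = A' @ B"
  have y: "sop m d (y # L)" using Cons.prems by (simp add: L_def)
  have v: "sop m d (x ^ j # L)"
  proof (rule sop_primeI)
    show "length (x ^ j # L) = d" using y by (simp add: sop_def)
    have "x ^ j = x ^ (j - e) * y" using e by (simp flip: power_add)
    moreover have ym: "y \<in> m" "set L \<subseteq> m" using y by (auto simp: sop_def)
    ultimately show "set (x ^ j # L) \<subseteq> m" using R.subspace_scale[OF m_subspace] by simp
    fix P assume P: "prime_ideal P" "set (x ^ j # L) \<subseteq> P"
    then have "x \<in> P" using prime_ideal_power[OF P(1), of x j] by simp
    moreover have "y = x ^ (e - 1) * x" using e by (metis One_nat_def Suc_pred less_eq_Suc_le power_Suc2)
    ultimately have "y \<in> P" using R.subspace_scale[OF prime_subspace[OF P(1)]] by simp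
    then show "P = m" using P by (intro sop_prime[OF y P(1)]) simp
  qed
  have "x ^ j - x ^ (j - e) * y = 0" using e by (simp flip: power_add)
  then have "emb (insert y (set L)) (insert (x ^ j) (set L))"
    using R.span_zero by (intro emb_step[OF y v, of "x ^ (j - e)"]) simp
  moreover have "sop m d (A' @ x ^ j # B)" by (rule sop_cong[OF v]) (auto simp: L_def)
  from Cons.IH[OF this] have "emb (insert (x ^ j) (set L)) ((\<lambda>x. x ^ j) ` set (x # A) \<union> set B)"
    by (simp add: L_def)
  ultimately show ?case using emb_trans[of "insert y (set L)"] by (simp add: L_def)
qed

text \<open>Choose w in \<open>m\<close> regular modulo A and modulo B simultaneously; regular
  sequences of length d are systems of parameters.\<close>

lemma sop_common_element:
  assumes "sop m d (x # A)" "sop m d (y # B)"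
  shows "\<exists>w. sop m d (w # A) \<and> sop m d (w # B)"
proof -
  have "\<exists>w\<in>m. \<forall>J\<in>{R.span (set A), R.span (set B)}. reg w J"
    using assms sop_reg[OF assms(1)] sop_reg[OF assms(2)]
    by (intro common_reg m_subspace) (auto simp: sop_def)
  then obtain w where w: "w \<in> m" "reg w (R.span (set A))" "reg w (R.span (set B))" by auto
  have *: "sop m d (w # C)" if C: "sop m d (z # C)" "reg w (R.span (set C))" for z C
  proof -
    have "regs {0} (C @ [z])" by (rule sop_regs[OF sop_cong[OF C(1)]]) auto
    then have "regs {0} (C @ [w])" using C(2) by (simp add: regs_append)
    then have "sop m d (C @ [w])" using C(1) w(1) by (intro regs_sop) (auto simp: sop_def)
    then show ?thesis by (rule sop_cong) auto
  qed
  show ?thesis using *[OF assms(1) w(2)] *[OF assms(2) w(3)] by blast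
qed

context
  fixes as :: "'a list"
begin

text \<open>All lists of powers of L are included because \<open>good_exchange\<close> has to raise
  the exchanged element to a power lying in the ideal of the current list.\<close>

definition good :: "'a list \<Rightarrow> bool" where
  "good L \<longleftrightarrow> (\<forall>L'. list_all2 is_power L' L \<longrightarrow> (\<exists>j\<ge>1. emb (set L') ((\<lambda>x. x ^ j) ` set as)))"

lemma good_self: "sop m d as \<Longrightarrow> good as"
  unfolding good_def
proof (intro allI impI)
  fix L' assume as: "sop m d as" and pw: "list_all2 is_power L' as"
  then have "\<forall>i<length as. \<exists>e\<ge>1. L' ! i = (as ! i) ^ e"
    by (auto simp: list_all2_conv_all_nth is_power_def)
  then obtain e where e: "\<And>i. i < length as \<Longrightarrow> 1 \<le> e i \<and> L' ! i = (as ! i) ^ e i" by metis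
  define j where "j = Suc (sum e {..<length as})"
  have ej: "e i \<le> j" if "i < length as" for i
    unfolding j_def using that member_le_sum[of i "{..<length as}" e] by simp
  have "list_all2 (\<lambda>y x. \<exists>e\<ge>1. e \<le> j \<and> y = x ^ e) L' as"
    unfolding list_all2_conv_all_nth using pw e ej by (auto simp: list_all2_lengthD)
  from emb_powers[OF this, of "[]"] sop_powers[OF as pw]
  show "\<exists>j\<ge>1. emb (set L') ((\<lambda>x. x ^ j) ` set as)" by (intro exI[of _ j]) (simp add: j_def)
qed

lemma good_rotate:
  assumes "good (x # A @ B)"
  shows "good (A @ x # B)"
  unfolding good_def
proof (intro allI impI)
  fix L' assume "list_all2 is_power L' (A @ x # B)"
  then obtain A' x' B' where L': "L' = A' @ x' # B'" "list_all2 is_power A' A" "is_power x' x"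
    "list_all2 is_power B' B" by (auto simp: list_all2_append2 list_all2_Cons2)
  then have "list_all2 is_power (x' # A' @ B') (x # A @ B)"
    by (auto intro: list_all2_appendI)
  with assms have "\<exists>j\<ge>1. emb (set (x' # A' @ B')) ((\<lambda>x. x ^ j) ` set as)"
    unfolding good_def by blast
  then show "\<exists>j\<ge>1. emb (set L') ((\<lambda>x. x ^ j) ` set as)" using L' by simp
qed

lemma good_unrotate:
  assumes "good (A @ x # B)"
  shows "good (x # A @ B)"
  unfolding good_def
proof (intro allI impI)
  fix L' assume "list_all2 is_power L' (x # A @ B)"
  then obtain A' x' B' where L': "L' = x' # A' @ B'" "list_all2 is_power A' A" "is_power x' x"
    "list_all2 is_power B' B" by (auto simp: list_all2_append2 list_all2_Cons2)
  then have "list_all2 is_power (A' @ x' # B') (A @ x # B)"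
    by (auto intro: list_all2_appendI)
  with assms have "\<exists>j\<ge>1. emb (set (A' @ x' # B')) ((\<lambda>x. x ^ j) ` set as)"
    unfolding good_def by blast
  then show "\<exists>j\<ge>1. emb (set L') ((\<lambda>x. x ^ j) ` set as)" using L' by simp
qed

lemma good_exchange:
  assumes y: "sop m d (y # L)" and w: "sop m d (w # L)" and g: "good (w # L)"
  shows "good (y # L)"
  unfolding good_def
proof (intro allI impI)
  fix L'' assume "list_all2 is_power L'' (y # L)"
  then obtain y' L' where L': "L'' = y' # L'" "is_power y' y" "list_all2 is_power L' L"
    by (auto simp: list_all2_Cons2)
  have y': "sop m d (y' # L')" by (rule sop_powers[OF y]) (simp add: L')
  have "w \<in> m" using w by (simp add: sop_def)
  then obtain k where k: "w ^ k \<in> R.span (set (y' # L'))"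
    using y' by (auto simp: sop_def radical_def ideal_simps)
  define N where "N = Suc k"
  have "w ^ N \<in> R.span (insert y' (R.span (set L')))"
    using R.span_scale[OF k, of w] by (simp add: N_def span_insert_span)
  then obtain e where e: "w ^ N - e * y' \<in> R.span (set L')"
    using mem_span_insert[OF R.subspace_span] by blast
  have pw: "list_all2 is_power (w ^ N # L') (w # L)" using L' is_powerI[of N w] by (simp add: N_def)
  have "emb (insert y' (set L')) (insert (w ^ N) (set L'))"
    by (rule emb_step[OF y' sop_powers[OF w pw] e])
  moreover obtain j where "1 \<le> j" "emb (set (w ^ N # L')) ((\<lambda>x. x ^ j) ` set as)"
    using g pw unfolding good_def by blast
  ultimately show "\<exists>j\<ge>1. emb (set L'') ((\<lambda>x. x ^ j) ` set as)"
    using emb_trans[of "insert y' (set L')"] L'(1) by auto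
qed

text \<open>Exchange entry by entry: a common element w takes the place of b, is moved to the tail
  shared by both lists, and later gives way to x.\<close>

lemma good_transfer:
  assumes "length xs = length bs" "sop m d (xs @ ws)" "sop m d (bs @ ws)" "good (bs @ ws)"
  shows "good (xs @ ws)"
  using assms
proof (induction xs bs arbitrary: ws rule: list_induct2)
  case Nil
  then show ?case by simp
next
  case (Cons x xs b bs)
  have x: "sop m d (x # xs @ ws)" and b: "sop m d (b # bs @ ws)" using Cons.prems by simp_all
  obtain w where w: "sop m d (w # xs @ ws)" "sop m d (w # bs @ ws)"
    using sop_common_element[OF x b] by blast
  have "good (w # bs @ ws)" by (rule good_exchange[OF w(2) b]) (use Cons.prems in simp)
  then have "good (bs @ w # ws)" by (rule good_rotate)
  then have "good (xs @ w # ws)"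
    by (intro Cons.IH) (auto intro: sop_cong[OF w(1)] sop_cong[OF w(2)])
  then have "good (w # xs @ ws)" by (rule good_unrotate)
  then show ?case using good_exchange[OF x w(1)] by simp
qed

end

lemma sop_emb:
  assumes "sop m d as" "sop m d xs"
  shows "\<exists>j\<ge>1. emb (set xs) ((\<lambda>x. x ^ j) ` set as)"
proof -
  have "good as (xs @ [])"
    by (rule good_transfer[of _ as]) (use assms good_self in \<open>auto simp: sop_def\<close>)
  moreover have "list_all2 is_power xs xs" by (simp add: list_all2_conv_all_nth is_power_refl)
  ultimately show ?thesis unfolding good_def by simp
qed

text \<open>An ideal over S that contains a power of every element of \<open>m\<close> contains all
  y^(N + 1) for large N; so Krull's intersection theorem removes the additional parameters.\<close>

lemma parameter_limit:
  fixes z :: 'a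
  assumes ys: "set ys \<subseteq> m" and z: "\<And>N. z \<in> R.span (S \<union> (\<lambda>y. y ^ Suc N) ` set ys)"
  shows "z \<in> R.span S"
proof (rule krull_intersection[OF noeth local R.subspace_span])
  fix I assume I: "R.subspace I" "R.span S \<subseteq> I" "\<And>y. y \<in> m \<Longrightarrow> \<exists>n. y ^ n \<in> I"
  then have "\<forall>y\<in>set ys. \<exists>n. y ^ n \<in> I" using ys by blast
  then obtain f where f: "\<And>y. y \<in> set ys \<Longrightarrow> y ^ f y \<in> I" by metis
  define N where "N = sum f (set ys)"
  have "y ^ Suc N \<in> I" if "y \<in> set ys" for y
  proof -
    have "f y \<le> Suc N" unfolding N_def using that by (intro le_SucI member_le_sum) auto
    then have "y ^ Suc N = y ^ (Suc N - f y) * y ^ f y" by (simp only: power_add[symmetric] le_add_diff_inverse2)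
    then show ?thesis using f[OF that] R.subspace_scale[OF I(1)] by simp
  qed
  then have "R.span (S \<union> (\<lambda>y. y ^ Suc N) ` set ys) \<subseteq> I"
    using I R.span_superset[of S] by (intro R.span_minimal) (auto simp del: power_Suc)
  with z show "z \<in> I" by blast
qed

lemma cancel_power:
  assumes x: "reg x J" and J: "R.subspace J"
  shows "x ^ k * z \<in> R.span (insert (x ^ (j + k)) J) \<longleftrightarrow> z \<in> R.span (insert (x ^ j) J)"
proof
  assume "x ^ k * z \<in> R.span (insert (x ^ (j + k)) J)"
  then obtain a where "x ^ k * z - a * x ^ (j + k) \<in> J" using mem_span_insert[OF J] by blast
  then have "(z - a * x ^ j) * x ^ k \<in> J" by (simp add: algebra_simps power_add)
  then have "z - a * x ^ j \<in> J" by (rule reg_power[OF x])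
  then show "z \<in> R.span (insert (x ^ j) J)" using mem_span_insert[OF J] by blast
next
  assume "z \<in> R.span (insert (x ^ j) J)"
  then obtain a where "z - a * x ^ j \<in> J" using mem_span_insert[OF J] by blast
  then have "x ^ k * (z - a * x ^ j) \<in> J" by (rule R.subspace_scale[OF J])
  then have "x ^ k * z - a * x ^ (j + k) \<in> J" by (simp add: algebra_simps power_add)
  then show "x ^ k * z \<in> R.span (insert (x ^ (j + k)) J)" using mem_span_insert[OF J] by blast
qed

text \<open>Injectivity of the transition maps in the direct system defining H. Each x is cancelled
  modulo the remaining entries, which are parameters together with it.\<close>

lemma cancel_prodpow:
  assumes "sop m d (A @ B)" "1 \<le> j"
  shows "prodpow A k * z \<in> R.span ((\<lambda>x. x ^ (j + k)) ` set A \<union> set B) \<longleftrightarrow>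
    z \<in> R.span ((\<lambda>x. x ^ j) ` set A \<union> set B)"
  using assms(1)
proof (induction A arbitrary: B z)
  case Nil
  then show ?case by (simp add: prodpow_def)
next
  case (Cons x A)
  have *: "list_all2 is_power ((A @ [x ^ (j + k)]) @ B) ((A @ [x]) @ B)"
    using assms(2) by (intro list_all2_appendI)
      (auto simp: list_all2_conv_all_nth is_power_refl intro!: is_powerI)
  have s: "sop m d ((A @ [x]) @ B)" by (rule sop_cong[OF Cons.prems]) auto
  have "sop m d (A @ x ^ (j + k) # B)" using sop_powers[OF s *] by simp
  from Cons.IH[OF this, of "x ^ k * z"]
  have "prodpow A k * (x ^ k * z) \<in> R.span ((\<lambda>x. x ^ (j + k)) ` set A \<union> set (x ^ (j + k) # B)) \<longleftrightarrow>
    x ^ k * z \<in> R.span ((\<lambda>x. x ^ j) ` set A \<union> set (x ^ (j + k) # B))" .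
  moreover have "x ^ k * z \<in> R.span ((\<lambda>x. x ^ j) ` set A \<union> set (x ^ (j + k) # B)) \<longleftrightarrow>
    z \<in> R.span ((\<lambda>x. x ^ j) ` set A \<union> set (x ^ j # B))"
  proof -
    have "list_all2 is_power (x # map (\<lambda>x. x ^ j) A @ B) (x # A @ B)"
      using assms(2) by (auto intro!: list_all2_appendI powers_map simp: is_power_refl)
        (simp add: list_all2_conv_all_nth is_power_refl)
    then have "sop m d (x # map (\<lambda>x. x ^ j) A @ B)" using sop_powers Cons.prems by auto
    from cancel_power[OF sop_reg[OF this] R.subspace_span, of k z j]
    show ?thesis by (simp add: span_insert_span)
  qed
  moreover have "prodpow (x # A) k * z = prodpow A k * (x ^ k * z)" by (simp add: prodpow_def mult_ac)
  moreover have "(\<lambda>x. x ^ i) ` set (x # A) \<union> set B = (\<lambda>x. x ^ i) ` set A \<union> set (x ^ i # B)" for i by simp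
  ultimately show ?case by (simp only:)
qed

text \<open>The monomial formula (x_i^N) : (x_i) = (x_i^N, prod x_i^(N - 1)) for parameters,
  relative to B. It makes the part of H killed by all parameters cyclic.\<close>

lemma colon_prodpow:
  assumes "sop m d (A @ B)" "1 \<le> N" "\<And>a. a \<in> set A \<Longrightarrow> a * s \<in> R.span ((\<lambda>x. x ^ N) ` set A \<union> set B)"
  shows "\<exists>t. s - prodpow A (N - 1) * t \<in> R.span ((\<lambda>x. x ^ N) ` set A \<union> set B)"
  using assms(1,3)
proof (induction A arbitrary: B)
  case Nil
  then show ?case by (intro exI[of _ s]) (simp add: prodpow_def R.span_zero)
next
  case (Cons x A)
  have *: "list_all2 is_power ((A @ [x ^ N]) @ B) ((A @ [x]) @ B)"
    using assms(2) by (intro list_all2_appendI)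
      (auto simp: list_all2_conv_all_nth is_power_refl intro!: is_powerI)
  have sx: "sop m d ((A @ [x]) @ B)" by (rule sop_cong[OF Cons.prems(1)]) auto
  have sN: "sop m d (A @ x ^ N # B)" using sop_powers[OF sx *] by simp
  let ?I = "R.span ((\<lambda>x. x ^ N) ` set A \<union> set (x ^ N # B))"
  have I: "?I = R.span ((\<lambda>x. x ^ N) ` set (x # A) \<union> set B)" by simp
  obtain t where t: "s - prodpow A (N - 1) * t \<in> ?I"
    using Cons.IH[OF sN] Cons.prems(2) unfolding I by auto
  have "x * s - x * (s - prodpow A (N - 1) * t) \<in> ?I"
    using Cons.prems(2)[of x] unfolding I
    by (intro R.span_diff R.span_scale[OF t[unfolded I]]) simp
  then have "prodpow A (N - 1) * (x * t) \<in> ?I" by (simp add: algebra_simps)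
  moreover have N1: "1 + (N - 1) = N" using assms(2) by simp
  ultimately have "x * t \<in> R.span ((\<lambda>x. x ^ 1) ` set A \<union> set (x ^ N # B))"
    using cancel_prodpow[OF sN, of 1 "N - 1" "x * t"] unfolding N1 by simp
  then have "x * t \<in> R.span (insert (x ^ N) (R.span (set (A @ B))))"
    by (simp add: span_insert_span)
  then obtain c where "x * t - c * x ^ N \<in> R.span (set (A @ B))"
    using mem_span_insert[OF R.subspace_span] by blast
  moreover have "x ^ N = x * x ^ (N - 1)" using N1 by (metis plus_1_eq_Suc power_Suc)
  ultimately have "x * (t - c * x ^ (N - 1)) \<in> R.span (set (A @ B))" by (simp add: algebra_simps)
  moreover have "reg x (R.span (set (A @ B)))" using sop_reg[of x "A @ B"] Cons.prems(1) by simp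
  ultimately have "t - c * x ^ (N - 1) \<in> R.span (set (A @ B))" by (simp add: reg_def)
  then have "t - c * x ^ (N - 1) \<in> R.span ((\<lambda>x. x ^ 1) ` set A \<union> set (x ^ N # B))"
    using R.span_mono[of "set (A @ B)" "(\<lambda>x. x ^ 1) ` set A \<union> set (x ^ N # B)"] by auto
  then have "prodpow A (N - 1) * (t - c * x ^ (N - 1)) \<in> ?I"
    using cancel_prodpow[OF sN, of 1 "N - 1" "t - c * x ^ (N - 1)"] unfolding N1 by simp
  with t have "(s - prodpow A (N - 1) * t) + prodpow A (N - 1) * (t - c * x ^ (N - 1)) \<in> ?I"
    by (rule R.span_add)
  then have "s - prodpow (x # A) (N - 1) * c \<in> ?I" by (simp add: prodpow_def algebra_simps)
  then show ?case unfolding I by blast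
qed

end

section \<open>Criteria for torsion and for the Artinian property\<close>

context local_module
begin

declare ring_module.scale_scale [simp del]

lemma mpow_one_power: "y \<in> m \<Longrightarrow> y ^ k \<in> mpow k"
proof (induction k)
  case (Suc k)
  then show ?case using mult_mpow[of y "y ^ k" k] by (simp del: mpow.simps)
qed simp

text \<open>Let T be the set of torsion elements. If h is not in T, choose s h outside T with T : s
  h maximal. If y s h were outside T for some y in \<open>m\<close>, maximality would make y regular
  modulo T : s h, yet a power of y lies there. So \<open>m\<close> s h lies in T, and then s h does
  as \<open>m\<close> is finitely generated.\<close>

lemma tors_locally:
  assumes W: "subspace W" and pw: "\<And>y. y \<in> m \<Longrightarrow> \<exists>n. y ^ n *s h \<in> W"
  shows "\<exists>k. h \<in> tors k W"
proof (rule ccontr)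
  assume neg: "\<not> ?thesis"
  define T where "T = {g. \<exists>k. g \<in> tors k W}"
  have T: "subspace T"
    unfolding subspace_def
  proof (intro conjI ballI allI)
    show "0 \<in> T" unfolding T_def using subspace_0[OF tors_subspace[OF W]] by blast
  next
    fix x y assume "x \<in> T" "y \<in> T"
    then obtain i j where "x \<in> tors i W" "y \<in> tors j W" by (auto simp: T_def)
    then have "x \<in> tors (max i j) W" "y \<in> tors (max i j) W"
      using tors_le[OF W, of i "max i j"] tors_le[OF W, of j "max i j"] by auto
    from subspace_add[OF tors_subspace[OF W] this] show "x + y \<in> T" by (auto simp: T_def)
  next
    fix c x assume "x \<in> T"
    then show "c *s x \<in> T" unfolding T_def using subspace_scale[OF tors_subspace[OF W]] by blast
  qed
  have TI: "g \<in> T" if g: "\<And>y. y \<in> m \<Longrightarrow> y *s g \<in> T" for g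
  proof -
    obtain S where S: "finite S" "m = R.span S" using noetherian_fg[OF noeth m_subspace] by blast
    have Sm: "S \<subseteq> m" using S R.span_superset by blast
    have "\<forall>y\<in>S. \<exists>k. y *s g \<in> tors k W" using g Sm by (auto simp: T_def)
    then obtain k where k: "\<And>y. y \<in> S \<Longrightarrow> y *s g \<in> tors (k y) W" by metis
    define K where "K = sum k S"
    have "y *s g \<in> tors K W" if "y \<in> S" for y
      using k[OF that] tors_le[OF W, of "k y" K] member_le_sum[OF that, of k] S(1) by (auto simp: K_def)
    then have "R.span S \<subseteq> {y. y *s g \<in> tors K W}"
      by (intro R.span_minimal subspace_annihilator tors_subspace W) auto
    then have "g \<in> tors (Suc K) W" unfolding S(2)[symmetric] by auto
    then show ?thesis unfolding T_def by blast
  qed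
  have hT: "h \<notin> T" using neg by (simp add: T_def)
  have "tors 0 W \<subseteq> T" unfolding T_def by blast
  then have WT: "W \<subseteq> T" by simp
  define Q where "Q I \<longleftrightarrow> (\<exists>s. I = {r. r *s (s *s h) \<in> T} \<and> s *s h \<notin> T)" for I
  have "Q {r. r *s h \<in> T}" unfolding Q_def using hT by (intro exI[of _ 1]) simp
  obtain M where M: "R.subspace M" "Q M"
    and mx: "\<And>K. R.subspace K \<Longrightarrow> Q K \<Longrightarrow> M \<subseteq> K \<Longrightarrow> K = M"
    by (rule noetherian_maximal[OF noeth, of "{r. r *s h \<in> T}" Q])
      (use \<open>Q {r. r *s h \<in> T}\<close> subspace_annihilator[OF T] in auto)
  obtain s where s: "M = {r. r *s (s *s h) \<in> T}" "s *s h \<notin> T" using M(2) unfolding Q_def by blast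
  have "y *s (s *s h) \<in> T" if y: "y \<in> m" for y
  proof (rule ccontr)
    assume n: "y *s (s *s h) \<notin> T"
    let ?K = "{r. r *s ((y * s) *s h) \<in> T}"
    have "?K = M"
    proof (rule mx)
      show "R.subspace ?K" by (rule subspace_annihilator[OF T])
      show "Q ?K" unfolding Q_def using n by (intro exI[of _ "y * s"]) simp
      show "M \<subseteq> ?K"
      proof
        fix r assume "r \<in> M"
        then have "y *s (r *s (s *s h)) \<in> T" unfolding s by (simp only: mem_Collect_eq subspace_scale[OF T])
        then show "r \<in> ?K" by (simp add: mult_ac)
      qed
    qed
    then have eq: "r * y \<in> M \<longleftrightarrow> r \<in> M" for r
      unfolding s(1) by (auto simp: set_eq_iff mult_ac)
    have "y ^ k \<notin> M" for k
    proof (induction k)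
      case 0
      then show ?case using s by simp
    next
      case (Suc k)
      then show ?case using eq[of "y ^ k"] by (simp add: mult.commute)
    qed
    moreover obtain k where "y ^ k *s h \<in> W" using pw[OF y] by blast
    then have "s *s (y ^ k *s h) \<in> T" using WT subspace_scale[OF T, of "y ^ k *s h" s] by blast
    then have "y ^ k \<in> M" by (simp add: s mult.commute)
    ultimately show False by blast
  qed
  with TI s(2) show False by blast
qed

text \<open>It suffices that the part killed by a is Artinian: nested submodules N coincide once all
  \<open>l N k\<close> do, the intersections of a^k N with that part modulo Z.\<close>

lemma dcc_torsion:
  assumes Z: "subspace Z" and W: "subspace W" "Z \<subseteq> W"
    and tor: "\<And>h. h \<in> W \<Longrightarrow> \<exists>k. a ^ k *s h \<in> Z"
    and d: "dcc Z (W \<inter> {h. a *s h \<in> Z})"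
  shows "dcc Z W"
  unfolding dcc_def
proof (intro allI impI)
  fix F assume F0: "F \<noteq> {}" and F: "\<forall>N\<in>F. subspace N \<and> Z \<subseteq> N \<and> N \<subseteq> W"
  define l where "l N k = {z. \<exists>h\<in>N. z - a ^ k *s h \<in> Z \<and> a ^ Suc k *s h \<in> Z}" for N k
  have l_sub: "subspace (l N k)" if "subspace N" for N k
    unfolding subspace_def l_def
  proof (intro conjI ballI allI CollectI)
    show "\<exists>h\<in>N. 0 - a ^ k *s h \<in> Z \<and> a ^ Suc k *s h \<in> Z"
      using subspace_0[OF that] subspace_0[OF Z] by (intro bexI[of _ 0]) auto
    fix x y
    assume "x \<in> {z. \<exists>h\<in>N. z - a ^ k *s h \<in> Z \<and> a ^ Suc k *s h \<in> Z}"
      "y \<in> {z. \<exists>h\<in>N. z - a ^ k *s h \<in> Z \<and> a ^ Suc k *s h \<in> Z}"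
    then obtain h g where hg: "h \<in> N" "x - a ^ k *s h \<in> Z" "a ^ Suc k *s h \<in> Z"
      "g \<in> N" "y - a ^ k *s g \<in> Z" "a ^ Suc k *s g \<in> Z" by auto
    have "(x - a ^ k *s h) + (y - a ^ k *s g) \<in> Z" "a ^ Suc k *s h + a ^ Suc k *s g \<in> Z"
      using hg by (blast intro: subspace_add[OF Z])+
    then show "\<exists>h\<in>N. x + y - a ^ k *s h \<in> Z \<and> a ^ Suc k *s h \<in> Z"
      using subspace_add[OF that hg(1,4)]
      by (intro bexI[of _ "h + g"]) (auto simp: scale_right_distrib algebra_simps)
  next
    fix c x assume "x \<in> {z. \<exists>h\<in>N. z - a ^ k *s h \<in> Z \<and> a ^ Suc k *s h \<in> Z}"
    then obtain h where h: "h \<in> N" "x - a ^ k *s h \<in> Z" "a ^ Suc k *s h \<in> Z" by auto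
    have "c *s (x - a ^ k *s h) \<in> Z" "c *s (a ^ Suc k *s h) \<in> Z"
      using h by (blast intro: subspace_scale[OF Z])+
    then show "\<exists>h\<in>N. c *s x - a ^ k *s h \<in> Z \<and> a ^ Suc k *s h \<in> Z"
      using subspace_scale[OF that h(1)]
      by (intro bexI[of _ "c *s h"]) (auto simp: scale_right_diff_distrib mult.commute mult.left_commute)
  qed
  have l_Z: "Z \<subseteq> l N k" if "subspace N" for N k
    unfolding l_def using subspace_0[OF that] subspace_0[OF Z] by (auto intro!: bexI[of _ 0])
  have l_W: "l N k \<subseteq> W \<inter> {h. a *s h \<in> Z}" if N: "N \<subseteq> W" for N k
  proof
    fix z assume "z \<in> l N k"
    then obtain h where h: "h \<in> N" "z - a ^ k *s h \<in> Z" "a ^ Suc k *s h \<in> Z" by (auto simp: l_def)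
    have "a ^ k *s h \<in> W" using h(1) N by (intro subspace_scale[OF W(1)]) auto
    then have "(z - a ^ k *s h) + a ^ k *s h \<in> W" using h(2) W by (intro subspace_add[OF W(1)]) auto
    moreover have "a *s (z - a ^ k *s h) + a ^ Suc k *s h \<in> Z"
      by (rule subspace_add[OF Z subspace_scale[OF Z h(2)] h(3)])
    then have "a *s z \<in> Z" by (simp add: scale_right_diff_distrib)
    ultimately show "z \<in> W \<inter> {h. a *s h \<in> Z}" by simp
  qed
  have l_mono: "l N k \<subseteq> l N' k" if "N \<subseteq> N'" for N N' k
    using that by (auto simp: l_def)
  have l_Suc: "l N (Suc k) \<subseteq> l N k" if N: "subspace N" for N k
  proof
    fix z assume "z \<in> l N (Suc k)"
    then obtain h where h: "h \<in> N" "z - a ^ Suc k *s h \<in> Z" "a ^ Suc (Suc k) *s h \<in> Z"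
      by (auto simp: l_def)
    have "a *s h \<in> N" using h(1) by (rule subspace_scale[OF N])
    moreover have "z - a ^ k *s (a *s h) \<in> Z" "a ^ Suc k *s (a *s h) \<in> Z"
      using h(2,3) by (simp_all add: mult_ac)
    ultimately show "z \<in> l N k" unfolding l_def by blast
  qed
  have l_anti: "l N k' \<subseteq> l N k" if "subspace N" "k \<le> k'" for N k k'
    using l_Suc[OF that(1)] that(2) by (rule lift_Suc_antimono_le)
  have l_eq: "N = N'" if N: "subspace N" "subspace N'" "Z \<subseteq> N'" "N \<subseteq> W" "N' \<subseteq> N"
    and e: "\<And>k. l N k = l N' k" for N N'
  proof (rule antisym[OF _ N(5)], rule subsetI)
    fix h assume h: "h \<in> N"
    have "h \<in> N'" if "h \<in> N" "a ^ k *s h \<in> Z" for h k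
      using that
    proof (induction k arbitrary: h)
      case 0
      then show ?case using N(3) by auto
    next
      case (Suc k)
      have "a ^ k *s h \<in> l N k" unfolding l_def using Suc.prems subspace_0[OF Z] by (auto intro!: bexI[of _ h])
      then obtain g where g: "g \<in> N'" "a ^ k *s h - a ^ k *s g \<in> Z" unfolding e by (auto simp: l_def)
      have "h - g \<in> N" using Suc.prems g N by (intro subspace_diff[OF N(1)]) auto
      moreover have "a ^ k *s (h - g) \<in> Z" using g by (simp add: scale_right_diff_distrib)
      ultimately have "h - g \<in> N'" by (rule Suc.IH)
      then have "(h - g) + g \<in> N'" using g(1) by (rule subspace_add[OF N(2)])
      then show ?case by simp
    qed
    then show "h \<in> N'" using tor[of h] N(4) h by blast
  qed
  obtain N0 where N0: "N0 \<in> F" using F0 by blast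
  \<comment> \<open>A smallest value among all l N k, attained at N1 and level K: below N1 nothing
    changes from level K on, and only finitely many levels remain.\<close>
  obtain V where V: "subspace V" "Z \<subseteq> V" "V \<subseteq> W \<inter> {h. a *s h \<in> Z}" "\<exists>N\<in>F. \<exists>k. V = l N k"
    and mnV: "\<And>V'. subspace V' \<Longrightarrow> Z \<subseteq> V' \<Longrightarrow> V' \<subseteq> V \<Longrightarrow> \<exists>N\<in>F. \<exists>k. V' = l N k \<Longrightarrow> V' = V"
    by (rule dcc_minimal[OF d, of "l N0 0" "\<lambda>V. \<exists>N\<in>F. \<exists>k. V = l N k"])
      (use N0 F l_sub l_Z l_W in auto)
  then obtain N1 K where N1: "N1 \<in> F" "V = l N1 K" by blast
  have high: "l N k = V" if N: "N \<in> F" "N \<subseteq> N1" and k: "K \<le> k" for N k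
  proof (rule mnV)
    have sN: "subspace N" using F N(1) by blast
    show "subspace (l N k)" "Z \<subseteq> l N k" using l_sub[OF sN] l_Z[OF sN] by auto
    show "l N k \<subseteq> V" using l_anti[OF sN k] l_mono[OF N(2), of K] N1(2) by blast
    show "\<exists>N'\<in>F. \<exists>k'. l N k = l N' k'" using N(1) by blast
  qed
  have "\<exists>N\<in>F. N \<subseteq> N1 \<and> (\<forall>N'\<in>F. N' \<subseteq> N \<longrightarrow> (\<forall>k<j. l N' k = l N k))" for j
  proof (induction j)
    case 0
    show ?case using N1(1) by (intro bexI[of _ N1] conjI ballI allI impI) simp_all
  next
    case (Suc j)
    then obtain N where N0: "N \<in> F" "N \<subseteq> N1" "\<forall>N'\<in>F. N' \<subseteq> N \<longrightarrow> (\<forall>k<j. l N' k = l N k)"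
      by (elim bexE conjE)
    note N = N0(1,2) N0(3)[rule_format]
    have sN: "subspace N" "N \<subseteq> W" using F N(1) by auto
    obtain U where U: "subspace U" "Z \<subseteq> U" "U \<subseteq> W \<inter> {h. a *s h \<in> Z}" "\<exists>M\<in>F. M \<subseteq> N \<and> U = l M j"
      and mnU: "\<And>V'. subspace V' \<Longrightarrow> Z \<subseteq> V' \<Longrightarrow> V' \<subseteq> U \<Longrightarrow> \<exists>M\<in>F. M \<subseteq> N \<and> V' = l M j \<Longrightarrow> V' = U"
      by (rule dcc_minimal[OF d, of "l N j" "\<lambda>V. \<exists>M\<in>F. M \<subseteq> N \<and> V = l M j"])
        (use N(1) sN l_sub l_Z l_W in auto)
    then obtain M where M: "M \<in> F" "M \<subseteq> N" "U = l M j" by blast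
    have "l N' k = l M k" if N': "N' \<in> F" "N' \<subseteq> M" "k < Suc j" for N' k
    proof (cases "k < j")
      case True
      have "N' \<subseteq> N" using N'(2) M(2) by (rule order_trans)
      from N(3)[OF N'(1) this True] N(3)[OF M(1,2) True] show ?thesis by (rule trans[OF _ sym])
    next
      case False
      then have k: "k = j" using N'(3) by simp
      have sN': "subspace N'" using F N'(1) by blast
      have "l N' j = U"
      proof (rule mnU)
        show "subspace (l N' j)" "Z \<subseteq> l N' j" using l_sub[OF sN'] l_Z[OF sN'] by auto
        show "l N' j \<subseteq> U" unfolding M(3) by (rule l_mono[OF N'(2)])
        show "\<exists>M\<in>F. M \<subseteq> N \<and> l N' j = l M j" using N' M(2) by blast
      qed
      then show ?thesis using k M(3) by simp
    qed
    then have "\<forall>N'\<in>F. N' \<subseteq> M \<longrightarrow> (\<forall>k<Suc j. l N' k = l M k)" by (intro ballI allI impI)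
    then show ?case by (intro bexI[OF _ M(1)] conjI order_trans[OF M(2) N(2)])
  qed
  from this[of K] obtain N where N': "N \<in> F" "N \<subseteq> N1"
    "\<forall>N'\<in>F. N' \<subseteq> N \<longrightarrow> (\<forall>k<K. l N' k = l N k)" by (elim bexE conjE)
  note N = N'(1,2) N'(3)[rule_format]
  have "N' = N" if N': "N' \<in> F" "N' \<subseteq> N" for N'
  proof -
    have "l N k = l N' k" for k
    proof (cases "k < K")
      case True
      then show ?thesis using N(3)[OF N' True] by simp
    next
      case False
      then have "K \<le> k" by simp
      from high[OF N(1,2) this] high[OF N'(1) order_trans[OF N'(2) N(2)] this]
      show ?thesis by (rule trans[OF _ sym])
    qed
    note eq = this
    have *: "subspace N" "subspace N'" "Z \<subseteq> N'" "N \<subseteq> W" using F N(1) N'(1) by blast+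
    show ?thesis by (rule sym, rule l_eq[OF * N'(2) eq])
  qed
  then have "\<forall>N'\<in>F. N' \<subseteq> N \<longrightarrow> N' = N" by (intro ballI impI)
  then show "\<exists>N\<in>F. \<forall>N'\<in>F. N' \<subseteq> N \<longrightarrow> N' = N" using N(1) by (rule bexI)
qed

end

section \<open>Local cohomology as a quotient of a polynomial ring\<close>

text \<open>\<open>H = H\<^sup>d\<^sub>m(R)\<close> is realised as a quotient of the polynomial ring \<open>R[T]\<close>, where \<open>T\<close> stands for
  \<open>1/(a\<^sub>1\<cdots>a\<^sub>d)\<close>; in characteristic \<open>p\<close> the Frobenius action is then induced by \<open>f \<mapsto> f\<^sup>p\<close>.\<close>

locale cm_cohomology = cm_local_char m d p
  for m :: "'a::comm_ring_1 set" and d p +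
  fixes as :: "'a list"
  assumes sop: "sop m d as" and d_pos: "0 < d"
begin

lemma prodpow_add: "prodpow L (k + l) = prodpow L k * (prodpow L l :: 'a)"
  by (induction L) (simp_all add: prodpow_def power_add mult_ac)

lemma prodpow_0 [simp]: "prodpow L 0 = (1 :: 'a)"
  by (induction L) (simp_all add: prodpow_def)

lemma prodpow_mult: "prodpow L (k * n) = (prodpow L k :: 'a) ^ n"
  by (induction L) (simp_all add: prodpow_def power_mult power_mult_distrib)

lemma powideal_span: "powideal as l = R.span ((\<lambda>a. a ^ l) ` set as)"
  by (simp add: powideal_def ideal_gen_span)

lemma powideal_subspace: "R.subspace (powideal as l)"
  by (simp add: powideal_span)

text \<open>Here d > 0 enters: some parameter exists, and its power with exponent 0 is 1.\<close>

lemma powideal_0: "powideal as 0 = UNIV"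
proof -
  obtain a L where "as = a # L" using sop d_pos by (cases as) (auto simp: sop_def)
  then have "1 \<in> powideal as 0" unfolding powideal_span by (intro R.span_base) auto
  then show ?thesis using subspace_one_iff[OF powideal_subspace] by blast
qed

lemma powideal_cancel: "prodpow as k * z \<in> powideal as (N + k) \<longleftrightarrow> z \<in> powideal as N"
proof (cases "N = 0")
  case True
  obtain a L where as: "as = a # L" using sop d_pos by (cases as) (auto simp: sop_def)
  have "a ^ k * (prodpow L k * z) \<in> powideal as k"
    unfolding powideal_span using as by (intro subspace_mult_right[OF R.subspace_span] R.span_base) auto
  then have "prodpow as k * z \<in> powideal as k" by (simp add: as prodpow_def mult.assoc)
  then show ?thesis using True by (simp add: powideal_0)
next
  case False
  then show ?thesis using cancel_prodpow[of as "[]" N k z] sop by (simp add: powideal_span)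
qed

lemma powideal_power: "z \<in> powideal as N \<Longrightarrow> z ^ p \<in> powideal as (p * N)"
  using frob_span[of z "(\<lambda>a. a ^ N) ` set as" 1]
  by (simp add: powideal_span image_image mult.commute flip: power_mult)

lemma hzero_iff: "hzero as (r, j) \<longleftrightarrow> r \<in> powideal as j"
proof -
  have "prodpow as (l - j) * r \<in> powideal as l \<longleftrightarrow> r \<in> powideal as j" if "j \<le> l" for l
    using powideal_cancel[of "l - j" r j] that by simp
  then show ?thesis unfolding hzero_def by auto
qed

text \<open>The numerator of f over the denominator (a_1...a_d)^N, with T read as
  1/(a_1...a_d).\<close>

definition numer :: "nat \<Rightarrow> 'a poly \<Rightarrow> 'a" where
  "numer N f = (\<Sum>i\<le>N. coeff f i * prodpow as (N - i))"

lemma numer_zero [simp]: "numer N 0 = 0"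
  by (simp add: numer_def)

lemma numer_add: "numer N (f + g) = numer N f + numer N g"
  by (simp add: numer_def distrib_right sum.distrib)

lemma numer_smult: "numer N (smult r f) = r * numer N f"
  by (simp add: numer_def sum_distrib_left mult.assoc)

lemma numer_diff: "numer N (f - g) = numer N f - numer N g"
  by (simp add: numer_def left_diff_distrib sum_subtractf)

lemma numer_sum: "numer N (\<Sum>i\<in>A. f i) = (\<Sum>i\<in>A. numer N (f i))"
  by (induction A rule: infinite_finite_induct) (simp_all add: numer_add)

lemma numer_monom: "j \<le> N \<Longrightarrow> numer N (monom r j) = r * prodpow as (N - j)"
proof -
  assume j: "j \<le> N"
  have "numer N (monom r j) = (\<Sum>i\<le>N. if i = j then r * prodpow as (N - j) else 0)"
    unfolding numer_def by (intro sum.cong) auto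
  then show ?thesis using j by simp
qed

lemma numer_shift:
  assumes "degree f \<le> N"
  shows "numer (N + k) f = prodpow as k * numer N f"
proof -
  have "numer (N + k) f = (\<Sum>i\<le>N. coeff f i * prodpow as (N + k - i))"
    unfolding numer_def using assms by (intro sum.mono_neutral_right) (auto simp: coeff_eq_0)
  also have "\<dots> = (\<Sum>i\<le>N. prodpow as k * (coeff f i * prodpow as (N - i)))"
  proof (intro sum.cong refl)
    fix i assume "i \<in> {..N}"
    then have "N + k - i = k + (N - i)" by simp
    then show "coeff f i * prodpow as (N + k - i) = prodpow as k * (coeff f i * prodpow as (N - i))"
      by (simp only: prodpow_add mult_ac)
  qed
  finally show ?thesis by (simp add: numer_def sum_distrib_left)
qed

lemma numer_power:
  assumes "degree f \<le> N"
  shows "numer (p * N) (f ^ p) = numer N f ^ p"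
proof -
  have pp: "prime CHAR('a)" "CHAR('a) = p" using prime_p char_p by auto
  have "f ^ p = (\<Sum>i\<le>N. monom (coeff f i) i) ^ p" using poly_as_sum_of_monoms'[OF assms] by simp
  also have "\<dots> = (\<Sum>i\<le>N. monom (coeff f i) i ^ p)"
    by (rule freshmans_dream_sum) (use pp in simp_all)
  also have "numer (p * N) \<dots> = (\<Sum>i\<le>N. (coeff f i * prodpow as (N - i)) ^ p)"
    unfolding numer_sum
  proof (intro sum.cong refl)
    fix i assume "i \<in> {..N}"
    then have i: "i * p \<le> p * N" by simp
    have "p * N - i * p = (N - i) * p" by (simp add: diff_mult_distrib mult.commute[of p N])
    then show "numer (p * N) (monom (coeff f i) i ^ p) = (coeff f i * prodpow as (N - i)) ^ p"
      using numer_monom[OF i, of "coeff f i ^ p"]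
      by (simp add: monom_power prodpow_mult power_mult_distrib)
  qed
  also have "\<dots> = numer N f ^ p"
    unfolding numer_def by (rule freshmans_dream_sum[symmetric]) (use pp in simp_all)
  finally show ?thesis .
qed

text \<open>The kernel of R[T] -> H. The degree is one admissible exponent of the denominator;
  \<open>Zr_iff\<close> allows every larger one.\<close>

definition Zr :: "'a poly set" where
  "Zr = {f. numer (degree f) f \<in> powideal as (degree f)}"

lemma Zr_iff:
  assumes "degree f \<le> N"
  shows "f \<in> Zr \<longleftrightarrow> numer N f \<in> powideal as N"
proof -
  obtain k where k: "N = degree f + k" using assms le_Suc_ex by blast
  show ?thesis using powideal_cancel[of k "numer (degree f) f" "degree f"]
    by (simp add: Zr_def k numer_shift)
qed

sublocale poly_module: local_module m "smult :: 'a \<Rightarrow> 'a poly \<Rightarrow> 'a poly"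
  by unfold_locales (simp_all add: smult_add_right smult_add_left)

declare ring_module.scale_scale [simp del]

lemma Zr_subspace: "poly_module.subspace Zr"
  unfolding poly_module.subspace_def
proof (intro conjI ballI allI)
  show "0 \<in> Zr" using R.subspace_0[OF powideal_subspace] by (simp add: Zr_def)
next
  fix f g assume fg: "f \<in> Zr" "g \<in> Zr"
  define N where "N = max (degree f) (degree g)"
  have "numer N f \<in> powideal as N" "numer N g \<in> powideal as N"
    using fg Zr_iff[of f N] Zr_iff[of g N] by (auto simp: N_def)
  from R.subspace_add[OF powideal_subspace this] show "f + g \<in> Zr"
    using Zr_iff[of "f + g" N] degree_add_le_max[of f g] by (simp add: numer_add N_def)
next
  fix c f assume "f \<in> Zr"
  then have "c * numer (degree f) f \<in> powideal as (degree f)"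
    unfolding Zr_def by (intro R.subspace_scale[OF powideal_subspace]) simp
  then show "smult c f \<in> Zr"
    using Zr_iff[of "smult c f" "degree f"] degree_smult_le[of c f] by (simp add: numer_smult)
qed

lemma monom_Zr: "monom r j \<in> Zr \<longleftrightarrow> r \<in> powideal as j"
  using Zr_iff[of "monom r j" j] degree_monom_le[of r j] by (simp add: numer_monom)

lemma hzero_Zr: "hzero as h \<longleftrightarrow> monom (fst h) (snd h) \<in> Zr"
  using hzero_iff[of "fst h" "snd h"] by (simp add: monom_Zr)

lemma monom_numer:
  assumes "degree f \<le> N"
  shows "f - monom (numer N f) N \<in> Zr"
proof -
  have "degree (f - monom (numer N f) N) \<le> N"
    using assms degree_monom_le by (intro degree_diff_le) auto
  then show ?thesis using R.subspace_0[OF powideal_subspace]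
    by (simp add: Zr_iff numer_diff numer_monom)
qed

lemma Zr_power: "f \<in> Zr \<Longrightarrow> f ^ p \<in> Zr"
proof -
  assume "f \<in> Zr"
  then have "numer (degree f) f ^ p \<in> powideal as (p * degree f)"
    by (intro powideal_power) (simp add: Zr_def)
  then show ?thesis using Zr_iff[of "f ^ p" "p * degree f"] degree_power_le[of f p]
    by (simp add: numer_power mult.commute)
qed

lemma powideal_smult: "degree f \<le> N \<Longrightarrow> r \<in> powideal as N \<Longrightarrow> smult r f \<in> Zr"
  using Zr_iff[of "smult r f" N] degree_smult_le[of r f] subspace_mult_right[OF powideal_subspace]
  by (auto simp: numer_smult)

lemma poly_torsion: "\<exists>k. f \<in> poly_module.tors k Zr"
proof (rule poly_module.tors_locally[OF Zr_subspace])
  fix y assume y: "y \<in> m"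
  define N where "N = Suc (degree f)"
  have "sop m d (map (\<lambda>a. a ^ N) as)"
    by (rule sop_powers[OF sop powers_map]) (simp add: N_def)
  then obtain n where "y ^ n \<in> powideal as N"
    using y by (auto simp: sop_def radical_def ideal_simps powideal_span)
  then have "smult (y ^ n) f \<in> Zr" by (rule powideal_smult[rotated]) (simp add: N_def)
  then show "\<exists>n. smult (y ^ n) f \<in> Zr" by blast
qed

text \<open>The part of H killed by all parameters is generated by 1/(a_1...a_d) and has finite
  length. \<open>dcc_torsion\<close> then releases the parameters one at a time.\<close>

lemma poly_dcc: "poly_module.dcc Zr UNIV"
proof -
  define W where "W L = {f. \<forall>a\<in>set L. smult a f \<in> Zr}" for L
  have sW: "poly_module.subspace (W L)" for L
    unfolding W_def poly_module.subspace_def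
    using poly_module.subspace_0[OF Zr_subspace] poly_module.subspace_add[OF Zr_subspace]
      poly_module.subspace_scale[OF Zr_subspace]
    by (auto simp: smult_add_right) (metis mult.commute smult_smult)
  have ZW: "Zr \<subseteq> W L" for L
    unfolding W_def using poly_module.subspace_scale[OF Zr_subspace] by blast
  have base: "poly_module.dcc Zr (W as)"
  proof -
    have "W as \<subseteq> poly_module.span (insert (monom 1 1) Zr)"
    proof
      fix f assume f: "f \<in> W as"
      define N where "N = Suc (degree f)"
      have "a * numer N f \<in> powideal as N" if "a \<in> set as" for a
        using f that Zr_iff[of "smult a f" N] degree_smult_le[of a f]
        by (auto simp: W_def numer_smult N_def)
      then obtain t where t: "numer N f - prodpow as (N - 1) * t \<in> powideal as N"
        using colon_prodpow[of as "[]" N "numer N f"] sop by (auto simp: powideal_span N_def)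
      have "degree (f - smult t (monom 1 1)) \<le> N"
        using degree_monom_le[of t 1] by (intro degree_diff_le) (auto simp: N_def smult_monom)
      then have "f - smult t (monom 1 1) \<in> Zr"
        using t numer_monom[of 1 N t] by (simp add: Zr_iff numer_diff smult_monom N_def mult.commute)
      then show "f \<in> poly_module.span (insert (monom 1 1) Zr)"
        using poly_module.span_insert_iff[OF Zr_subspace] by blast
    qed
    moreover obtain k where "monom 1 1 \<in> poly_module.tors k Zr" using poly_torsion by blast
    then have "poly_module.dcc Zr (poly_module.span (insert (monom 1 1) Zr))"
      by (intro poly_module.fin_over_dcc poly_module.fin_over_tors Zr_subspace)
    ultimately show ?thesis by (rule poly_module.dcc_mono[rotated 2]) simp
  qed
  have "poly_module.dcc Zr (W (drop i as))" if "i \<le> length as" for i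
    using that
  proof (induction i)
    case 0
    then show ?case using base by simp
  next
    case (Suc i)
    let ?a = "as ! i"
    have am: "?a \<in> m" using sop Suc.prems by (auto simp: sop_def)
    have "drop i as = ?a # drop (Suc i) as" using Suc.prems by (simp add: Cons_nth_drop_Suc)
    then have "W (drop i as) = W (drop (Suc i) as) \<inter> {f. smult ?a f \<in> Zr}"
      unfolding W_def by auto
    then have "poly_module.dcc Zr (W (drop (Suc i) as) \<inter> {f. smult ?a f \<in> Zr})"
      using Suc by simp
    then show ?case
    proof (rule poly_module.dcc_torsion[OF Zr_subspace sW ZW, rotated])
      fix f
      obtain k where "f \<in> poly_module.tors k Zr" using poly_torsion by blast
      then have "smult (?a ^ k) f \<in> Zr"
        by (rule poly_module.mpow_tors[OF Zr_subspace poly_module.mpow_one_power[OF am]])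
      then show "\<exists>k. smult (?a ^ k) f \<in> Zr" by blast
    qed
  qed
  from this[OF order_refl] show ?thesis by (simp add: W_def)
qed

sublocale H: frobenius_module m "smult :: 'a \<Rightarrow> 'a poly \<Rightarrow> 'a poly" p "\<lambda>f. f ^ p" Zr
proof unfold_locales
  show "2 \<le> p" using prime_p by (rule prime_ge_2_nat)
  show "(g + h) ^ p = g ^ p + h ^ p" for g h :: "'a poly"
    by (rule freshmans_dream) (use prime_p char_p in simp_all)
  show "smult r h ^ p = smult (r ^ p) (h ^ p)" for r and h :: "'a poly" by (rule smult_power)
  show "poly_module.subspace Zr" by (rule Zr_subspace)
  show "h ^ p \<in> Zr" if "h \<in> Zr" for h using that by (rule Zr_power)
  show "poly_module.dcc Zr UNIV" by (rule poly_dcc)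
  show "\<exists>k. h \<in> poly_module.tors k Zr" for h by (rule poly_torsion)
qed

end

section \<open>Parameter test elements\<close>

lemma reg_pow: "reg c J \<Longrightarrow> reg (c ^ k) J"
  by (induction k) (simp_all add: reg_one reg_mult)

context frobenius_module
begin

lemma gamma_closed: "closed gamma"
  unfolding closed_def
proof (intro conjI allI impI gamma_stable)
  fix h assume "X h \<in> gamma"
  then obtain n where "X h \<in> ker n" by (auto simp: gamma_def)
  then have "h \<in> ker (n + 1)" using ker_add[of 1 h n] by simp
  then show "h \<in> gamma" unfolding gamma_def by blast
qed

end

context cm_cohomology
begin

lemma Xn_power: "((\<lambda>f. f ^ p) ^^ n) f = (f :: 'a poly) ^ (p ^ n)"
  by (induction n) (simp_all add: mult.commute flip: power_mult)

section \<open>Translation between pairs and polynomials\<close>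

definition mon :: "'a \<times> nat \<Rightarrow> 'a poly" where
  "mon h = monom (fst h) (snd h)"

lemma mon_hx: "mon (hx p h) = mon h ^ p"
  by (simp add: mon_def hx_def monom_power mult.commute)

lemma mon_hxpow: "mon (hxpow p n h) = mon h ^ (p ^ n)"
  unfolding hxpow_def Xn_power[symmetric] by (induction n) (simp_all add: mon_hx)

lemma mon_hsmul: "mon (hsmul t h) = smult t (mon h)"
  by (simp add: mon_def hsmul_def smult_monom)

lemma hzero_mon: "hzero as h \<longleftrightarrow> mon h \<in> Zr"
  by (simp add: hzero_Zr mon_def)

lemma mon_hadd: "mon (hadd as h h') - (mon h + mon h') \<in> Zr"
proof -
  define N where "N = snd h + snd h'"
  have "degree (mon (hadd as h h') - (mon h + mon h')) \<le> N"
    unfolding mon_def hadd_def N_def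
    by (intro degree_diff_le degree_add_le order_trans[OF degree_monom_le]) auto
  moreover have "numer N (mon (hadd as h h') - (mon h + mon h')) = 0"
    by (simp add: mon_def hadd_def N_def numer_diff numer_add numer_monom mult.commute)
  ultimately show ?thesis using R.subspace_0[OF powideal_subspace] by (simp add: Zr_iff)
qed

text \<open>An exponent at least 1 makes \<open>powideal as (snd h)\<close> a proper ideal, hence
  usable as a parameter ideal.\<close>

lemma ex_mon: "\<exists>h. 1 \<le> snd h \<and> f - mon h \<in> Zr"
  using monom_numer[of f "Suc (degree f)"]
  by (intro exI[of _ "(numer (Suc (degree f)) f, Suc (degree f))"]) (simp add: mon_def)

lemma in_Gamma_mon: "in_Gamma_x as p h \<longleftrightarrow> mon h \<in> H.gamma"
  by (simp add: in_Gamma_x_def hzero_mon mon_hxpow H.gamma_def H.ker_def Xn_power)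

lemma ex_hsl: "\<exists>e. hsl_kills as p e"
proof -
  obtain e where e: "\<And>h n. ((\<lambda>f. f ^ p) ^^ n) h \<in> Zr \<Longrightarrow> ((\<lambda>f. f ^ p) ^^ e) h \<in> Zr"
    using H.hartshorne_speiser_lyubeznik by blast
  have "hsl_kills as p e"
    unfolding hsl_kills_def in_Gamma_x_def hzero_mon mon_hxpow Xn_power[symmetric] using e by blast
  then show ?thesis by blast
qed

lemma gamma_cong: "f - g \<in> Zr \<Longrightarrow> f \<in> H.gamma \<longleftrightarrow> g \<in> H.gamma"
  using poly_module.mem_cong[OF H.gamma_subspace] H.Z_gamma by blast

lemma hsl_gamma:
  assumes e: "hsl_kills as p e" and f: "f \<in> H.gamma"
  shows "f ^ (p ^ e) \<in> Zr"
proof -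
  obtain h where h: "f - mon h \<in> Zr" using ex_mon by blast
  then have "mon h \<in> H.gamma" using f gamma_cong by blast
  then have "mon h ^ (p ^ e) \<in> Zr"
    using e unfolding hsl_kills_def in_Gamma_mon hzero_mon mon_hxpow by blast
  moreover have "((\<lambda>f. f ^ p) ^^ e) (f - mon h) \<in> Zr" by (rule H.stable_Xn[OF H.stable_Z h])
  then have "f ^ (p ^ e) - mon h ^ (p ^ e) \<in> Zr" unfolding H.Xn_diff unfolding Xn_power .
  ultimately show ?thesis using poly_module.mem_cong[OF Zr_subspace] by blast
qed

text \<open>A set of pairs need not contain all representatives of its classes; adding
  \<open>gamma\<close> saturates it without changing the annihilator in G.\<close>

lemma submodule_of_pairs:
  assumes N: "G_submodule as p N"
  shows "H.stable {f. \<exists>h\<in>N. f - mon h \<in> H.gamma}" (is "H.stable ?M")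
    "H.gamma \<subseteq> {f. \<exists>h\<in>N. f - mon h \<in> H.gamma}"
    "H.ann H.gamma {f. \<exists>h\<in>N. f - mon h \<in> H.gamma} = grann_deg as p N 0"
proof -
  note g_add = poly_module.subspace_add[OF H.gamma_subspace]
    and g_diff = poly_module.subspace_diff[OF H.gamma_subspace]
    and g_scale = poly_module.subspace_scale[OF H.gamma_subspace]
  have zero: "(0, 0) \<in> N" and add: "\<And>h h'. h \<in> N \<Longrightarrow> h' \<in> N \<Longrightarrow> hadd as h h' \<in> N"
    and scale: "\<And>t h. h \<in> N \<Longrightarrow> hsmul t h \<in> N" and hx: "\<And>h. h \<in> N \<Longrightarrow> hx p h \<in> N"
    using N by (auto simp: G_submodule_def)
  have mon0: "mon (0, 0) = 0" by (simp add: mon_def)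
  show gM: "H.gamma \<subseteq> ?M" using zero mon0 by (auto intro!: bexI[of _ "(0, 0)"])
  show "H.stable ?M"
    unfolding H.stable_def poly_module.subspace_def
  proof (intro conjI ballI allI)
    show "0 \<in> ?M" using gM poly_module.subspace_0[OF H.gamma_subspace] by blast
    show "Zr \<subseteq> ?M" using gM H.Z_gamma by blast
  next
    fix f g assume "f \<in> ?M" "g \<in> ?M"
    then obtain h h' where h: "h \<in> N" "f - mon h \<in> H.gamma" "h' \<in> N" "g - mon h' \<in> H.gamma" by blast
    have "mon (hadd as h h') - (mon h + mon h') \<in> H.gamma" using mon_hadd H.Z_gamma by blast
    then have "(f - mon h) + (g - mon h') - (mon (hadd as h h') - (mon h + mon h')) \<in> H.gamma"
      using h by (simp only: g_diff g_add)
    then have "(f + g) - mon (hadd as h h') \<in> H.gamma" by (simp add: algebra_simps)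
    then show "f + g \<in> ?M" using add[OF h(1,3)] by blast
  next
    fix c f assume "f \<in> ?M"
    then obtain h where h: "h \<in> N" "f - mon h \<in> H.gamma" by blast
    then have "smult c f - mon (hsmul c h) \<in> H.gamma"
      using g_scale[OF h(2), of c] by (simp add: mon_hsmul smult_diff_right)
    then show "smult c f \<in> ?M" using scale[OF h(1)] by blast
  next
    fix f assume "f \<in> ?M"
    then obtain h where h: "h \<in> N" "f - mon h \<in> H.gamma" by blast
    have "(f - mon h) ^ p \<in> H.gamma" by (rule H.stableD(3)[OF H.gamma_stable h(2)])
    then have "f ^ p - mon (hx p h) \<in> H.gamma" by (simp add: mon_hx H.X_diff)
    then show "f ^ p \<in> ?M" using hx[OF h(1)] by blast
  qed
  show "H.ann H.gamma ?M = grann_deg as p N 0"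
  proof (rule antisym)
    show "H.ann H.gamma ?M \<subseteq> grann_deg as p N 0"
    proof
      fix r assume r: "r \<in> H.ann H.gamma ?M"
      have "smult r (mon h) \<in> H.gamma" if "h \<in> N" for h
      proof -
        have "mon h - mon h \<in> H.gamma" using poly_module.subspace_0[OF H.gamma_subspace] by simp
        then have "mon h \<in> ?M" using that by blast
        then show ?thesis using r by (simp add: H.ann_def)
      qed
      then show "r \<in> grann_deg as p N 0"
        by (simp add: grann_deg_def in_Gamma_mon mon_hsmul mon_hxpow)
    qed
    show "grann_deg as p N 0 \<subseteq> H.ann H.gamma ?M"
    proof
      fix r assume "r \<in> grann_deg as p N 0"
      then have r: "\<And>h. h \<in> N \<Longrightarrow> smult r (mon h) \<in> H.gamma"
        by (simp add: grann_deg_def in_Gamma_mon mon_hsmul mon_hxpow)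
      have "smult r f \<in> H.gamma" if f: "f \<in> ?M" for f
      proof -
        obtain h where h: "h \<in> N" "f - mon h \<in> H.gamma" using f by blast
        have "smult r (f - mon h) + smult r (mon h) \<in> H.gamma"
          using r[OF h(1)] g_scale[OF h(2)] by (rule g_add[rotated])
        then show ?thesis by (simp add: smult_diff_right)
      qed
      then show "r \<in> H.ann H.gamma ?M" by (simp add: H.ann_def)
    qed
  qed
qed

text \<open>The annihilator is the same in each degree: if r X^n h is torsion, then so is r^(p^n)
  X^n h = X^n (r h), and therefore r h.\<close>

lemma pairs_of_submodule:
  assumes N: "H.stable N" "H.gamma \<subseteq> N"
  shows "G_submodule as p {h. mon h \<in> N}" "grann_deg as p {h. mon h \<in> N} n = H.ann H.gamma N"
proof -
  note sN = H.stableD(1)[OF N(1)]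
  have cong: "f \<in> N \<longleftrightarrow> g \<in> N" if "f - g \<in> Zr" for f g
    using poly_module.mem_cong[OF sN] that H.stableD(2)[OF N(1)] by blast
  show "G_submodule as p {h. mon h \<in> N}"
    unfolding G_submodule_def
  proof (intro conjI ballI allI)
    show "(0, 0) \<in> {h. mon h \<in> N}" using poly_module.subspace_0[OF sN] by (simp add: mon_def)
    show "hadd as h h' \<in> {h. mon h \<in> N}" if "h \<in> {h. mon h \<in> N}" "h' \<in> {h. mon h \<in> N}" for h h'
      using that cong[OF mon_hadd, of h h'] poly_module.subspace_add[OF sN] by simp
    show "hsmul t h \<in> {h. mon h \<in> N}" if "h \<in> {h. mon h \<in> N}" for t h
      using that poly_module.subspace_scale[OF sN] by (simp add: mon_hsmul)
    show "hx p h \<in> {h. mon h \<in> N}" if "h \<in> {h. mon h \<in> N}" for h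
      using that H.stableD(3)[OF N(1)] by (simp add: mon_hx)
  qed
  show "grann_deg as p {h. mon h \<in> N} n = H.ann H.gamma N"
  proof (rule antisym)
    show "grann_deg as p {h. mon h \<in> N} n \<subseteq> H.ann H.gamma N"
    proof
      fix r assume "r \<in> grann_deg as p {h. mon h \<in> N} n"
      then have r: "\<And>h. mon h \<in> N \<Longrightarrow> smult r (mon h ^ (p ^ n)) \<in> H.gamma"
        unfolding grann_deg_def in_Gamma_mon mon_hsmul mon_hxpow by blast
      have "smult r f \<in> H.gamma" if f: "f \<in> N" for f
      proof -
        obtain h where h: "f - mon h \<in> Zr" using ex_mon by blast
        then have "mon h \<in> N" using cong f by blast
        then have "smult (r ^ (p ^ n)) (mon h ^ (p ^ n)) \<in> H.gamma"
          using r frob_pos[of n] by (intro H.scale_pos_power_mem[OF H.gamma_subspace])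
        then have "((\<lambda>f. f ^ p) ^^ n) (smult r (mon h)) \<in> H.gamma"
          by (simp add: Xn_power smult_power)
        then have "smult r (mon h) \<in> H.gamma" by (rule H.closed_Xn[OF H.gamma_closed])
        moreover have "smult r f - smult r (mon h) \<in> Zr"
          using poly_module.subspace_scale[OF Zr_subspace h, of r] by (simp add: smult_diff_right)
        ultimately show ?thesis using gamma_cong by blast
      qed
      then show "r \<in> H.ann H.gamma N" by (simp add: H.ann_def)
    qed
    show "H.ann H.gamma N \<subseteq> grann_deg as p {h. mon h \<in> N} n"
      using H.stable_Xn[OF N(1)]
      by (auto simp: H.ann_def grann_deg_def in_Gamma_mon mon_hsmul mon_hxpow Xn_power)
  qed
qed

lemma G_special_iff: "b \<in> G_special_ideals as p \<longleftrightarrow> H.special_over H.gamma b"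
proof
  assume "b \<in> G_special_ideals as p"
  then obtain N where N: "G_submodule as p N" "grann_deg as p N 0 = b"
    by (auto simp: G_special_ideals_def)
  show "H.special_over H.gamma b"
    using submodule_of_pairs[OF N(1)] N(2) unfolding H.special_over_def by blast
next
  assume "H.special_over H.gamma b"
  then obtain N where N: "H.stable N" "H.gamma \<subseteq> N" "b = H.ann H.gamma N"
    by (auto simp: H.special_over_def)
  show "b \<in> G_special_ideals as p"
    unfolding G_special_ideals_def using pairs_of_submodule[OF N(1,2)] N(3) by blast
qed

lemma special_subspace: "H.special_over H.gamma b \<Longrightarrow> R.subspace b"
  using H.ann_subspace[OF H.gamma_subspace] by (auto simp: H.special_over_def)

definition smallest_special :: "'a set \<Rightarrow> bool" where
  "smallest_special b \<longleftrightarrow> b \<in> G_special_ideals as p \<and> ideal_height b \<ge> 1 \<and>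
     (\<forall>c\<in>G_special_ideals as p. ideal_height c \<ge> 1 \<longrightarrow> b \<subseteq> c)"

lemma special_height_iff:
  "H.special_over H.gamma b \<Longrightarrow> 1 \<le> ideal_height b \<longleftrightarrow> (\<exists>c\<in>b. reg c {0})"
  by (rule height_ge_1_iff) (rule special_subspace)

text \<open>With e the common nonzerodivisor, every stable submodule whose annihilator contains a
  nonzerodivisor lies in \<open>M\<close>, the largest one killed by e modulo \<open>gamma\<close>;
  so the annihilator of \<open>M\<close> is smallest.\<close>

lemma ex1_smallest_special: "\<exists>!b. smallest_special b"
proof -
  obtain e where e: "reg e {0}"
    "\<And>N. H.stable N \<Longrightarrow> \<exists>c\<in>H.ann H.gamma N. reg c {0} \<Longrightarrow> e \<in> H.ann H.gamma N"
    using H.common_regular_annihilator[OF H.gamma_closed, of d] prime_chain_le by blast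
  define M where "M = H.killed H.gamma {e}"
  have M: "H.stable M" "H.gamma \<subseteq> M"
    unfolding M_def using H.killed_closed[OF H.gamma_closed] H.killed_superset[OF H.gamma_stable]
    by (auto intro: H.closed_stable)
  have sp: "H.special_over H.gamma (H.ann H.gamma M)" by (rule H.special_overI[OF M])
  have "e \<in> H.ann H.gamma M" using H.ann_killed[of "{e}" H.gamma] by (auto simp: M_def)
  then have ht: "1 \<le> ideal_height (H.ann H.gamma M)" using special_height_iff[OF sp] e(1) by blast
  have min: "H.ann H.gamma M \<subseteq> c" if c: "c \<in> G_special_ideals as p" "1 \<le> ideal_height c" for c
  proof -
    have spc: "H.special_over H.gamma c" using c(1) G_special_iff by blast
    then obtain N where N: "H.stable N" "c = H.ann H.gamma N" by (auto simp: H.special_over_def)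
    have "e \<in> H.ann H.gamma N" using e(2)[OF N(1)] c(2) special_height_iff[OF spc] N(2) by blast
    then have "N \<subseteq> M" unfolding M_def using H.sub_killed[OF N(1)] by blast
    then show ?thesis unfolding N(2) H.ann_def by blast
  qed
  have "smallest_special (H.ann H.gamma M)"
    unfolding smallest_special_def using sp ht min G_special_iff by blast
  moreover have "b = b'" if "smallest_special b" "smallest_special b'" for b b'
    using that unfolding smallest_special_def by (intro antisym) blast+
  ultimately show ?thesis by blast
qed

lemma powideal_frob: "frob_pow (powideal as j) (p ^ n) = powideal as (j * p ^ n)"
  unfolding powideal_span frob_pow_span by (simp add: image_image power_mult)

lemma monom_frob: "smult c (monom r j ^ (p ^ n)) \<in> Zr \<longleftrightarrow> c * r ^ (p ^ n) \<in> powideal as (j * p ^ n)"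
  by (simp add: monom_power smult_monom monom_Zr)

section \<open>Test elements and bounds for the weak parameter test ideal\<close>

context
  fixes m0 :: nat and b :: "'a set"
  assumes hsl: "hsl_kills as p m0" and b: "smallest_special b"
begin

lemma b_special: "H.special_over H.gamma b"
  using b G_special_iff by (simp add: smallest_special_def)

lemma b_subspace: "R.subspace b"
  by (rule special_subspace[OF b_special])

lemma b_regular: "\<exists>c\<in>b. reg c {0}"
  using b special_height_iff[OF b_special] by (simp add: smallest_special_def)

lemma b_minimal: "H.stable N \<Longrightarrow> H.gamma \<subseteq> N \<Longrightarrow> \<exists>c\<in>H.ann H.gamma N. reg c {0} \<Longrightarrow> b \<subseteq> H.ann H.gamma N"
  using b G_special_iff special_height_iff H.special_overI unfolding smallest_special_def by blast

text \<open>The source of the exponent: (c f^(p^(n - m0)))^(p^m0) = c^(p^m0) f^(p^n).\<close>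

lemma gamma_hsl:
  assumes "\<And>n. smult c (f ^ (p ^ n)) \<in> H.gamma" and n: "m0 \<le> n"
  shows "smult (c ^ (p ^ m0)) (f ^ (p ^ n)) \<in> Zr"
proof -
  have "(smult c (f ^ (p ^ (n - m0)))) ^ (p ^ m0) \<in> Zr"
    by (rule hsl_gamma[OF hsl assms(1)])
  moreover have "p ^ (n - m0) * p ^ m0 = p ^ n" using n by (simp flip: power_add)
  ultimately show ?thesis by (simp add: smult_power power_mult[symmetric])
qed

text \<open>The span of \<open>gamma\<close> and the high Frobenius powers of f is killed by c'
  modulo \<open>gamma\<close>, hence by all of \<open>b\<close>. Torsion-freeness extends this to
  the low powers, so the bound n0 belonging to c' disappears.\<close>

lemma test_exponent:
  assumes c: "c \<in> b" and c': "reg c' {0}" "\<And>n. n0 \<le> n \<Longrightarrow> smult c' (f ^ (p ^ n)) \<in> Zr" and n: "m0 \<le> n"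
  shows "smult (c ^ (p ^ m0)) (f ^ (p ^ n)) \<in> Zr"
proof -
  let ?S = "H.gamma \<union> {f ^ (p ^ k) | k. n0 \<le> k}"
  have st: "H.stable (poly_module.span ?S)"
  proof (rule H.stable_span)
    show "Zr \<subseteq> ?S" using H.Z_gamma by blast
    fix g assume "g \<in> ?S"
    then consider "g \<in> H.gamma" | k where "n0 \<le> k" "g = f ^ (p ^ k)" by blast
    then show "g ^ p \<in> poly_module.span ?S"
    proof cases
      case 1
      then show ?thesis using H.stableD(3)[OF H.gamma_stable] by (intro poly_module.span_base) blast
    next
      case 2
      then have "g ^ p = f ^ (p ^ Suc k)" by (simp add: mult.commute flip: power_mult)
      moreover have "n0 \<le> Suc k" using 2 by simp
      ultimately show ?thesis by (intro poly_module.span_base) blast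
    qed
  qed
  have "poly_module.span ?S \<subseteq> {g. smult c' g \<in> H.gamma}"
  proof (rule poly_module.span_minimal)
    show "?S \<subseteq> {g. smult c' g \<in> H.gamma}"
      using c'(2) H.Z_gamma poly_module.subspace_scale[OF H.gamma_subspace] by blast
    show "poly_module.subspace {g. smult c' g \<in> H.gamma}"
      unfolding poly_module.subspace_def
    proof (intro conjI ballI allI CollectI)
      show "smult c' 0 \<in> H.gamma" using poly_module.subspace_0[OF H.gamma_subspace] by simp
      show "smult c' (x + y) \<in> H.gamma"
        if "x \<in> {g. smult c' g \<in> H.gamma}" "y \<in> {g. smult c' g \<in> H.gamma}" for x y
        using that poly_module.subspace_add[OF H.gamma_subspace] by (simp add: smult_add_right)
      show "smult c' (smult a x) \<in> H.gamma" if "x \<in> {g. smult c' g \<in> H.gamma}" for a x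
        using that poly_module.subspace_scale[OF H.gamma_subspace, of "smult c' x" a]
        by (simp add: mult.commute)
    qed
  qed
  then have "c' \<in> H.ann H.gamma (poly_module.span ?S)" by (auto simp: H.ann_def)
  moreover have "H.gamma \<subseteq> poly_module.span ?S" using poly_module.span_superset by blast
  ultimately have "c \<in> H.ann H.gamma (poly_module.span ?S)" using b_minimal[OF st] c c'(1) by blast
  then have high: "smult c (f ^ (p ^ k)) \<in> H.gamma" if "n0 \<le> k" for k
    using that by (auto simp: H.ann_def intro: poly_module.span_base)
  have "smult c (f ^ (p ^ k)) \<in> H.gamma" for k
  proof (rule H.closed_Xn[OF H.gamma_closed, of n0])
    have "smult (c ^ (p ^ n0)) (f ^ (p ^ (k + n0))) \<in> H.gamma"
      using high[of "k + n0"] frob_pos[of n0] by (intro H.scale_pos_power_mem[OF H.gamma_subspace]) auto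
    then show "((\<lambda>f. f ^ p) ^^ n0) (smult c (f ^ (p ^ k))) \<in> H.gamma"
      by (simp add: Xn_power smult_power power_add power_mult)
  qed
  then show ?thesis by (rule gamma_hsl[OF _ n])
qed

lemma test_element:
  assumes c: "c \<in> b" "c \<in> R_circ"
  shows "weak_param_test_elem p m0 (c ^ (p ^ m0))"
  unfolding weak_param_test_elem_def
proof (intro conjI allI impI)
  show cR: "c ^ (p ^ m0) \<in> R_circ" using c(2) by (simp add: R_circ_iff reg_pow)
  fix I :: "'a set" and r :: 'a
  assume "parameter_ideal I"
  then obtain xs where xs: "I = R.span (set xs)" "enat (length xs) = ideal_height I" "I \<noteq> UNIV"
    by (auto simp: parameter_ideal_def ideal_simps)
  have xm: "set xs \<subseteq> m" "regs {0} xs"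
    using parameter_regs[of xs] xs by auto
  obtain ys where ys: "sop m d (xs @ ys)" using regs_extend_sop[OF xm] by blast
  have ym: "set ys \<subseteq> m" using ys by (auto simp: sop_def)
  show "r \<in> tight_closure p I \<longleftrightarrow> (\<forall>n\<ge>m0. c ^ (p ^ m0) * r ^ (p ^ n) \<in> frob_pow I (p ^ n))"
  proof
    assume "\<forall>n\<ge>m0. c ^ (p ^ m0) * r ^ (p ^ n) \<in> frob_pow I (p ^ n)"
    with cR show "r \<in> tight_closure p I" unfolding tight_closure_def by blast
  next
    assume "r \<in> tight_closure p I"
    then obtain c' n0 where c': "c' \<in> R_circ" "\<And>n. n0 \<le> n \<Longrightarrow> c' * r ^ (p ^ n) \<in> frob_pow I (p ^ n)"
      unfolding tight_closure_def by blast
    show "\<forall>n\<ge>m0. c ^ (p ^ m0) * r ^ (p ^ n) \<in> frob_pow I (p ^ n)"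
    proof (intro allI impI)
      fix n assume n: "m0 \<le> n"
      \<comment> \<open>The element is tested modulo \<open>xs\<close> together with arbitrarily
        high powers of the complementary parameters \<open>ys\<close>.\<close>
      have "c ^ (p ^ m0) * r ^ (p ^ n) \<in> R.span ((\<lambda>x. x ^ (p ^ n)) ` set xs)"
      proof (rule parameter_limit)
        show "set (map (\<lambda>y. y ^ (p ^ n)) ys) \<subseteq> m"
        proof -
          have "y ^ (p ^ n) \<in> m" if "y \<in> set ys" for y
          proof -
            have "y ^ (p ^ n) = y ^ (p ^ n - 1) * y" using frob_pos[of n] by (rule power_minus_mult[symmetric])
            then show ?thesis using ym that R.subspace_scale[OF m_subspace] by auto
          qed
          then show ?thesis by auto
        qed
        fix M
        define L where "L = xs @ map (\<lambda>y. y ^ Suc M) ys"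
        have "list_all2 is_power L (xs @ ys)"
          unfolding L_def
          by (intro list_all2_appendI powers_map) (simp_all add: list_all2_conv_all_nth is_power_refl)
        from sop_powers[OF ys this] obtain j u where
          u: "\<And>n z. z \<in> R.span ((\<lambda>x. x ^ (p ^ n)) ` set L) \<longleftrightarrow>
            u ^ (p ^ n) * z \<in> R.span ((\<lambda>x. x ^ (p ^ n)) ` (\<lambda>x. x ^ j) ` set as)"
          using sop_emb[OF sop] unfolding emb_def by blast
        have u': "z \<in> R.span ((\<lambda>x. x ^ (p ^ n)) ` set L) \<longleftrightarrow> u ^ (p ^ n) * z \<in> powideal as (j * p ^ n)" for n z
          unfolding u powideal_span by (simp add: image_image power_mult)
        \<comment> \<open>One multiplier u serves all k, so the single class of u * r records every
          Frobenius power of r modulo those of L.\<close>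
        have tst: "smult a (monom (u * r) j ^ (p ^ k)) \<in> Zr \<longleftrightarrow>
            a * r ^ (p ^ k) \<in> R.span ((\<lambda>x. x ^ (p ^ k)) ` set L)" for a k
          unfolding monom_frob u' by (simp add: power_mult_distrib mult_ac)
        have "smult (c ^ (p ^ m0)) (monom (u * r) j ^ (p ^ n)) \<in> Zr"
        proof (rule test_exponent[OF c(1) _ _ n])
          show "reg c' {0}" using c'(1) R_circ_iff by blast
          fix k assume "n0 \<le> k"
          then have "c' * r ^ (p ^ k) \<in> R.span ((\<lambda>x. x ^ (p ^ k)) ` set xs)"
            using c'(2) unfolding xs(1) frob_pow_span by blast
          moreover have "(\<lambda>x. x ^ (p ^ k)) ` set xs \<subseteq> (\<lambda>x. x ^ (p ^ k)) ` set L" by (auto simp: L_def)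
          ultimately show "smult c' (monom (u * r) j ^ (p ^ k)) \<in> Zr"
            unfolding tst using R.span_mono by blast
        qed
        then have "c ^ (p ^ m0) * r ^ (p ^ n) \<in> R.span ((\<lambda>x. x ^ (p ^ n)) ` set L)" by (simp only: tst)
        moreover have "(\<lambda>x. x ^ (p ^ n)) ` set L =
            (\<lambda>x. x ^ (p ^ n)) ` set xs \<union> (\<lambda>y. y ^ Suc M) ` set (map (\<lambda>y. y ^ (p ^ n)) ys)"
          by (simp add: L_def image_Un image_image mult.commute del: power_Suc flip: power_mult)
        ultimately show "c ^ (p ^ m0) * r ^ (p ^ n) \<in> R.span ((\<lambda>x. x ^ (p ^ n)) ` set xs \<union>
            (\<lambda>y. y ^ Suc M) ` set (map (\<lambda>y. y ^ (p ^ n)) ys))" by simp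
      qed
      then show "c ^ (p ^ m0) * r ^ (p ^ n) \<in> frob_pow I (p ^ n)" by (simp add: xs(1) frob_pow_span)
    qed
  qed
qed

lemma ex_test_element: "\<exists>c. weak_param_test_elem p m0 (c :: 'a)"
  using b_regular test_element R_circ_iff by blast

text \<open>Every \<open>r \<in> b\<close> is a difference of an element of \<open>b \<inter> R\<^sup>\<circ>\<close> and a multiple of another one.\<close>

lemma frob_pow_subset_test_ideal: "frob_pow b (p ^ m0) \<subseteq> weak_param_test_ideal p"
proof -
  define T where "T = (weak_param_test_ideal p :: 'a set)"
  have T: "R.subspace T" and in_T: "\<And>c w. weak_param_test_elem p w c \<Longrightarrow> c \<in> T"
    unfolding T_def weak_param_test_ideal_def ideal_simps by (auto intro: R.span_base)
  obtain c where c: "c \<in> b" "reg c {0}" using b_regular by blast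
  have power_T: "s ^ (p ^ m0) \<in> T" if "s \<in> b" "reg s {0}" for s
    using in_T[OF test_element] that by (simp add: R_circ_iff)
  have "r ^ (p ^ m0) \<in> T" if r: "r \<in> b" for r
  proof -
    obtain F where F: "finite F" "F \<subseteq> assoc_primes {0}" "\<And>y :: 'a. \<not> reg y {0} \<Longrightarrow> \<exists>P\<in>F. y \<in> P"
      using finite_assoc_primes[OF noeth R.subspace_single_0] by metis
    have "\<exists>t\<in>R.span {c}. \<forall>P\<in>F. r + t \<notin> P"
    proof (rule avoidance[OF F(1) _ R.subspace_span])
      fix P assume "P \<in> F"
      then have P: "P \<in> assoc_primes {0}" using F(2) by blast
      then show "prime_ideal P" by (simp add: assoc_primes_def)
      from P obtain v where v: "v \<noteq> 0" "P = colon {0} v" by (auto simp: assoc_primes_def)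
      then have "c \<notin> P" using c(2) by (auto simp: colon_def reg_def)
      then show "r \<notin> P \<or> \<not> R.span {c} \<subseteq> P" using R.span_base[of c "{c}"] by blast
    qed
    then obtain t where t: "t \<in> R.span {c}" "\<forall>P\<in>F. r + t \<notin> P" by blast
    then obtain k where k: "t = k * c" by (auto simp: R.span_singleton)
    have "reg (r + t) {0}" using F(3) t(2) by blast
    moreover have "r + t \<in> b"
      using r c(1) k R.subspace_add[OF b_subspace] R.subspace_scale[OF b_subspace] by blast
    ultimately have "(r + t) ^ (p ^ m0) \<in> T" by (intro power_T)
    moreover have "t ^ (p ^ m0) \<in> T"
      unfolding k power_mult_distrib by (rule R.subspace_scale[OF T power_T[OF c]])
    ultimately have "(r + t) ^ (p ^ m0) - t ^ (p ^ m0) \<in> T" by (rule R.subspace_diff[OF T])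
    then show ?thesis by (simp add: frob_add)
  qed
  then show ?thesis unfolding frob_pow_def ideal_gen_span T_def[symmetric]
    by (intro R.span_minimal T) blast
qed

lemma powideal_parameter: "1 \<le> j \<Longrightarrow> parameter_ideal (powideal as j)"
proof -
  assume j: "1 \<le> j"
  have s: "sop m d (map (\<lambda>a. a ^ j) as)" by (rule sop_powers[OF sop powers_map[OF j]])
  have I: "powideal as j = R.span (set (map (\<lambda>a. a ^ j) as))" by (simp add: powideal_span)
  have "powideal as j \<noteq> UNIV" unfolding I using sop_proper[OF s] m_one by blast
  moreover have "enat (length (map (\<lambda>a. a ^ j) as)) = ideal_height (powideal as j)"
    unfolding I sop_height[OF s] using s by (simp add: sop_def)
  ultimately show ?thesis
    unfolding parameter_ideal_def ideal_simps using I powideal_subspace by blast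
qed

text \<open>For a class [s] in N, a nonzerodivisor of \<open>b\<close> shows that s is in the tight
  closure of \<open>powideal as j\<close>. A test element c' then satisfies X^w (c' [s]) = 0, so c'
  [s] is torsion and c' annihilates N modulo \<open>gamma\<close>.\<close>

lemma test_ideal_subset: "weak_param_test_ideal p \<subseteq> b"
proof -
  obtain N where N: "H.stable N" "b = H.ann H.gamma N"
    using b_special by (auto simp: H.special_over_def)
  obtain c where c: "c \<in> b" "reg c {0}" using b_regular by blast
  have "c' \<in> b" if test: "weak_param_test_elem p w c'" for c' w
  proof -
    have "smult c' f \<in> H.gamma" if f: "f \<in> N" for f
    proof -
      obtain h where h: "1 \<le> snd h" "f - mon h \<in> Zr" using ex_mon by blast
      define s j where "s = fst h" and "j = snd h"
      have mon: "mon h = monom s j" by (simp add: mon_def s_def j_def)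
      have "mon h \<in> N"
        using f h(2) poly_module.mem_cong[OF H.stableD(1)[OF N(1)]] H.stableD(2)[OF N(1)] by blast
      then have "smult c (mon h ^ (p ^ n)) \<in> H.gamma" for n
        using c(1) H.stable_Xn[OF N(1), of "mon h" n] unfolding N(2) H.ann_def Xn_power by blast
      then have "smult (c ^ (p ^ m0)) (mon h ^ (p ^ n)) \<in> Zr" if "m0 \<le> n" for n
        by (rule gamma_hsl[OF _ that])
      then have "\<forall>n\<ge>m0. c ^ (p ^ m0) * s ^ (p ^ n) \<in> frob_pow (powideal as j) (p ^ n)"
        unfolding mon monom_frob powideal_frob by blast
      moreover have "c ^ (p ^ m0) \<in> R_circ" using c(2) by (simp add: R_circ_iff reg_pow)
      ultimately have "s \<in> tight_closure p (powideal as j)"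
        unfolding tight_closure_def by blast
      then have "c' * s ^ (p ^ w) \<in> frob_pow (powideal as j) (p ^ w)"
        using test powideal_parameter[of j] h(1) unfolding weak_param_test_elem_def j_def by blast
      then have "smult c' (mon h ^ (p ^ w)) \<in> Zr" unfolding mon monom_frob powideal_frob .
      \<comment> \<open>Replacing c' by its p^w-th power turns the expression into X^w applied to c'
        [s].\<close>
      then have "smult (c' ^ (p ^ w)) (mon h ^ (p ^ w)) \<in> Zr"
        using frob_pos[of w] by (intro H.scale_pos_power_mem[OF Zr_subspace])
      then have "((\<lambda>f. f ^ p) ^^ w) (smult c' (mon h)) \<in> Zr" by (simp add: Xn_power smult_power)
      then have "smult c' (mon h) \<in> H.gamma" unfolding H.gamma_def H.ker_def by blast
      moreover have "smult c' f - smult c' (mon h) \<in> Zr"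
        using poly_module.subspace_scale[OF Zr_subspace h(2), of c'] by (simp add: smult_diff_right)
      ultimately show ?thesis using gamma_cong by blast
    qed
    then show ?thesis unfolding N(2) H.ann_def by blast
  qed
  then show ?thesis
    unfolding weak_param_test_ideal_def ideal_simps
    using R.subspace_0[OF b_subspace] by (intro R.span_minimal b_subspace) blast
qed

end

end

theorem theorem4p5:
  fixes m :: "'a::comm_ring_1 set" and p d :: nat and as :: "'a list"
  assumes "prime p" and "CHAR('a) = p"
    and "noetherian_ring TYPE('a)"
    and "CM_local m d" and "d > 0"
    and "sop m d as"
  defines "m0 \<equiv> LEAST e. hsl_kills as p e"
  defines "q0 \<equiv> p ^ m0"
  shows "(\<exists>e. hsl_kills as p e) \<and>
    (\<exists>!b. b \<in> G_special_ideals as p \<and> ideal_height b \<ge> 1 \<and>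
          (\<forall>c\<in>G_special_ideals as p. ideal_height c \<ge> 1 \<longrightarrow> b \<subseteq> c)) \<and>
    (\<forall>b. b \<in> G_special_ideals as p \<and> ideal_height b \<ge> 1 \<and>
          (\<forall>c\<in>G_special_ideals as p. ideal_height c \<ge> 1 \<longrightarrow> b \<subseteq> c) \<longrightarrow>
        (\<forall>c\<in>b \<inter> R_circ. weak_param_test_elem p m0 (c ^ q0)) \<and>
        (\<exists>c::'a. weak_param_test_elem p m0 c) \<and>
        frob_pow b q0 \<subseteq> weak_param_test_ideal p \<and>
        weak_param_test_ideal p \<subseteq> b)"
proof -
  interpret cm_cohomology m d p as
    using assms by unfold_locales (auto simp: CM_local_def)
  have "\<exists>e. hsl_kills as p e" by (rule ex_hsl)
  moreover from this have hsl: "hsl_kills as p m0" unfolding m0_def by (rule LeastI_ex)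
  moreover note ex1_smallest_special
  ultimately show ?thesis
    unfolding q0_def smallest_special_def[symmetric]
    using test_element[OF hsl] ex_test_element[OF hsl] frob_pow_subset_test_ideal[OF hsl]
      test_ideal_subset[OF hsl] by blast
qed

end
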